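(* Let $\varepsilon>0$, $M>0$ and $\phi_0,\phi_T\in (L^2(\mathbb R))^4$ with $\|\phi_0\|=\|\phi_T\|$. Then there exists $T_0>0$ such that for all $T>T_0$ there exist controls $u_1,u_{1r},u_{1b},u_2,u_{2r},u_{2b}\in L^\infty((0,T),\mathbb C)$, each with $L^\infty$-norm smaller than $M$, such that the solution $\phi(t)$ of the two trapped ions system with initial datum $\phi(0)=\phi_0$ satisfies $$\|\phi(T)-\phi_T\|_{(L^2(\mathbb R))^4}<\varepsilon.$$
   Context: The state is $\phi=(\phi_{gg},\phi_{eg},\phi_{ge},\phi_{ee})\in (L^2(\mathbb R))^4$. Let $a=\frac{1}{\sqrt2}(x+\partial_x)$ and $a^\dagger=\frac{1}{\sqrt2}(x-\partial_x)$ be the annihilation and creation operators on $L^2(\mathbb R)$, and let $u^*$ denote the complex conjugate of $u\in\mathbb C$. The two trapped ions system, with complex-valued controls $u_1,u_{1r},u_{1b},u_2,u_{2r},u_{2b}$, is $$\begin{aligned} i\tfrac{d}{dt}\phi_{gg} &= (u_1+u_{1r}a^\dagger+u_{1b}a)\phi_{eg}+(u_2+u_{2r}a^\dagger+u_{2b}a)\phi_{ge},\\ i\tfrac{d}{dt}\phi_{eg} &= (u_1^*+u_{1r}^*a+u_{1b}^*a^\dagger)\phi_{gg}+(u_2+u_{2r}a^\dagger+u_{2b}a)\phi_{ee},\\ i\tfrac{d}{dt}\phi_{ge} &= (u_1+u_{1r}a^\dagger+u_{1b}a)\phi_{ee}+(u_2^*+u_{2r}^*a+u_{2b}^*a^\dagger)\phi_{gg},\\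 i\tfrac{d}{dt}\phi_{ee} &= (u_1^*+u_{1r}^*a+u_{1b}^*a^\dagger)\phi_{ge}+(u_2^*+u_{2r}^*a+u_{2b}^*a^\dagger)\phi_{eg}. \end{aligned}$$ The norm on $(L^2(\mathbb R))^4$ is the standard Hilbert norm. *)

theory Defs
  imports "HOL-Analysis.Analysis"
begin

datatype comp = GG | EG | GE | EE

type_synonym state = "comp \<Rightarrow> real \<Rightarrow> complex"

definition L2 :: "(real \<Rightarrow> complex) \<Rightarrow> bool" where
  "L2 f \<longleftrightarrow> f \<in> borel_measurable lborel \<and> integrable lborel (\<lambda>x. (cmod (f x))\<^sup>2)"

definition L2_4 :: "state \<Rightarrow> bool" where
  "L2_4 f \<longleftrightarrow> (\<forall>j. L2 (f j))"

definition norm4 :: "state \<Rightarrow> real" where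
  "norm4 f = sqrt (\<Sum>j\<in>{GG, EG, GE, EE}. \<integral>x. (cmod (f j x))\<^sup>2 \<partial>lborel)"

definition diff4 :: "state \<Rightarrow> state \<Rightarrow> state" where
  "diff4 f g = (\<lambda>j x. f j x - g j x)"

definition ip :: "(real \<Rightarrow> complex) \<Rightarrow> (real \<Rightarrow> complex) \<Rightarrow> complex" where
  "ip f g = (\<integral>x. f x * cnj (g x) \<partial>lborel)"

text \<open>Test functions: smooth compactly supported complex-valued functions on R,
  given together with the sequence of their derivatives.\<close>
definition test_fun :: "(nat \<Rightarrow> real \<Rightarrow> complex) \<Rightarrow> bool" where
  "test_fun D \<longleftrightarrow> (\<forall>n x. (D n has_vector_derivative D (Suc n) x) (at x))
     \<and> (\<exists>R. \<forall>x. \<bar>x\<bar> > R \<longrightarrow> D 0 x = 0)"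

definition ann :: "(nat \<Rightarrow> real \<Rightarrow> complex) \<Rightarrow> real \<Rightarrow> complex" where
  "ann D x = (of_real x * D 0 x + D 1 x) / of_real (sqrt 2)"

definition cre :: "(nat \<Rightarrow> real \<Rightarrow> complex) \<Rightarrow> real \<Rightarrow> complex" where
  "cre D x = (of_real x * D 0 x - D 1 x) / of_real (sqrt 2)"

text \<open>Weak pairing: the distribution (c + r a^dagger + b a) f tested against psi = D 0,
  i.e. c <f,psi> + r <f, a psi> + b <f, a^dagger psi>.\<close>
definition wk :: "complex \<Rightarrow> complex \<Rightarrow> complex \<Rightarrow> (real \<Rightarrow> complex)
                   \<Rightarrow> (nat \<Rightarrow> real \<Rightarrow> complex) \<Rightarrow> complex" where
  "wk c r b f D = c * ip f (D 0) + r * ip f (ann D) + b * ip f (cre D)"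

text \<open>Right-hand side of the two trapped ions system (component j at time s),
  tested against psi = D 0. Note u^* + r^* a + b^* a^dagger = (u^*) + (b^*) a^dagger + (r^*) a.\<close>
definition rhs ::
  "(real \<Rightarrow> complex) \<Rightarrow> (real \<Rightarrow> complex) \<Rightarrow> (real \<Rightarrow> complex) \<Rightarrow>
   (real \<Rightarrow> complex) \<Rightarrow> (real \<Rightarrow> complex) \<Rightarrow> (real \<Rightarrow> complex) \<Rightarrow>
   state \<Rightarrow> real \<Rightarrow> comp \<Rightarrow> (nat \<Rightarrow> real \<Rightarrow> complex) \<Rightarrow> complex" where
  "rhs u1 u1r u1b u2 u2r u2b f s j D =
    (case j of
      GG \<Rightarrow> wk (u1 s) (u1r s) (u1b s) (f EG) D + wk (u2 s) (u2r s) (u2b s) (f GE) D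
    | EG \<Rightarrow> wk (cnj (u1 s)) (cnj (u1b s)) (cnj (u1r s)) (f GG) D
           + wk (u2 s) (u2r s) (u2b s) (f EE) D
    | GE \<Rightarrow> wk (u1 s) (u1r s) (u1b s) (f EE) D
           + wk (cnj (u2 s)) (cnj (u2b s)) (cnj (u2r s)) (f GG) D
    | EE \<Rightarrow> wk (cnj (u1 s)) (cnj (u1b s)) (cnj (u1r s)) (f GE) D
           + wk (cnj (u2 s)) (cnj (u2b s)) (cnj (u2r s)) (f EG) D)"

text \<open>(Weak) solution on [0,T] with initial datum phi0: phi(t) in (L^2)^4,
  t \<mapsto> phi(t) continuous in (L^2)^4 on [0,T], phi(0) = phi0 in (L^2)^4, and the
  system holds in the distributional sense in x, integrated in time.\<close>
definition is_solution ::
  "(real \<Rightarrow> complex) \<Rightarrow> (real \<Rightarrow> complex) \<Rightarrow> (real \<Rightarrow> complex) \<Rightarrow>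
   (real \<Rightarrow> complex) \<Rightarrow> (real \<Rightarrow> complex) \<Rightarrow> (real \<Rightarrow> complex) \<Rightarrow>
   real \<Rightarrow> state \<Rightarrow> (real \<Rightarrow> state) \<Rightarrow> bool" where
  "is_solution u1 u1r u1b u2 u2r u2b T phi0 phi \<longleftrightarrow>
     (\<forall>t\<in>{0..T}. L2_4 (phi t))
   \<and> (\<forall>t\<in>{0..T}. ((\<lambda>s. norm4 (diff4 (phi s) (phi t))) \<longlongrightarrow> 0) (at t within {0..T}))
   \<and> norm4 (diff4 (phi 0) phi0) = 0
   \<and> (\<forall>D j t. test_fun D \<longrightarrow> t \<in> {0..T} \<longrightarrow>
        set_integrable lborel {0..t} (\<lambda>s. rhs u1 u1r u1b u2 u2r u2b (phi s) s j D)
      \<and> ip (phi t j) (D 0) = ip (phi 0 j) (D 0)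
           - \<i> * (LINT s:{0..t}|lborel. rhs u1 u1r u1b u2 u2r u2b (phi s) s j D))"

text \<open>Control in L^infinity((0,T),C) with L^infinity norm smaller than M
  (a representative bounded by some c < M on (0,T)).\<close>
definition Linf_ctrl :: "real \<Rightarrow> real \<Rightarrow> (real \<Rightarrow> complex) \<Rightarrow> bool" where
  "Linf_ctrl T M u \<longleftrightarrow> u \<in> borel_measurable lborel
     \<and> (\<exists>c<M. \<forall>t\<in>{0<..<T}. cmod (u t) \<le> c)"

end

theory Submission
  imports Defs
begin

text \<open>
  Driving one ion with \<open>u = z k0\<close>, \<open>u\<^sub>r = z (k1 + i k2) / sqrt 2\<close>, \<open>u\<^sub>b = z (k1 - i k2) / sqrt 2\<close>, \<open>|z| = 1\<close>,
  produces the Hamiltonian \<open>k0 + k1 x + k2 p\<close> coupled to a spin direction. It is diagonalised by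
  \<open>\<phi>\<^sub>g \<plusminus> z \<phi>\<^sub>e\<close>, which are multiplied by phases and translated in opposite directions; the weak
  solution is therefore explicit, and unique by duality with transported test functions.

  Products of such propagators contain spin rotations by angles affine in \<open>x\<close>. The angles
  that can be approximated form an algebra, since group commutators multiply them, and the algebra
  is closed under pointwise limits; by Weierstrass it contains the indicators of half-lines. Together with
  spin-dependent translations this suffices: shifting the levels of an ion apart and flipping one of them
  empties its excited level, and a step function in the ground state is folded, bin by bin, into
  a multiple of the indicator of one interval. Hence all states of equal norm reach a common
  state, and all propagators are invertible. Slow driving keeps the controls small.
\<close>

section \<open>Square-integrable functions\<close>

text \<open>The system has no drift: under zero controls the state stands still. Hence a trajectory
  can be run at any speed and prolonged by rest, which yields every \<open>T\<close> beyond
  \<open>T0\<close>. The obstacle is that x and p are unbounded. The equation is therefore posed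
  weakly, and driving one ion at a time with constant controls keeps it explicitly solvable;
  uniqueness is essential too, because the conclusion concerns every weak solution. For the same
  reason a rotation angle affine in x is small only locally, so the gates converge at each x but not
  uniformly. All approximation is thus strong, state by state, with dominated convergence in place
  of norm estimates. This suffices because propagators are isometries: errors do not grow under
  composition. Angles multiply because [i F sigma_x, i G sigma_y] = - 2 i F G sigma_z holds at each
  x, multiplication operators being commutative. Passing through a common state is legitimate
  because approximate reachability is an equivalence relation; conservation of the norm fixes the
  modulus of the final amplitude and a constant rotation its argument.\<close>

definition l2n :: "(real \<Rightarrow> complex) \<Rightarrow> real" where
  "l2n f = sqrt (\<integral>x. (cmod (f x))\<^sup>2 \<partial>lborel)"

lemma L2_measurable: "L2 f \<Longrightarrow> f \<in> borel_measurable borel"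
  by (simp add: L2_def)

lemma L2_integrable: "L2 f \<Longrightarrow> integrable lborel (\<lambda>x. (cmod (f x))\<^sup>2)"
  by (simp add: L2_def)

lemma L2_dominated:
  assumes "f \<in> borel_measurable borel" "integrable lborel (\<lambda>x. (w x)\<^sup>2)"
    and "AE x in lborel. cmod (f x) \<le> w x"
  shows "L2 f"
  unfolding L2_def
proof (intro conjI)
  show "f \<in> borel_measurable lborel" using assms by simp
  show "integrable lborel (\<lambda>x. (cmod (f x))\<^sup>2)"
  proof (rule Bochner_Integration.integrable_bound[OF assms(2)])
    show "(\<lambda>x. (cmod (f x))\<^sup>2) \<in> borel_measurable lborel" using assms(1) by simp
    show "AE x in lborel. norm ((cmod (f x))\<^sup>2) \<le> norm ((w x)\<^sup>2)"
      using assms(3) by eventually_elim (simp add: power_mono)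
  qed
qed

lemma power2_add_le: "(a + b)\<^sup>2 \<le> 2 * a\<^sup>2 + 2 * (b::real)\<^sup>2"
  using sum_squares_bound[of a b] by (simp add: power2_eq_square algebra_simps)

lemma cmod_add_sq_le: "(cmod (a + b))\<^sup>2 \<le> 2 * (cmod a)\<^sup>2 + 2 * (cmod b)\<^sup>2"
  using power2_add_le[of "cmod a" "cmod b"] power_mono[OF norm_triangle_ineq[of a b] norm_ge_zero, of 2]
  by linarith

lemma L2_add: assumes "L2 f" "L2 g" shows "L2 (\<lambda>x. f x + g x)"
  unfolding L2_def
proof (intro conjI)
  note [measurable] = L2_measurable[OF assms(1)] L2_measurable[OF assms(2)]
  show "(\<lambda>x. f x + g x) \<in> borel_measurable lborel" by simp
  show "integrable lborel (\<lambda>x. (cmod (f x + g x))\<^sup>2)"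
  proof (rule Bochner_Integration.integrable_bound)
    show "integrable lborel (\<lambda>x. 2 * (cmod (f x))\<^sup>2 + 2 * (cmod (g x))\<^sup>2)"
      using assms by (auto simp: L2_def)
    show "(\<lambda>x. (cmod (f x + g x))\<^sup>2) \<in> borel_measurable lborel" by simp
    show "AE x in lborel. norm ((cmod (f x + g x))\<^sup>2) \<le> norm (2 * (cmod (f x))\<^sup>2 + 2 * (cmod (g x))\<^sup>2)"
      using cmod_add_sq_le by auto
  qed
qed

lemma L2_mult_bounded:
  assumes "L2 f" "g \<in> borel_measurable borel" "\<And>x. cmod (g x) \<le> B"
  shows "L2 (\<lambda>x. g x * f x)"
proof (rule L2_dominated[where w="\<lambda>x. B * cmod (f x)"])
  show "(\<lambda>x. g x * f x) \<in> borel_measurable borel"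
    using assms(2) L2_measurable[OF assms(1)] by simp
  show "integrable lborel (\<lambda>x. (B * cmod (f x))\<^sup>2)"
    using L2_integrable[OF assms(1)] by (simp add: power_mult_distrib)
  show "AE x in lborel. cmod (g x * f x) \<le> B * cmod (f x)"
    using assms(3) by (simp add: norm_mult mult_right_mono)
qed

lemma L2_cmult: "L2 f \<Longrightarrow> L2 (\<lambda>x. c * f x)"
  by (rule L2_mult_bounded[where B="cmod c"]) auto

lemma L2_uminus: "L2 f \<Longrightarrow> L2 (\<lambda>x. - f x)"
  using L2_cmult[of f "-1"] by simp

lemma L2_diff: "L2 f \<Longrightarrow> L2 g \<Longrightarrow> L2 (\<lambda>x. f x - g x)"
  using L2_add[of f "\<lambda>x. - g x"] L2_uminus[of g] by simp

lemma L2_zero: "L2 (\<lambda>x. 0)"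
  by (simp add: L2_def)

lemma L2_sum: "finite S \<Longrightarrow> (\<And>i. i \<in> S \<Longrightarrow> L2 (f i)) \<Longrightarrow> L2 (\<lambda>x. \<Sum>i\<in>S. f i x)"
  by (induction S rule: finite_induct) (auto intro: L2_zero L2_add)

lemma l2n_nonneg [simp]: "0 \<le> l2n f"
  by (simp add: l2n_def)

lemma l2n_sq: "(l2n f)\<^sup>2 = (\<integral>x. (cmod (f x))\<^sup>2 \<partial>lborel)"
  by (simp add: l2n_def)

lemma l2n_cmult: "l2n (\<lambda>x. c * f x) = cmod c * l2n f"
  by (simp add: l2n_def norm_mult power_mult_distrib real_sqrt_mult)

lemma l2n_zero [simp]: "l2n (\<lambda>x. 0) = 0"
  by (simp add: l2n_def)

lemma l2n_minus_commute: "l2n (\<lambda>x. f x - g x) = l2n (\<lambda>x. g x - f x)"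
  by (simp add: l2n_def norm_minus_commute)

lemma l2n_eq_0_iff: assumes "L2 f" shows "l2n f = 0 \<longleftrightarrow> (AE x in lborel. f x = 0)"
  using integral_nonneg_eq_0_iff_AE[OF L2_integrable[OF assms]] by (simp add: l2n_def)

section \<open>The inner product and the Cauchy-Schwarz inequality\<close>

lemma ip_integrable: assumes "L2 f" "L2 g" shows "integrable lborel (\<lambda>x. f x * cnj (g x))"
proof (rule Bochner_Integration.integrable_bound)
  note [measurable] = L2_measurable[OF assms(1)] L2_measurable[OF assms(2)]
  show "integrable lborel (\<lambda>x. (cmod (f x))\<^sup>2 + (cmod (g x))\<^sup>2)"
    using assms by (auto simp: L2_def)
  have [measurable]: "(\<lambda>x. cnj (g x)) \<in> borel_measurable borel"
    by (rule measurable_compose[OF L2_measurable[OF assms(2)]])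
      (intro borel_measurable_continuous_onI continuous_intros)
  show "(\<lambda>x. f x * cnj (g x)) \<in> borel_measurable lborel" by simp
  have "norm (f x * cnj (g x)) \<le> (cmod (f x))\<^sup>2 + (cmod (g x))\<^sup>2" for x
    using sum_squares_bound[of "cmod (f x)" "cmod (g x)"] mult_nonneg_nonneg[OF norm_ge_zero[of "f x"] norm_ge_zero[of "g x"]]
    unfolding norm_mult complex_mod_cnj by linarith
  then show "AE x in lborel. norm (f x * cnj (g x)) \<le> norm ((cmod (f x))\<^sup>2 + (cmod (g x))\<^sup>2)"
    by simp
qed

lemma ip_add_left: "L2 f \<Longrightarrow> L2 g \<Longrightarrow> L2 h \<Longrightarrow> ip (\<lambda>x. f x + g x) h = ip f h + ip g h"
  unfolding ip_def by (simp add: distrib_right ip_integrable)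

lemma ip_diff_left: "L2 f \<Longrightarrow> L2 g \<Longrightarrow> L2 h \<Longrightarrow> ip (\<lambda>x. f x - g x) h = ip f h - ip g h"
  unfolding ip_def by (simp add: left_diff_distrib ip_integrable)

lemma ip_cmult_left: "ip (\<lambda>x. c * f x) h = c * ip f h"
  unfolding ip_def by (simp add: mult.assoc)

lemma ip_add_right: "L2 f \<Longrightarrow> L2 g \<Longrightarrow> L2 h \<Longrightarrow> ip f (\<lambda>x. g x + h x) = ip f g + ip f h"
  unfolding ip_def by (simp add: distrib_left ip_integrable)

lemma ip_diff_right: "L2 f \<Longrightarrow> L2 g \<Longrightarrow> L2 h \<Longrightarrow> ip f (\<lambda>x. g x - h x) = ip f g - ip f h"
  unfolding ip_def by (simp add: right_diff_distrib ip_integrable)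

lemma ip_cmult_right: "ip f (\<lambda>x. c * h x) = cnj c * ip f h"
proof -
  have "f x * cnj (c * h x) = cnj c * (f x * cnj (h x))" for x by simp
  then show ?thesis unfolding ip_def by (simp only: integral_mult_right_zero)
qed

text \<open>Integrating 2 (s|f|)(t|g|) <= s^2 |f|^2 + t^2 |g|^2 and choosing s =
  \<open>l2n g\<close>, t = \<open>l2n f\<close> gives the bound. If one norm vanishes, the
  integrand is zero almost everywhere.\<close>

lemma ip_Cauchy_Schwarz: assumes "L2 f" "L2 g" shows "cmod (ip f g) \<le> l2n f * l2n g"
proof -
  have i: "integrable lborel (\<lambda>x. cmod (f x) * cmod (g x))"
    using integrable_norm[OF ip_integrable[OF assms]] by (simp add: norm_mult)
  have "cmod (ip f g) \<le> (\<integral>x. cmod (f x) * cmod (g x) \<partial>lborel)" (is "_ \<le> ?I")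
    unfolding ip_def using integral_norm_bound[of lborel "\<lambda>x. f x * cnj (g x)"] by (simp add: norm_mult)
  also have "?I \<le> l2n f * l2n g"
  proof -
    have *: "2 * s * t * ?I \<le> s\<^sup>2 * (l2n f)\<^sup>2 + t\<^sup>2 * (l2n g)\<^sup>2" for s t :: real
    proof -
      have "2 * s * t * ?I = (\<integral>x. 2 * (s * cmod (f x)) * (t * cmod (g x)) \<partial>lborel)"
        by (subst integral_mult_right_zero[symmetric]) (simp add: algebra_simps)
      also have "\<dots> \<le> (\<integral>x. s\<^sup>2 * (cmod (f x))\<^sup>2 + t\<^sup>2 * (cmod (g x))\<^sup>2 \<partial>lborel)"
      proof (rule integral_mono)
        show "integrable lborel (\<lambda>x. 2 * (s * cmod (f x)) * (t * cmod (g x)))"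
          using integrable_mult_right[OF i, of "2 * s * t"] by (simp add: algebra_simps)
        show "integrable lborel (\<lambda>x. s\<^sup>2 * (cmod (f x))\<^sup>2 + t\<^sup>2 * (cmod (g x))\<^sup>2)"
          using assms by (auto simp: L2_def)
        show "2 * (s * cmod (f x)) * (t * cmod (g x)) \<le> s\<^sup>2 * (cmod (f x))\<^sup>2 + t\<^sup>2 * (cmod (g x))\<^sup>2" for x
          using sum_squares_bound[of "s * cmod (f x)" "t * cmod (g x)"] by (simp add: power_mult_distrib)
      qed
      also have "\<dots> = s\<^sup>2 * (l2n f)\<^sup>2 + t\<^sup>2 * (l2n g)\<^sup>2"
        using assms by (simp add: l2n_sq L2_def)
      finally show ?thesis .
    qed
    show ?thesis
    proof (cases "l2n f = 0 \<or> l2n g = 0")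
      case True
      have "?I = 0"
      proof -
        have "AE x in lborel. cmod (f x) * cmod (g x) = 0"
          using True l2n_eq_0_iff[OF assms(1)] l2n_eq_0_iff[OF assms(2)] by auto
        then show ?thesis by (rule integral_eq_zero_AE)
      qed
      then show ?thesis by simp
    next
      case False
      then have p: "l2n f > 0" "l2n g > 0" by (auto simp: less_le)
      have "2 * (l2n g * l2n f) * ?I \<le> 2 * (l2n g * l2n f) * (l2n f * l2n g)"
        using *[of "l2n g" "l2n f"] by (simp add: power2_eq_square algebra_simps)
      then show ?thesis using p by (simp add: mult_le_cancel_left)
    qed
  qed
  finally show ?thesis .
qed

lemma of_real_l2n_sq: "of_real ((l2n f)\<^sup>2) = ip f f"
  unfolding l2n_sq ip_def using complex_norm_square[symmetric]
  by (simp add: integral_complex_of_real[symmetric] del: of_real_power integral_complex_of_real)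

lemma l2n_triangle: assumes "L2 f" "L2 g" shows "l2n (\<lambda>x. f x + g x) \<le> l2n f + l2n g"
proof -
  let ?h = "\<lambda>x. f x + g x"
  have h: "L2 ?h" using assms by (rule L2_add)
  have "of_real ((l2n ?h)\<^sup>2) = ip f ?h + ip g ?h"
    unfolding of_real_l2n_sq by (rule ip_add_left[OF assms h])
  then have "(l2n ?h)\<^sup>2 \<le> cmod (ip f ?h + ip g ?h)"
    by (metis complex_Re_le_cmod Re_complex_of_real)
  also have "\<dots> \<le> l2n f * l2n ?h + l2n g * l2n ?h"
    using norm_triangle_ineq ip_Cauchy_Schwarz[OF assms(1) h] ip_Cauchy_Schwarz[OF assms(2) h]
    by (meson add_mono order_trans)
  finally have "l2n ?h * l2n ?h \<le> (l2n f + l2n g) * l2n ?h"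
    by (simp add: power2_eq_square distrib_right)
  then show ?thesis
    using l2n_nonneg[of ?h] l2n_nonneg[of f] l2n_nonneg[of g]
    by (metis mult_right_le_imp_le add_nonneg_nonneg le_less)
qed

text \<open>The limit inherits the majorant \<open>w\<close>, so the squared differences are bounded
  by \<open>4 * (w x)\<^sup>2\<close>. This one limit theorem serves truncation, step approximation,
  smoothing of indicators, difference quotients of the Weyl group and limits of gates.\<close>

lemma l2n_dominated_convergence:
  assumes [measurable]: "\<And>n. f n \<in> borel_measurable borel" "f0 \<in> borel_measurable borel"
    and w: "integrable lborel (\<lambda>x. (w x)\<^sup>2)"
    and lim: "AE x in lborel. (\<lambda>n. f n x) \<longlonglongrightarrow> f0 x"
    and bd: "\<And>n. AE x in lborel. cmod (f n x) \<le> w x"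
  shows "(\<lambda>n. l2n (\<lambda>x. f n x - f0 x)) \<longlonglongrightarrow> 0"
proof -
  have "AE x in lborel. \<forall>n. cmod (f n x) \<le> w x"
    using bd by (simp add: AE_all_countable)
  then have bd0: "AE x in lborel. cmod (f0 x) \<le> w x"
    using lim by eventually_elim (rule tendsto_upperbound[OF tendsto_norm], auto)
  have "(\<lambda>n. \<integral>x. (cmod (f n x - f0 x))\<^sup>2 \<partial>lborel) \<longlonglongrightarrow> (\<integral>x. (0::real) \<partial>(lborel::real measure))"
  proof (rule integral_dominated_convergence[where w="\<lambda>x. 4 * (w x)\<^sup>2"])
    show "integrable lborel (\<lambda>x. 4 * (w x)\<^sup>2)" using w by simp
    show "AE x in lborel. (\<lambda>n. (cmod (f n x - f0 x))\<^sup>2) \<longlonglongrightarrow> 0"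
      using lim
    proof eventually_elim
      case (elim x)
      then have "(\<lambda>n. (cmod (f n x - f0 x))\<^sup>2) \<longlonglongrightarrow> (cmod (f0 x - f0 x))\<^sup>2"
        by (intro tendsto_intros)
      then show ?case by simp
    qed
    show "AE x in lborel. norm ((cmod (f n x - f0 x))\<^sup>2) \<le> 4 * (w x)\<^sup>2" for n
      using bd[of n] bd0
    proof eventually_elim
      case (elim x)
      have "cmod (f n x - f0 x) \<le> 2 * w x"
        using norm_triangle_ineq4[of "f n x" "f0 x"] elim by linarith
      then show ?case using power_mono[of "cmod (f n x - f0 x)" "2 * w x" 2] by (simp add: power_mult_distrib)
    qed
  qed auto
  then have "(\<lambda>n. sqrt (\<integral>x. (cmod (f n x - f0 x))\<^sup>2 \<partial>lborel)) \<longlonglongrightarrow> sqrt 0"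
    by (intro tendsto_real_sqrt) simp
  then show ?thesis by (simp add: l2n_def)
qed

lemma square_integrable_indicator: "integrable lborel (\<lambda>x. (B * indicator {-R..R::real} x)\<^sup>2 :: real)"
proof -
  have "(\<lambda>x. (B * indicator {-R..R} x)\<^sup>2 :: real) = (\<lambda>x. B\<^sup>2 * indicator {-R..R} x)"
    by (auto simp: fun_eq_iff indicator_def)
  moreover have "integrable lborel (\<lambda>x. B\<^sup>2 * indicator {-R..R} x :: real)"
    by (intro integrable_mult_right integrable_real_indicator) (auto simp: emeasure_lborel_Icc_eq)
  ultimately show ?thesis by simp
qed

lemma L2_bounded_support:
  assumes "f \<in> borel_measurable borel" "\<And>x. cmod (f x) \<le> B" "\<And>x. \<bar>x\<bar> > R \<Longrightarrow> f x = 0"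
  shows "L2 f"
proof (rule L2_dominated[OF assms(1) square_integrable_indicator[of B R]])
  show "AE x in lborel. cmod (f x) \<le> B * indicator {-R..R} x"
    using assms(2,3) by (auto simp: indicator_def)
qed

lemma L2_continuous_support:
  fixes f :: "real \<Rightarrow> complex"
  assumes "continuous_on UNIV f" "\<And>x. \<bar>x\<bar> > R \<Longrightarrow> f x = 0"
  shows "L2 f"
proof -
  have "compact (f ` {-R..R})"
    by (intro compact_continuous_image continuous_on_subset[OF assms(1)]) auto
  then obtain B where B: "\<And>y. y \<in> f ` {-R..R} \<Longrightarrow> cmod y \<le> B"
    using compact_imp_bounded bounded_iff by metis
  have "cmod (f x) \<le> max B 0" for x
    using B[of "f x"] assms(2)[of x] by (cases "\<bar>x\<bar> > R") (auto simp: le_max_iff_disj not_less abs_le_iff)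
  then show ?thesis
    using L2_bounded_support[OF borel_measurable_continuous_onI[OF assms(1)], of "max B 0" R] assms(2) by blast
qed

lemma tendsto_0_less:
  fixes X :: "nat \<Rightarrow> real"
  assumes "X \<longlonglongrightarrow> 0" "e > 0" shows "\<exists>n. X n < e"
  using eventually_happens'[OF sequentially_bot order_tendstoD(2)[OF assms]] .

section \<open>Density of step functions\<close>

text \<open>All bins have the same width and are half-open, so that they tile an interval and one
  bin can later be slid exactly onto its neighbour.\<close>

definition step :: "real \<Rightarrow> real \<Rightarrow> (nat \<Rightarrow> complex) \<Rightarrow> nat \<Rightarrow> real \<Rightarrow> complex" where
  "step a d c n x = (\<Sum>k<n. c k * indicator {a + real k * d..<a + real (Suc k) * d} x)"

lemma step_inside:
  assumes "d > 0" "k < n" "a + real k * d \<le> x" "x < a + real (Suc k) * d"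
  shows "step a d c n x = c k"
proof -
  have uniq: "i = k" if "a + real i * d \<le> x" "x < a + real (Suc i) * d" for i
  proof -
    have "real i * d < real (Suc k) * d" "real k * d < real (Suc i) * d" using assms that by linarith+
    then have "real i < real (Suc k)" "real k < real (Suc i)"
      using assms(1) by (simp_all only: mult_less_cancel_right_pos)
    then show ?thesis by simp
  qed
  have "c i * indicator {a + real i * d..<a + real (Suc i) * d} x = (if i = k then c k else 0)" for i
    using uniq[of i] assms(3,4) by (cases "i = k") (auto simp del: of_nat_Suc simp: indicator_def)
  then have "step a d c n x = (\<Sum>i<n. if i = k then c k else 0)"
    unfolding step_def by (simp only:)
  then show ?thesis using assms(2) by simp
qed

lemma step_outside:
  assumes "d > 0" "x < a \<or> x \<ge> a + real n * d"
  shows "step a d c n x = 0"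
  unfolding step_def
proof (rule sum.neutral, intro ballI)
  fix k assume "k \<in> {..<n}"
  then have "real (Suc k) * d \<le> real n * d" "0 \<le> real k * d"
    using assms(1) by (auto intro!: mult_right_mono)
  then show "c k * indicator {a + real k * d..<a + real (Suc k) * d} x = 0"
    using assms(2) by (auto simp: indicator_def)
qed

lemma L2_indicator: "L2 (\<lambda>x. c * indicator {a..<b::real} x)"
  by (rule L2_bounded_support[where B="cmod c" and R="\<bar>a\<bar> + \<bar>b\<bar>"]) (auto simp: indicator_def)

lemma L2_step: "L2 (step a d c n)"
  unfolding step_def by (intro L2_sum L2_indicator) auto

lemma step_floor:
  assumes "d > 0" "a \<le> x" "x < a + real n * d"
  shows "\<exists>k<n. a + real k * d \<le> x \<and> x < a + real (Suc k) * d"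
proof -
  define k where "k = nat \<lfloor>(x - a) / d\<rfloor>"
  have *: "real k = of_int \<lfloor>(x - a) / d\<rfloor>" using assms by (simp add: k_def)
  have 1: "real k \<le> (x - a) / d" "(x - a) / d < real k + 1" using * by linarith+
  then have 2: "a + real k * d \<le> x" "x < a + real (Suc k) * d"
    using assms(1) by (simp_all add: field_simps)
  have "real k * d < real n * d" using 2 assms by linarith
  then have "k < n" using assms(1) by simp
  then show ?thesis using 2 by blast
qed

text \<open>Each bin carries the value of \<open>g\<close> at its left endpoint, whose distance from
  \<open>x\<close> is at most the bin width. The \<open>2 * N * Suc m\<close> bins fill exactly [-N,
  N).\<close>

lemma step_tendsto:
  fixes g :: "real \<Rightarrow> complex"
  assumes "continuous_on UNIV g"
  shows "(\<lambda>m. step (- real N) (1 / real (Suc m)) (\<lambda>k. g (- real N + real k * (1 / real (Suc m)))) (2 * N * Suc m) x)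
    \<longlonglongrightarrow> (if - real N \<le> x \<and> x < real N then g x else 0)"
proof -
  let ?s = "\<lambda>m. step (- real N) (1 / real (Suc m)) (\<lambda>k. g (- real N + real k * (1 / real (Suc m)))) (2 * N * Suc m) x"
  show ?thesis
  proof (cases "- real N \<le> x \<and> x < real N")
    case True
    have "\<exists>y. ?s m = g y
        \<and> \<bar>y - x\<bar> \<le> 1 / real (Suc m)" for m
    proof -
      let ?d = "1 / real (Suc m)"
      have "- real N + real (2 * N * Suc m) * ?d = real N" by (simp add: field_simps)
      then obtain k where k: "k < 2 * N * Suc m" "- real N + real k * ?d \<le> x" "x < - real N + real (Suc k) * ?d"
        using step_floor[of ?d "- real N" x "2 * N * Suc m"] True by auto
      then have "\<bar>(- real N + real k * ?d) - x\<bar> \<le> ?d"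
        by (simp add: algebra_simps add_divide_distrib)
      moreover have "step (- real N) ?d (\<lambda>k. g (- real N + real k * ?d)) (2 * N * Suc m) x = g (- real N + real k * ?d)"
        by (rule step_inside) (use k in auto)
      ultimately show ?thesis by blast
    qed
    then obtain y where y: "\<And>m. ?s m = g (y m)"
        "\<And>m. \<bar>y m - x\<bar> \<le> 1 / real (Suc m)" by metis
    have "(\<lambda>m. y m - x) \<longlonglongrightarrow> 0"
      by (rule Lim_null_comparison[OF _ LIMSEQ_Suc[OF lim_inverse_n]]) (use y(2) in \<open>auto simp: inverse_eq_divide\<close>)
    then have "y \<longlonglongrightarrow> x" by (simp add: LIM_zero_iff)
    then have "(\<lambda>m. g (y m)) \<longlonglongrightarrow> g x"
      using assms by (auto simp: continuous_on_eq_continuous_within intro: continuous_within_tendsto_compose')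
    then show ?thesis using True y(1) by simp
  next
    case False
    have "?s m = 0" for m
    proof (rule step_outside)
      have "- real N + real (2 * N * Suc m) * (1 / real (Suc m)) = real N" by (simp add: field_simps)
      then show "x < - real N \<or> - real N + real (2 * N * Suc m) * (1 / real (Suc m)) \<le> x"
        using False by linarith
    qed simp
    then show ?thesis using False by auto
  qed
qed

lemma step_bounded:
  assumes "d > 0" "\<And>k. cmod (c k) \<le> B" "B \<ge> 0"
  shows "cmod (step a d c n x) \<le> B"
proof (cases "a \<le> x \<and> x < a + real n * d")
  case True
  then obtain k where "k < n" "a + real k * d \<le> x" "x < a + real (Suc k) * d"
    using step_floor[of d a x n] assms(1) by auto
  then show ?thesis using step_inside[of d k n a x c] assms by simp
next
  case False
  then show ?thesis using step_outside[of d x a n c] assms by auto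
qed

text \<open>Three errors of size \<open>e / 3\<close>: truncation in height and support, passage to
  continuous functions, sampling on a grid. The width keeps the form \<open>1 / real (Suc m)\<close>
  so that a whole number of bins fills the unit interval, on which the reference state
  lives.\<close>

lemma step_dense:
  assumes f: "L2 f" and e: "e > 0"
  shows "\<exists>a m c n. l2n (\<lambda>x. f x - step a (1 / real (Suc m)) c n x) < e"
proof -
  have [measurable]: "f \<in> borel_measurable borel" using f by (rule L2_measurable)
  define F where "F N x = (if - real N \<le> x \<and> x < real N \<and> cmod (f x) \<le> real N then f x else 0)" for N x
  have [measurable]: "F N \<in> borel_measurable borel" for N unfolding F_def by measurable
  have "(\<lambda>N. l2n (\<lambda>x. F N x - f x)) \<longlonglongrightarrow> 0"
  proof (rule l2n_dominated_convergence[where w="\<lambda>x. cmod (f x)"])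
    show "AE x in lborel. (\<lambda>N. F N x) \<longlonglongrightarrow> f x"
    proof (rule AE_I2)
      fix x
      obtain N0 where N0: "real N0 > \<bar>x\<bar> + cmod (f x)" using reals_Archimedean2 by blast
      have "\<forall>\<^sub>F N in sequentially. F N x = f x"
        unfolding eventually_sequentially
      proof (intro exI allI impI)
        fix N assume "N0 \<le> N"
        then have "real N0 \<le> real N" by simp
        then have "\<bar>x\<bar> < real N" "cmod (f x) \<le> real N" using N0 norm_ge_zero[of "f x"] by linarith+
        then show "F N x = f x" by (auto simp: F_def)
      qed
      then show "(\<lambda>N. F N x) \<longlonglongrightarrow> f x" by (rule tendsto_eventually)
    qed
    show "AE x in lborel. cmod (F N x) \<le> cmod (f x)" for N by (simp add: F_def)
  qed (use f in \<open>auto simp: L2_def\<close>)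
  then have "\<forall>\<^sub>F N in sequentially. N \<ge> 1 \<and> l2n (\<lambda>x. F N x - f x) < e / 3"
    using order_tendstoD(2)[of "\<lambda>N. l2n (\<lambda>x. F N x - f x)" 0 sequentially "e / 3"] e
    by (intro eventually_conj eventually_ge_at_top) auto
  then obtain N where N: "N \<ge> 1" "l2n (\<lambda>x. F N x - f x) < e / 3"
    using eventually_happens'[OF sequentially_bot] by blast
  have F_bd: "cmod (F N x) \<le> real N" for x by (simp add: F_def)
  have LF: "L2 (F N)"
    by (rule L2_bounded_support[where B="real N" and R="real N"]) (auto simp: F_def)
  \<comment> \<open>Measurability in this sense supplies continuous functions converging off a
    negligible set, but no bound on them.\<close>
  have "F N measurable_on UNIV"
    by (intro lebesgue_measurable_imp_measurable_on) (auto intro: borel_measurable_if_D measurable_completion)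
  then obtain Z g where Z: "negligible Z" and g: "\<And>n. continuous_on UNIV (g n)"
      and gl: "\<And>x. x \<notin> Z \<Longrightarrow> (\<lambda>n. g n x) \<longlonglongrightarrow> F N x"
    unfolding measurable_on_def by auto
  \<comment> \<open>Radial retraction onto the disc of radius \<open>N\<close>. It is continuous and
    fixes the values of \<open>F N\<close>, so clipping \<open>g n\<close> creates a majorant
    without changing the limit.\<close>
  define cl :: "complex \<Rightarrow> complex" where "cl z = z * of_real (real N / max (real N) (cmod z))" for z
  have Npos: "real N > 0" using N by simp
  have cl_cont: "continuous_on UNIV cl"
    unfolding cl_def using Npos by (intro continuous_intros) (auto simp: max_def)
  have cl_id: "cl z = z" if "cmod z \<le> real N" for z
    using that Npos by (simp add: cl_def max_absorb1)
  have cl_bd: "cmod (cl z) \<le> real N" for z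
    using Npos by (auto simp: cl_def norm_mult max_def field_simps norm_divide)
  define h where "h n x = cl (g n x)" for n x
  have h_cont: "continuous_on UNIV (h n)" for n
    unfolding h_def using continuous_on_compose2[OF cl_cont g] by auto
  have [measurable]: "h n \<in> borel_measurable borel" for n
    using h_cont by (rule borel_measurable_continuous_onI)
  define H where "H n x = (if - real N \<le> x \<and> x < real N then h n x else 0)" for n x
  have [measurable]: "H n \<in> borel_measurable borel" for n unfolding H_def by measurable
  have LH: "L2 (H n)" for n
    by (rule L2_bounded_support[where B="real N" and R="real N"]) (auto simp: H_def h_def cl_bd)
  have "(\<lambda>n. l2n (\<lambda>x. H n x - F N x)) \<longlonglongrightarrow> 0"
  proof (rule l2n_dominated_convergence[OF _ _ square_integrable_indicator[of "real N" "real N"]])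
    have "AE x in lebesgue. x \<notin> Z" using Z by (simp add: AE_not_in negligible_iff_null_sets)
    then have "AE x in lborel. x \<notin> Z" by (simp add: AE_completion_iff)
    then show "AE x in lborel. (\<lambda>n. H n x) \<longlonglongrightarrow> F N x"
    proof eventually_elim
      case (elim x)
      have "(\<lambda>n. cl (g n x)) \<longlonglongrightarrow> cl (F N x)"
        using gl[OF elim] cl_cont
        by (auto simp: continuous_on_eq_continuous_within intro: continuous_within_tendsto_compose')
      then have "(\<lambda>n. h n x) \<longlonglongrightarrow> F N x" using cl_id[OF F_bd] by (simp add: h_def)
      then show ?case
        by (cases "- real N \<le> x \<and> x < real N") (auto simp: H_def F_def)
    qed
    show "AE x in lborel. cmod (H n x) \<le> real N * indicator {- real N..real N} x" for n
      by (auto simp: H_def h_def cl_bd indicator_def)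
  qed auto
  then obtain n where n: "l2n (\<lambda>x. H n x - F N x) < e / 3"
    using tendsto_0_less[of _ "e / 3"] e by auto
  define S where "S m = step (- real N) (1 / real (Suc m)) (\<lambda>k. h n (- real N + real k * (1 / real (Suc m)))) (2 * N * Suc m)" for m
  have LS: "L2 (S m)" for m unfolding S_def by (rule L2_step)
  have "(\<lambda>m. l2n (\<lambda>x. S m x - H n x)) \<longlonglongrightarrow> 0"
  proof (rule l2n_dominated_convergence[OF _ _ square_integrable_indicator[of "real N" "real N"]])
    show "AE x in lborel. (\<lambda>m. S m x) \<longlonglongrightarrow> H n x"
      unfolding S_def H_def using step_tendsto[OF h_cont] by auto
    have "cmod (S m x) \<le> real N" for m x
      unfolding S_def by (rule step_bounded) (auto simp: h_def cl_bd)
    moreover have "S m x = 0" if "x \<notin> {- real N..real N}" for m x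
      unfolding S_def
    proof (rule step_outside)
      have "- real N + real (2 * N * Suc m) * (1 / real (Suc m)) = real N" by (simp add: field_simps)
      then show "x < - real N \<or> - real N + real (2 * N * Suc m) * (1 / real (Suc m)) \<le> x"
        using that by (simp only: atLeastAtMost_iff) linarith
    qed simp
    ultimately show "AE x in lborel. cmod (S m x) \<le> real N * indicator {- real N..real N} x" for m
      by (auto simp: indicator_def)
  qed (use LS L2_measurable in auto)
  then obtain m where m: "l2n (\<lambda>x. S m x - H n x) < e / 3"
    using tendsto_0_less[of _ "e / 3"] e by auto
  have "l2n (\<lambda>x. f x - S m x) = l2n (\<lambda>x. (f x - F N x) + ((F N x - H n x) + (H n x - S m x)))"
    by simp
  also have "\<dots> \<le> l2n (\<lambda>x. f x - F N x) + l2n (\<lambda>x. (F N x - H n x) + (H n x - S m x))"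
    by (intro l2n_triangle L2_add L2_diff f LF LH LS)
  also have "l2n (\<lambda>x. (F N x - H n x) + (H n x - S m x)) \<le> l2n (\<lambda>x. F N x - H n x) + l2n (\<lambda>x. H n x - S m x)"
    by (intro l2n_triangle L2_add L2_diff f LF LH LS)
  finally have "l2n (\<lambda>x. f x - S m x) < e"
    using N(2) n m by (simp add: l2n_minus_commute[of f] l2n_minus_commute[of "F N" "H n"] l2n_minus_commute[of "H n" "S m"])
  then show ?thesis unfolding S_def by blast
qed

section \<open>Density of test functions\<close>

text \<open>The factors \<open>1 / x ^ n\<close> make the family closed under differentiation up to
  linear combinations.\<close>

definition flat :: "real \<Rightarrow> nat \<Rightarrow> real \<Rightarrow> real" where
  "flat c n x = (if x > 0 then exp (- c / x) / x ^ n else 0)"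

text \<open>In the variable y = c / h the limit from the right is that of y^(n+1) exp (-y) at
  infinity. It yields derivative zero at the origin, the only point where differentiability is in
  doubt.\<close>

lemma flat_quotient_tendsto:
  assumes "c > 0" shows "((\<lambda>h. flat c n h / h) \<longlongrightarrow> 0) (at 0)"
proof -
  have "LIM h at_right 0. c / h :> at_top"
    using filterlim_tendsto_pos_mult_at_top[OF tendsto_const assms filterlim_inverse_at_top_right]
    by (simp add: divide_inverse)
  then have "((\<lambda>h. (c / h) ^ Suc n / exp (c / h)) \<longlongrightarrow> 0) (at_right 0)"
    by (rule filterlim_compose[OF tendsto_power_div_exp_0])
  then have "((\<lambda>h. (1 / c ^ Suc n) * ((c / h) ^ Suc n / exp (c / h))) \<longlongrightarrow> 0) (at_right 0)"
    by (rule tendsto_mult_right_zero)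
  then have "((\<lambda>h. flat c n h / h) \<longlongrightarrow> 0) (at_right 0)"
  proof (rule Lim_transform_eventually)
    have "\<forall>\<^sub>F h in at_right 0. h > (0::real)" by (simp add: eventually_at_filter)
    then show "\<forall>\<^sub>F h in at_right 0. 1 / c ^ Suc n * ((c / h) ^ Suc n / exp (c / h)) = flat c n h / h"
    proof eventually_elim
      case (elim h)
      then show ?case using assms by (simp add: flat_def power_divide exp_minus field_simps)
    qed
  qed
  moreover have "((\<lambda>h. flat c n h / h) \<longlongrightarrow> 0) (at_left 0)"
  proof (rule tendsto_eventually)
    have "\<forall>\<^sub>F h in at_left 0. h < (0::real)" by (simp add: eventually_at_filter)
    then show "\<forall>\<^sub>F h in at_left 0. flat c n h / h = 0" by eventually_elim (simp add: flat_def)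
  qed
  ultimately show ?thesis by (simp add: filterlim_split_at)
qed

lemma flat_deriv:
  assumes "c > 0"
  shows "(flat c n has_real_derivative (c * flat c (n + 2) x - real n * flat c (n + 1) x)) (at x)"
proof -
  consider "x > 0" | "x < 0" | "x = 0" by linarith
  then show ?thesis
  proof cases
    case 1
    have "((\<lambda>x. exp (- c / x) / x ^ n) has_real_derivative (c * flat c (n + 2) x - real n * flat c (n + 1) x)) (at x)"
      using 1 by (auto intro!: derivative_eq_intros simp: flat_def)
        (cases n; simp add: field_simps power2_eq_square)
    then show ?thesis
      by (rule DERIV_cong_ev[OF refl _ refl, THEN iffD1, rotated])
        (use eventually_nhds_in_open[of "{0<..}" x] 1 in \<open>auto simp: flat_def elim!: eventually_mono\<close>)
  next
    case 2
    have "((\<lambda>x. 0) has_real_derivative (c * flat c (n + 2) x - real n * flat c (n + 1) x)) (at x)"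
      using 2 by (simp add: flat_def)
    then show ?thesis
      by (rule DERIV_cong_ev[OF refl _ refl, THEN iffD1, rotated])
        (use eventually_nhds_in_open[of "{..<0}" x] 2 in \<open>auto simp: flat_def elim!: eventually_mono\<close>)
  next
    case 3
    then show ?thesis using flat_quotient_tendsto[OF assms, of n]
      by (simp add: has_field_derivative_iff flat_def)
  qed
qed

text \<open>A class that contains a derivative of each of its members. The infinite tower of
  derivatives demanded by \<open>test_fun\<close> then comes from closure and dependent choice,
  without formulas for higher derivatives.\<close>

inductive smooth_bump :: "(real \<Rightarrow> real) \<Rightarrow> bool" where
  flat_left: "c > 0 \<Longrightarrow> smooth_bump (\<lambda>x. flat c n (x - a))"
| flat_right: "c > 0 \<Longrightarrow> smooth_bump (\<lambda>x. flat c n (a - x))"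
| add: "smooth_bump f \<Longrightarrow> smooth_bump g \<Longrightarrow> smooth_bump (\<lambda>x. f x + g x)"
| mult: "smooth_bump f \<Longrightarrow> smooth_bump g \<Longrightarrow> smooth_bump (\<lambda>x. f x * g x)"
| scale: "smooth_bump f \<Longrightarrow> smooth_bump (\<lambda>x. k * f x)"

lemma smooth_bump_deriv:
  "smooth_bump f \<Longrightarrow> \<exists>f'. smooth_bump f' \<and> (\<forall>x. (f has_real_derivative f' x) (at x))"
proof (induction rule: smooth_bump.induct)
  case (flat_left c n a)
  have "smooth_bump (\<lambda>x. c * flat c (n + 2) (x - a) + (- real n) * flat c (n + 1) (x - a))"
    using flat_left by (intro smooth_bump.intros)
  moreover have "((\<lambda>x. flat c n (x - a)) has_real_derivative (c * flat c (n + 2) (x - a) + (- real n) * flat c (n + 1) (x - a))) (at x)" for x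
  proof -
    have "((\<lambda>x. x - a) has_real_derivative 1) (at x)" by (auto intro!: derivative_eq_intros)
    from DERIV_chain2[where f="flat c n" and g="\<lambda>x. x - a" and x=x, OF flat_deriv[OF flat_left] this]
    show ?thesis by (simp add: algebra_simps)
  qed
  ultimately show ?case by blast
next
  case (flat_right c n a)
  have "smooth_bump (\<lambda>x. (- c) * flat c (n + 2) (a - x) + real n * flat c (n + 1) (a - x))"
    using flat_right by (intro smooth_bump.intros)
  moreover have "((\<lambda>x. flat c n (a - x)) has_real_derivative ((- c) * flat c (n + 2) (a - x) + real n * flat c (n + 1) (a - x))) (at x)" for x
  proof -
    have "((\<lambda>x. a - x) has_real_derivative -1) (at x)" by (auto intro!: derivative_eq_intros)
    from DERIV_chain2[where f="flat c n" and g="\<lambda>x. a - x" and x=x, OF flat_deriv[OF flat_right] this]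
    show ?thesis by (simp add: algebra_simps)
  qed
  ultimately show ?case by blast
next
  case (add f g)
  then obtain f' g' where "smooth_bump f'" "\<forall>x. (f has_real_derivative f' x) (at x)"
    "smooth_bump g'" "\<forall>x. (g has_real_derivative g' x) (at x)" by blast
  then show ?case
    by (intro exI[of _ "\<lambda>x. f' x + g' x"]) (auto intro!: smooth_bump.intros derivative_intros)
next
  case (mult f g)
  then obtain f' g' where "smooth_bump f'" "\<forall>x. (f has_real_derivative f' x) (at x)"
    "smooth_bump g'" "\<forall>x. (g has_real_derivative g' x) (at x)" by blast
  then show ?case using mult.hyps
    by (intro exI[of _ "\<lambda>x. f' x * g x + g' x * f x"]) (auto intro!: smooth_bump.intros DERIV_mult)
next
  case (scale f k)
  then obtain f' where "smooth_bump f'" "\<forall>x. (f has_real_derivative f' x) (at x)" by blast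
  then show ?case
    by (intro exI[of _ "\<lambda>x. k * f' x"]) (auto intro!: smooth_bump.intros DERIV_cmult)
qed

lemma smooth_bump_test_fun:
  assumes "smooth_bump f" "\<And>x. \<bar>x\<bar> > R \<Longrightarrow> f x = 0"
  shows "\<exists>D. test_fun D \<and> D 0 = (\<lambda>x. of_real (f x))"
proof -
  have "\<exists>F. \<forall>n. (smooth_bump (F n) \<and> (n = 0 \<longrightarrow> F n = f)) \<and> (\<forall>x. (F n has_real_derivative F (Suc n) x) (at x))"
  proof (rule dependent_nat_choice)
    show "\<exists>x. smooth_bump x \<and> (0 = 0 \<longrightarrow> x = f)" using assms by blast
    show "\<exists>y. (smooth_bump y \<and> (Suc n = 0 \<longrightarrow> y = f)) \<and> (\<forall>z. (x has_real_derivative y z) (at z))"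
      if "smooth_bump x \<and> (n = 0 \<longrightarrow> x = f)" for x n
      using smooth_bump_deriv that by blast
  qed
  then obtain F where F: "F 0 = f" "\<And>n x. (F n has_real_derivative F (Suc n) x) (at x)" by blast
  have "test_fun (\<lambda>n x. complex_of_real (F n x))"
    unfolding test_fun_def
  proof (intro conjI allI exI[of _ R] impI)
    fix n x
    show "((\<lambda>x. complex_of_real (F n x)) has_vector_derivative complex_of_real (F (Suc n) x)) (at x)"
      using F(2)[of n x] by (intro has_vector_derivative_of_real) (simp add: has_real_derivative_iff_has_vector_derivative)
  qed (use F(1) assms(2) in auto)
  then show ?thesis using F(1) by (intro exI[of _ "\<lambda>n x. complex_of_real (F n x)"]) auto
qed

section \<open>Supports and linearity of test functions, and approximation by them\<close>

lemma test_fun_continuous: assumes "test_fun D" shows "continuous_on UNIV (D n)"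
proof (rule continuous_at_imp_continuous_on, intro ballI)
  show "isCont (D n) x" for x
    using assms has_vector_derivative_continuous[of "D n" "D (Suc n) x" x UNIV] by (simp add: test_fun_def)
qed

text \<open>One \<open>R\<close> serves all derivatives: outside [-R, R] a function of the tower
  vanishes on an open set, hence so does the next one.\<close>

lemma test_fun_support:
  assumes "test_fun D" shows "\<exists>R\<ge>0. \<forall>n x. \<bar>x\<bar> > R \<longrightarrow> D n x = 0"
proof -
  obtain R where R: "\<And>x. \<bar>x\<bar> > R \<Longrightarrow> D 0 x = 0" using assms by (auto simp: test_fun_def)
  have "\<forall>x. \<bar>x\<bar> > R \<longrightarrow> D n x = 0" for n
  proof (induction n)
    case (Suc n)
    show ?case
    proof (intro allI impI)
      fix x :: real assume x: "\<bar>x\<bar> > R"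
      have d: "(D n has_vector_derivative D (Suc n) x) (at x)" using assms by (simp add: test_fun_def)
      have "open {y::real. R < \<bar>y\<bar>}" by (intro open_Collect_less continuous_intros)
      then have "((\<lambda>_. 0) has_vector_derivative D (Suc n) x) (at x)"
        by (rule has_vector_derivative_transform_within_open[OF d]) (use x Suc in auto)
      then show "D (Suc n) x = 0"
        using vector_derivative_unique_at has_vector_derivative_const by blast
    qed
  qed (use R in auto)
  then show ?thesis by (intro exI[of _ "max R 0"]) auto
qed

lemma test_fun_L2: assumes "test_fun D" shows "L2 (D n)" "L2 (\<lambda>x. of_real x * D n x)"
proof -
  obtain R where R: "\<And>n x. \<bar>x\<bar> > R \<Longrightarrow> D n x = 0" using test_fun_support[OF assms] by blast
  show "L2 (D n)" using R by (intro L2_continuous_support[OF test_fun_continuous[OF assms]])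
  show "L2 (\<lambda>x. of_real x * D n x)"
    using R by (intro L2_continuous_support continuous_intros test_fun_continuous[OF assms]) auto
qed

lemma test_fun_lincomb:
  assumes "test_fun D" "test_fun E" shows "test_fun (\<lambda>n x. c * D n x + E n x)"
proof -
  obtain R S where "\<And>x. \<bar>x\<bar> > R \<Longrightarrow> D 0 x = 0" "\<And>x. \<bar>x\<bar> > S \<Longrightarrow> E 0 x = 0"
    using assms by (auto simp: test_fun_def)
  then have "\<forall>x. \<bar>x\<bar> > max R S \<longrightarrow> c * D 0 x + E 0 x = 0" by auto
  then have "\<exists>R. \<forall>x. \<bar>x\<bar> > R \<longrightarrow> c * D 0 x + E 0 x = 0" by blast
  then show ?thesis using assms
    by (auto simp: test_fun_def intro!: derivative_intros has_vector_derivative_mult_right)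
qed

lemma test_fun_zero: "test_fun (\<lambda>n x. 0)"
  by (auto simp: test_fun_def)

text \<open>The bumps exp (- c / (x - a)) exp (- c / (b - x)) with c = 1 / (m + 1) stay between 0
  and 1 and tend to 1 on the open interval as c tends to 0.\<close>

lemma test_approx_indicator:
  assumes "a < b" "e > 0"
  shows "\<exists>D. test_fun D \<and> l2n (\<lambda>x. D 0 x - indicator {a..<b} x) < e"
proof -
  define B where "B m x = flat (1 / real (Suc m)) 0 (x - a) * flat (1 / real (Suc m)) 0 (b - x)" for m x
  have sB: "smooth_bump (B m)" for m unfolding B_def by (intro smooth_bump.intros) auto
  have supp: "B m x = 0" if "\<bar>x\<bar> > \<bar>a\<bar> + \<bar>b\<bar>" for m x
    using that by (auto simp: B_def flat_def)
  have cont: "continuous_on UNIV (B m)" for m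
    using smooth_bump_deriv[OF sB] by (meson DERIV_continuous continuous_at_imp_continuous_on)
  have "(\<lambda>m. l2n (\<lambda>x. complex_of_real (B m x) - indicator {a..<b} x)) \<longlonglongrightarrow> 0"
  proof (rule l2n_dominated_convergence[OF _ _ square_integrable_indicator[of 1 "\<bar>a\<bar> + \<bar>b\<bar>"]])
    show "(\<lambda>x. complex_of_real (B m x)) \<in> borel_measurable borel" for m
      by (intro borel_measurable_continuous_onI continuous_intros cont)
    \<comment> \<open>At \<open>a\<close> the bumps vanish while the half-open indicator is 1; this
      null set is discarded.\<close>
    have "AE x in lborel. x \<noteq> a" by (rule AE_lborel_singleton)
    then show "AE x in lborel. (\<lambda>m. complex_of_real (B m x)) \<longlonglongrightarrow> indicator {a..<b} x"
    proof eventually_elim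
      case (elim x)
      show ?case
      proof (cases "a < x \<and> x < b")
        case True
        have "(\<lambda>m. exp (- (1 / real (Suc m)) / y)) \<longlonglongrightarrow> 1" for y :: real
        proof -
          have "(\<lambda>m. exp (- (1 / real (Suc m)) / y)) \<longlonglongrightarrow> exp (- 0 / y)"
            unfolding divide_inverse[of _ y]
            by (intro tendsto_intros LIMSEQ_Suc[OF lim_inverse_n'])
          then show ?thesis by simp
        qed
        then have "(\<lambda>m. complex_of_real (exp (- (1 / real (Suc m)) / (x - a)) * exp (- (1 / real (Suc m)) / (b - x)))) \<longlonglongrightarrow> of_real (1 * 1)"
          by (intro tendsto_intros)
        then show ?thesis using True by (simp add: B_def flat_def indicator_def)
      next
        case False
        then show ?thesis using elim by (auto simp: B_def flat_def indicator_def)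
      qed
    qed
    show "AE x in lborel. cmod (complex_of_real (B m x)) \<le> 1 * indicator {- (\<bar>a\<bar> + \<bar>b\<bar>)..\<bar>a\<bar> + \<bar>b\<bar>} x" for m
    proof (rule AE_I2)
      fix x
      have "0 \<le> flat (1 / real (Suc m)) 0 y \<and> flat (1 / real (Suc m)) 0 y \<le> 1" for y
        by (auto simp: flat_def)
      then have "\<bar>B m x\<bar> \<le> 1" unfolding B_def by (simp add: abs_mult mult_le_one)
      then show "cmod (complex_of_real (B m x)) \<le> 1 * indicator {- (\<bar>a\<bar> + \<bar>b\<bar>)..\<bar>a\<bar> + \<bar>b\<bar>} x"
        using supp[of x m] by (auto simp: indicator_def)
    qed
  qed auto
  then obtain m where "l2n (\<lambda>x. complex_of_real (B m x) - indicator {a..<b} x) < e"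
    using tendsto_0_less assms(2) by blast
  moreover obtain D where "test_fun D" "D 0 = (\<lambda>x. complex_of_real (B m x))"
    using smooth_bump_test_fun[of "B m" "\<bar>a\<bar> + \<bar>b\<bar>"] sB supp by auto
  ultimately show ?thesis by (intro exI[of _ D]) simp
qed

lemma test_approx_step:
  assumes "d > 0"
  shows "e > 0 \<Longrightarrow> \<exists>D. test_fun D \<and> l2n (\<lambda>x. D 0 x - step a d c n x) < e"
proof (induction n arbitrary: e)
  case 0
  then show ?case by (intro exI[of _ "\<lambda>n x. 0"]) (auto simp: step_def test_fun_zero)
next
  case (Suc n)
  let ?I = "{a + real n * d..<a + real (Suc n) * d}"
  have "e / 2 > 0" using Suc by simp
  from Suc.IH[OF this] obtain E where E: "test_fun E" "l2n (\<lambda>x. E 0 x - step a d c n x) < e / 2" by auto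
  have "a + real n * d < a + real (Suc n) * d" using assms by simp
  moreover have "e / (2 * (cmod (c n) + 1)) > 0"
    using Suc.prems norm_ge_zero[of "c n"] by (intro divide_pos_pos) (simp_all add: add_nonneg_pos)
  ultimately obtain D where D: "test_fun D" "l2n (\<lambda>x. D 0 x - indicator ?I x) < e / (2 * (cmod (c n) + 1))"
    using test_approx_indicator by blast
  have i: "L2 (indicator ?I)" using L2_indicator[of 1] by simp
  have "l2n (\<lambda>x. (c n * D 0 x + E 0 x) - step a d c (Suc n) x)
      = l2n (\<lambda>x. c n * (D 0 x - indicator ?I x) + (E 0 x - step a d c n x))"
    by (simp add: step_def algebra_simps)
  also have "\<dots> \<le> l2n (\<lambda>x. c n * (D 0 x - indicator ?I x)) + l2n (\<lambda>x. E 0 x - step a d c n x)"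
    by (intro l2n_triangle L2_cmult L2_diff test_fun_L2 D E i L2_step)
  also have "\<dots> < e"
  proof -
    have "cmod (c n) * l2n (\<lambda>x. D 0 x - indicator ?I x) \<le> (cmod (c n) + 1) * (e / (2 * (cmod (c n) + 1)))"
      using D(2) by (intro mult_mono) auto
    also have "\<dots> = e / 2" using add_nonneg_pos[OF norm_ge_zero[of "c n"] zero_less_one] by (simp add: field_simps)
    finally show ?thesis using E(2) by (simp add: l2n_cmult)
  qed
  finally show ?case using test_fun_lincomb[OF D(1) E(1), of "c n"]
    by (intro exI[of _ "\<lambda>k x. c n * D k x + E k x"]) auto
qed

lemma test_dense:
  assumes "L2 f" "e > 0" shows "\<exists>D. test_fun D \<and> l2n (\<lambda>x. f x - D 0 x) < e"
proof -
  obtain a m c n where s: "l2n (\<lambda>x. f x - step a (1 / real (Suc m)) c n x) < e / 2"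
    using step_dense[OF assms(1), of "e / 2"] assms(2) by auto
  obtain D where D: "test_fun D" "l2n (\<lambda>x. D 0 x - step a (1 / real (Suc m)) c n x) < e / 2"
    using test_approx_step[of "1 / real (Suc m)" "e / 2" a c n] assms(2) by auto
  let ?s = "step a (1 / real (Suc m)) c n"
  have "l2n (\<lambda>x. f x - D 0 x) = l2n (\<lambda>x. (f x - ?s x) + (?s x - D 0 x))" by simp
  also have "\<dots> \<le> l2n (\<lambda>x. f x - ?s x) + l2n (\<lambda>x. ?s x - D 0 x)"
    by (intro l2n_triangle L2_diff assms L2_step test_fun_L2 D)
  finally show ?thesis using s D l2n_minus_commute[of ?s "D 0"] by (intro exI[of _ D]) auto
qed

text \<open>A test function D closer to f than the norm of f would give |f|^2 = <f, f - D> <= |f| |f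
  - D| < |f|^2.\<close>

lemma L2_eq_0_if_orthogonal:
  assumes f: "L2 f" and orth: "\<And>D. test_fun D \<Longrightarrow> ip f (D 0) = 0"
  shows "l2n f = 0"
proof (rule ccontr)
  assume "l2n f \<noteq> 0"
  then have p: "l2n f > 0" by (simp add: less_le)
  then obtain D where D: "test_fun D" "l2n (\<lambda>x. f x - D 0 x) < l2n f" using test_dense[OF f] by blast
  have "of_real ((l2n f)\<^sup>2) = ip f f" by (rule of_real_l2n_sq)
  also have "ip f f = ip f (\<lambda>x. f x - D 0 x)"
    using ip_diff_right[OF f f test_fun_L2(1)[OF D(1)]] orth[OF D(1)] by simp
  finally have "(l2n f)\<^sup>2 \<le> cmod (ip f (\<lambda>x. f x - D 0 x))"
    by (metis complex_Re_le_cmod Re_complex_of_real)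
  also have "\<dots> \<le> l2n f * l2n (\<lambda>x. f x - D 0 x)"
    by (intro ip_Cauchy_Schwarz f L2_diff test_fun_L2 D)
  finally show False using D(2) p by (simp add: power2_eq_square)
qed

section \<open>Weyl operators\<close>

text \<open>\<open>weyl (t * k0) (t * k1) (t * k2)\<close> is the one-parameter group
  \<open>exp (- i t (k0 + k1 x + k2 p))\<close> with \<open>p = - i d/dx\<close>; the term \<open>b * c / 2\<close> comes from
  \<open>[x, p] = i\<close>.\<close>

definition weyl :: "real \<Rightarrow> real \<Rightarrow> real \<Rightarrow> (real \<Rightarrow> complex) \<Rightarrow> real \<Rightarrow> complex" where
  "weyl a b c f x = cis (- (a + b * x - b * c / 2)) * f (x - c)"

lemma weyl_zero [simp]: "weyl 0 0 0 f = f"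
  by (simp add: weyl_def fun_eq_iff)

text \<open>In general Weyl operators compose only up to a phase given by the symplectic form of
  their parameters. The phase disappears here because both parameter triples lie on one
  line.\<close>

lemma weyl_add:
  "weyl (s * a) (s * b) (s * c) (weyl (t * a) (t * b) (t * c) f) = weyl ((s + t) * a) ((s + t) * b) ((s + t) * c) f"
proof
  fix x
  have "- (s * a + s * b * x - s * b * (s * c) / 2) + - (t * a + t * b * (x - s * c) - t * b * (t * c) / 2)
     = - ((s + t) * a + (s + t) * b * x - (s + t) * b * ((s + t) * c) / 2)"
    by (simp add: field_simps)
  then have "cis (- (s * a + s * b * x - s * b * (s * c) / 2)) * cis (- (t * a + t * b * (x - s * c) - t * b * (t * c) / 2))
     = cis (- ((s + t) * a + (s + t) * b * x - (s + t) * b * ((s + t) * c) / 2))"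
    by (simp only: cis_mult)
  moreover have "x - s * c - t * c = x - (s + t) * c" by (simp add: algebra_simps)
  ultimately show "weyl (s * a) (s * b) (s * c) (weyl (t * a) (t * b) (t * c) f) x
      = weyl ((s + t) * a) ((s + t) * b) ((s + t) * c) f x"
    unfolding weyl_def by (metis mult.assoc)
qed

lemma weyl_inverse: "weyl a b c (weyl (- a) (- b) (- c) f) = f"
  using weyl_add[of 1 a b c "-1" f] by simp

lemma weyl_minus: "weyl a b c (\<lambda>x. f x - g x) = (\<lambda>x. weyl a b c f x - weyl a b c g x)"
  by (simp add: weyl_def fun_eq_iff algebra_simps)

lemma cis_affine_measurable [measurable]: "(\<lambda>x. cis (- (a + b * x - c))) \<in> borel_measurable borel"
  by (intro borel_measurable_continuous_onI continuous_intros)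

lemma L2_weyl: assumes "L2 f" shows "L2 (weyl a b c f)"
proof -
  have "L2 (\<lambda>x. f (x - c))"
    unfolding L2_def
  proof
    show "(\<lambda>x. f (x - c)) \<in> borel_measurable lborel"
      using measurable_compose[OF _ L2_measurable[OF assms], of "\<lambda>x. x - c" borel] by simp
    show "integrable lborel (\<lambda>x. (cmod (f (x - c)))\<^sup>2)"
      using lborel_integrable_real_affine[OF L2_integrable[OF assms], of 1 "-c"] by (simp add: add.commute)
  qed
  then show ?thesis
    unfolding weyl_def by (rule L2_mult_bounded[where B=1, OF _ cis_affine_measurable]) simp
qed

lemma l2n_weyl: "l2n (weyl a b c f) = l2n f"
  unfolding l2n_def weyl_def
  using lborel_integral_real_affine[of 1 "\<lambda>x. (cmod (f x))\<^sup>2" "-c"] by (simp add: norm_mult add.commute)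

text \<open>Unitarity: the adjoint is the inverse. Substituting c + x for x moves the translation to
  the other factor.\<close>

lemma ip_weyl: "ip (weyl a b c f) g = ip f (weyl (- a) (- b) (- c) g)"
proof -
  have "ip (weyl a b c f) g = (\<integral>x. weyl a b c f (c + 1 * x) * cnj (g (c + 1 * x)) \<partial>lborel)"
    unfolding ip_def by (subst lborel_integral_real_affine[of 1 _ c]) auto
  also have "\<dots> = ip f (weyl (- a) (- b) (- c) g)"
    unfolding ip_def
  proof (rule Bochner_Integration.integral_cong)
    fix x
    have "- (a + b * (c + x) - b * c / 2) = - (- (- a + - b * x - - b * - c / 2))" by (simp add: algebra_simps)
    then have "cis (- (a + b * (c + x) - b * c / 2)) = cnj (cis (- (- a + - b * x - - b * - c / 2)))"
      unfolding cis_cnj by (rule arg_cong)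
    then show "weyl a b c f (c + 1 * x) * cnj (g (c + 1 * x)) = f x * cnj (weyl (- a) (- b) (- c) g x)"
      unfolding weyl_def by (simp only: mult_1 complex_cnj_mult add_diff_cancel_left' diff_minus_eq_add add.commute[of c x]) simp
  qed simp
  finally show ?thesis .
qed

text \<open>The operator d/dx - i b: the derivative of a Weyl image of f is the Weyl image of the
  twisted f.\<close>

definition twist :: "real \<Rightarrow> (nat \<Rightarrow> real \<Rightarrow> complex) \<Rightarrow> nat \<Rightarrow> real \<Rightarrow> complex" where
  "twist b D n x = D (Suc n) x - \<i> * of_real b * D n x"

text \<open>A Weyl image together with all its derivatives, again in the format of
  \<open>test_fun\<close>. The duality argument transports test functions in this form.\<close>

definition weylD :: "real \<Rightarrow> real \<Rightarrow> real \<Rightarrow> (nat \<Rightarrow> real \<Rightarrow> complex) \<Rightarrow> nat \<Rightarrow> real \<Rightarrow> complex" where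
  "weylD a b c D n = weyl a b c ((twist b ^^ n) D 0)"

lemma weylD_0: "weylD a b c D 0 = weyl a b c (D 0)"
  by (simp add: weylD_def)

lemma weyl_has_vector_derivative:
  assumes "(f has_vector_derivative f') (at (x - c))"
  shows "(weyl a b c f has_vector_derivative
    cis (- (a + b * x - b * c / 2)) * (f' - \<i> * of_real b * f (x - c))) (at x)"
proof -
  have "((\<lambda>z. exp (\<i> * (- (of_real a + of_real b * z - of_real (b * c / 2))))) has_field_derivative
      exp (\<i> * (- (of_real a + of_real b * of_real x - of_real (b * c / 2)))) * (- \<i> * of_real b)) (at (of_real x))"
    by (auto intro!: derivative_eq_intros)
  from has_vector_derivative_real_field[OF this]
  have 1: "((\<lambda>x. cis (- (a + b * x - b * c / 2))) has_vector_derivative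
      cis (- (a + b * x - b * c / 2)) * (- \<i> * of_real b)) (at x)"
    by (simp add: cis_conv_exp)
  have "((\<lambda>x. x - c) has_vector_derivative 1) (at x)"
    by (auto intro!: derivative_eq_intros)
  from vector_diff_chain_at[OF this assms]
  have 2: "((\<lambda>x. f (x - c)) has_vector_derivative f') (at x)" by (simp add: o_def)
  have "weyl a b c f = (\<lambda>x. cis (- (a + b * x - b * c / 2)) * f (x - c))"
    by (simp add: weyl_def fun_eq_iff)
  then show ?thesis
    using has_vector_derivative_mult[OF 1 2] by (simp add: algebra_simps)
qed

lemma test_fun_weylD: assumes "test_fun D" shows "test_fun (weylD a b c D)"
  unfolding test_fun_def
proof (intro conjI allI)
  have tw: "((twist b ^^ n) D m has_vector_derivative (twist b ^^ n) D (Suc m) x) (at x)" for n m x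
  proof (induction n arbitrary: m x)
    case 0 then show ?case using assms by (simp add: test_fun_def)
  next
    case (Suc n)
    then show ?case unfolding funpow.simps comp_def twist_def
      by (intro derivative_intros has_vector_derivative_mult_right) auto
  qed
  show "(weylD a b c D n has_vector_derivative weylD a b c D (Suc n) x) (at x)" for n x
    using weyl_has_vector_derivative[OF tw[of n 0 "x - c"], of a b]
    by (simp add: weylD_def weyl_def twist_def)
  obtain R where R: "\<And>x. \<bar>x\<bar> > R \<Longrightarrow> D 0 x = 0" using assms by (auto simp: test_fun_def)
  show "\<exists>R. \<forall>x. R < \<bar>x\<bar> \<longrightarrow> weylD a b c D 0 x = 0"
    by (intro exI[of _ "R + \<bar>c\<bar>"]) (auto simp: weylD_def weyl_def intro!: R)
qed

definition ham :: "real \<Rightarrow> real \<Rightarrow> real \<Rightarrow> (nat \<Rightarrow> real \<Rightarrow> complex) \<Rightarrow> real \<Rightarrow> complex" where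
  "ham k0 k1 k2 D x = of_real k0 * D 0 x + of_real k1 * (of_real x * D 0 x) - \<i> * of_real k2 * D 1 x"

lemma ip_ham_scale: "ip g (ham (r * k0) (r * k1) (r * k2) D) = of_real r * ip g (ham k0 k1 k2 D)"
proof -
  have "ham (r * k0) (r * k1) (r * k2) D = (\<lambda>x. of_real r * ham k0 k1 k2 D x)"
    by (simp add: ham_def fun_eq_iff algebra_simps)
  then show ?thesis by (simp only: ip_cmult_right) simp
qed

lemma L2_ham: "test_fun D \<Longrightarrow> L2 (ham k0 k1 k2 D)"
  unfolding ham_def by (intro L2_add L2_diff L2_cmult test_fun_L2)

text \<open>The difference quotient of the group at time \<open>h\<close> minus its limit - i H,
  where H is \<open>ham\<close>.\<close>

definition weyl_err :: "real \<Rightarrow> real \<Rightarrow> real \<Rightarrow> (nat \<Rightarrow> real \<Rightarrow> complex) \<Rightarrow> real \<Rightarrow> real \<Rightarrow> complex" where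
  "weyl_err k0 k1 k2 D h x =
     of_real (1 / h) * (weyl (h * k0) (h * k1) (h * k2) (D 0) x - D 0 x) + \<i> * ham k0 k1 k2 D x"

lemma L2_weyl_err: "test_fun D \<Longrightarrow> L2 (weyl_err k0 k1 k2 D h)"
  unfolding weyl_err_def by (intro L2_add L2_cmult L2_diff L2_weyl test_fun_L2 L2_ham)

lemma has_vector_derivative_iff_quotient:
  "(f has_vector_derivative f') (at t within S) \<longleftrightarrow>
     ((\<lambda>s. (1 / (s - t)) *\<^sub>R (f s - f t)) \<longlongrightarrow> f') (at t within S)"
proof -
  have "norm ((1 / norm (s - t)) *\<^sub>R (f s - (f t + (s - t) *\<^sub>R f'))) = norm ((1 / (s - t)) *\<^sub>R (f s - f t) - f')"
    if "s \<noteq> t" for s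
  proof -
    have "(1 / (s - t)) *\<^sub>R (f s - f t) - f' = (1 / (s - t)) *\<^sub>R (f s - (f t + (s - t) *\<^sub>R f'))"
      using that by (simp add: scaleR_right_diff_distrib scaleR_add_right)
    then show ?thesis by simp
  qed
  then have "\<forall>\<^sub>F s in at t within S. norm ((1 / norm (s - t)) *\<^sub>R (f s - (f t + (s - t) *\<^sub>R f'))) = norm ((1 / (s - t)) *\<^sub>R (f s - f t) - f')"
    by (auto simp: eventually_at_filter)
  then have "((\<lambda>s. norm ((1 / norm (s - t)) *\<^sub>R (f s - (f t + (s - t) *\<^sub>R f')))) \<longlongrightarrow> 0) (at t within S) \<longleftrightarrow>
     ((\<lambda>s. norm ((1 / (s - t)) *\<^sub>R (f s - f t) - f')) \<longlongrightarrow> 0) (at t within S)"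
    by (rule tendsto_cong)
  then show ?thesis
    unfolding has_vector_derivative_def has_derivative_within tendsto_norm_zero_iff
    by (simp add: bounded_linear_scaleR_left LIM_zero_iff)
qed

lemma cmod_cis_minus_1_le: "cmod (cis t - 1) \<le> \<bar>t\<bar>"
  using dist_exp_i_1[of t] abs_sin_x_le_abs_x[of "t / 2"] by (simp add: cis_conv_exp)

lemma weyl_pointwise_deriv:
  assumes "test_fun D"
  shows "((\<lambda>h. weyl (h * k0) (h * k1) (h * k2) (D 0) x) has_vector_derivative - \<i> * ham k0 k1 k2 D x) (at 0)"
proof -
  have "((\<lambda>z. exp (\<i> * (- (z * of_real k0 + z * of_real k1 * of_real x - z * of_real k1 * (z * of_real k2) / 2)))) has_field_derivative
      - \<i> * (of_real k0 + of_real k1 * of_real x)) (at (of_real 0))"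
    by (auto intro!: derivative_eq_intros simp: algebra_simps)
  from has_vector_derivative_real_field[OF this]
  have 1: "((\<lambda>h. cis (- (h * k0 + h * k1 * x - h * k1 * (h * k2) / 2))) has_vector_derivative
      - \<i> * (of_real k0 + of_real k1 * of_real x)) (at 0)"
    by (simp add: cis_conv_exp)
  have "((\<lambda>h. x - h * k2) has_vector_derivative - k2) (at 0)"
    by (auto intro!: derivative_eq_intros)
  moreover have "(D 0 has_vector_derivative D 1 x) (at (x - 0 * k2))"
    using assms by (simp add: test_fun_def)
  ultimately have 2: "((\<lambda>h. D 0 (x - h * k2)) has_vector_derivative (- k2) *\<^sub>R D 1 x) (at 0)"
    using vector_diff_chain_at[of "\<lambda>h. x - h * k2" "-k2" 0 "D 0" "D 1 x"] by (simp add: o_def)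
  show ?thesis
    unfolding weyl_def
    by (rule has_vector_derivative_eq_rhs[OF has_vector_derivative_mult[OF 1 2]])
      (simp add: ham_def algebra_simps scaleR_conv_of_real)
qed

text \<open>Strong differentiability of the Weyl group on test functions. The quotient converges at
  each x; for bounded \<open>h\<close> it lives on a fixed interval and is uniformly bounded, so
  dominated convergence applies along every null sequence.\<close>

lemma weyl_err_tendsto:
  assumes D: "test_fun D" shows "((\<lambda>h. l2n (weyl_err k0 k1 k2 D h)) \<longlongrightarrow> 0) (at 0)"
  unfolding tendsto_at_iff_sequentially
proof (intro allI impI)
  fix X :: "nat \<Rightarrow> real"
  assume "\<forall>i. X i \<in> UNIV - {0}" and X0: "X \<longlonglongrightarrow> 0"
  then have Xn: "X i \<noteq> 0" for i by auto
  obtain K where K: "\<And>i. \<bar>X i\<bar> \<le> K" using convergent_imp_Bseq[OF convergentI[OF X0]] by (auto simp: Bseq_def)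
  have K0: "K \<ge> 0" using K[of 0] by linarith
  obtain R where R: "R \<ge> 0" "\<And>n x. \<bar>x\<bar> > R \<Longrightarrow> D n x = 0" using test_fun_support[OF D] by blast
  have "\<exists>B. \<forall>x. cmod (D n x) \<le> B" for n
  proof -
    have "compact (D n ` {-R..R})"
      by (intro compact_continuous_image continuous_on_subset[OF test_fun_continuous[OF D]]) auto
    then obtain B where B: "\<And>y. y \<in> D n ` {-R..R} \<Longrightarrow> cmod y \<le> B"
      using compact_imp_bounded bounded_iff by metis
    have "cmod (D n x) \<le> max B 0" for x
      using B[of "D n x"] R(2)[of x n] by (cases "\<bar>x\<bar> > R") (auto simp: le_max_iff_disj not_less abs_le_iff)
    then show ?thesis by blast
  qed
  then obtain B where B: "\<And>n x. cmod (D n x) \<le> B n" by metis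
  have B0: "B n \<ge> 0" for n using B[of n 0] norm_ge_zero order_trans by blast
  have lip: "cmod (D 0 x - D 0 y) \<le> B 1 * \<bar>x - y\<bar>" for x y
  proof -
    have "norm (D 0 x - D 0 y) \<le> B 1 * norm (x - y)"
    proof (rule differentiable_bound[of UNIV "D 0" "\<lambda>x h. h *\<^sub>R D 1 x"])
      show "(D 0 has_derivative (\<lambda>h. h *\<^sub>R D 1 x)) (at x within UNIV)" for x
        using D by (simp add: test_fun_def has_vector_derivative_def)
      show "onorm (\<lambda>h. h *\<^sub>R D 1 x) \<le> B 1" for x
        by (rule onorm_bound[OF B0]) (use B[of 1 x] in \<open>auto intro: mult_left_mono simp: mult.commute\<close>)
    qed auto
    then show ?thesis by simp
  qed
  \<comment> \<open>\<open>S\<close> covers the support of \<open>D 0\<close> and of its translates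
    by \<open>X i * k2\<close>. \<open>C\<close> collects the phase error, from |cis t - 1| <= |t|,
    and the translation error, from the Lipschitz constant \<open>B 1\<close>, both divided by
    |h|.\<close>
  define S where "S = R + K * \<bar>k2\<bar>"
  define C where "C = (\<bar>k0\<bar> + \<bar>k1\<bar> * S + \<bar>k1 * k2\<bar> * K) * B 0 + B 1 * \<bar>k2\<bar>"
  let ?w = "\<lambda>h x. of_real (1 / h) * (weyl (h * k0) (h * k1) (h * k2) (D 0) x - D 0 x)"
  have wz: "?w (X i) x = 0" if "\<bar>x\<bar> > S" for i x
  proof -
    have "\<bar>X i * k2\<bar> \<le> K * \<bar>k2\<bar>" using K[of i] by (simp add: abs_mult mult_right_mono)
    then have "\<bar>x - X i * k2\<bar> > R" using that unfolding S_def by linarith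
    moreover have "\<bar>x\<bar> > R" using that K0 unfolding S_def using mult_nonneg_nonneg[OF K0 abs_ge_zero[of k2]] by linarith
    ultimately show ?thesis using R(2) by (simp add: weyl_def)
  qed
  have wb: "cmod (?w (X i) x) \<le> C" if "\<bar>x\<bar> \<le> S" for i x
  proof -
    let ?h = "X i"
    let ?t = "- (?h * k0 + ?h * k1 * x - ?h * k1 * (?h * k2) / 2)"
    have "weyl (?h * k0) (?h * k1) (?h * k2) (D 0) x - D 0 x = (cis ?t - 1) * D 0 (x - ?h * k2) + (D 0 (x - ?h * k2) - D 0 x)"
      by (simp add: weyl_def algebra_simps)
    also have "cmod \<dots> \<le> cmod (cis ?t - 1) * cmod (D 0 (x - ?h * k2)) + cmod (D 0 (x - ?h * k2) - D 0 x)"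
      using norm_triangle_ineq norm_mult by metis
    also have "\<dots> \<le> \<bar>?t\<bar> * B 0 + B 1 * \<bar>?h * k2\<bar>"
      using lip[of "x - ?h * k2" x] by (intro add_mono mult_mono cmod_cis_minus_1_le B) auto
    also have "\<bar>?t\<bar> \<le> \<bar>?h\<bar> * (\<bar>k0\<bar> + \<bar>k1\<bar> * S + \<bar>k1 * k2\<bar> * K)"
    proof -
      have "?t = - (?h * (k0 + k1 * x - k1 * k2 * ?h / 2))" by (simp add: algebra_simps)
      then have "\<bar>?t\<bar> = \<bar>?h\<bar> * \<bar>k0 + k1 * x - k1 * k2 * ?h / 2\<bar>" by (simp only: abs_minus_cancel abs_mult)
      also have "\<bar>k0 + k1 * x - k1 * k2 * ?h / 2\<bar> \<le> \<bar>k0\<bar> + \<bar>k1 * x\<bar> + \<bar>k1 * k2 * ?h\<bar>" by linarith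
      also have "\<bar>k1 * x\<bar> \<le> \<bar>k1\<bar> * S" using that by (simp add: abs_mult mult_left_mono)
      also have "\<bar>k1 * k2 * ?h\<bar> \<le> \<bar>k1 * k2\<bar> * K" using K[of i] by (simp add: abs_mult mult_left_mono)
      finally show ?thesis by (simp add: mult_left_mono)
    qed
    finally have "cmod (weyl (?h * k0) (?h * k1) (?h * k2) (D 0) x - D 0 x) \<le> \<bar>?h\<bar> * C"
      using B0[of 0] by (simp add: C_def abs_mult algebra_simps mult_right_mono)
    then show ?thesis using Xn[of i] by (simp add: norm_mult norm_divide field_simps)
  qed
  have m1: "(\<lambda>x. ?w h x) \<in> borel_measurable borel" for h
    using L2_measurable[OF L2_cmult[OF L2_diff[OF L2_weyl[OF test_fun_L2(1)[OF D]] test_fun_L2(1)[OF D]]]] .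
  have m2: "(\<lambda>x. - \<i> * ham k0 k1 k2 D x) \<in> borel_measurable borel"
    using L2_measurable[OF L2_cmult[OF L2_ham[OF D]]] .
  have "(\<lambda>i. l2n (\<lambda>x. ?w (X i) x - (- \<i> * ham k0 k1 k2 D x))) \<longlonglongrightarrow> 0"
  proof (rule l2n_dominated_convergence[OF m1 m2 square_integrable_indicator[of C S]])
    show "AE x in lborel. (\<lambda>i. ?w (X i) x) \<longlonglongrightarrow> - \<i> * ham k0 k1 k2 D x"
    proof (rule AE_I2)
      fix x
      have "((\<lambda>h. ?w h x) \<longlongrightarrow> - \<i> * ham k0 k1 k2 D x) (at 0)"
        using weyl_pointwise_deriv[OF D, of k0 k1 k2 x]
        by (simp add: has_vector_derivative_iff_quotient scaleR_conv_of_real)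
      then show "(\<lambda>i. ?w (X i) x) \<longlonglongrightarrow> - \<i> * ham k0 k1 k2 D x"
        using X0 Xn by (auto simp: tendsto_at_iff_sequentially o_def)
    qed
    show "AE x in lborel. cmod (?w (X i) x) \<le> C * indicator {- S..S} x" for i
    proof (rule AE_I2)
      fix x show "cmod (?w (X i) x) \<le> C * indicator {- S..S} x"
      proof (cases "\<bar>x\<bar> > S")
        case True then show ?thesis using wz[OF True, of i] by (auto simp: indicator_def)
      next
        case False
        then have "x \<in> {-S..S}" by auto
        then show ?thesis using wb[of x i] False by (simp add: indicator_def)
      qed
    qed
  qed
  then show "((\<lambda>h. l2n (weyl_err k0 k1 k2 D h)) \<circ> X) \<longlonglongrightarrow> 0"
    unfolding weyl_err_def o_def by simp
qed

section \<open>Weak solutions of the scalar equation\<close>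

abbreviation ev :: "real \<Rightarrow> real \<Rightarrow> real \<Rightarrow> real \<Rightarrow> (real \<Rightarrow> complex) \<Rightarrow> real \<Rightarrow> complex" where
  "ev k0 k1 k2 t \<equiv> weyl (t * k0) (t * k1) (t * k2)"

lemma ev_diff: "ev k0 k1 k2 s f = ev k0 k1 k2 t (ev k0 k1 k2 (s - t) f)"
  by (simp add: weyl_add)

lemma ev_diff': "ev k0 k1 k2 s f = ev k0 k1 k2 (s - t) (ev k0 k1 k2 t f)"
  by (simp add: weyl_add)

lemma filterlim_minus_at_0: "filterlim (\<lambda>s. s - t) (at 0) (at (t::real) within S)"
  unfolding filterlim_at
proof
  show "((\<lambda>s. s - t) \<longlongrightarrow> 0) (at t within S)" by (auto intro!: tendsto_eq_intros)
qed (simp add: eventually_at_filter)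

lemma weyl_increment:
  assumes "h \<noteq> 0"
  shows "weyl (h * k0) (h * k1) (h * k2) (D 0) x - D 0 x = of_real h * (weyl_err k0 k1 k2 D h x + (- \<i>) * ham k0 k1 k2 D x)"
  using assms by (simp add: weyl_err_def algebra_simps)

lemma ev_continuous_0_test:
  assumes D: "test_fun D" shows "((\<lambda>h. l2n (\<lambda>x. ev k0 k1 k2 h (D 0) x - D 0 x)) \<longlongrightarrow> 0) (at 0)"
proof (rule Lim_null_comparison)
  show "((\<lambda>h. \<bar>h\<bar> * (l2n (weyl_err k0 k1 k2 D h) + l2n (ham k0 k1 k2 D))) \<longlongrightarrow> 0) (at 0)"
    by (auto intro!: tendsto_eq_intros weyl_err_tendsto[OF D])
  have "l2n (\<lambda>x. ev k0 k1 k2 h (D 0) x - D 0 x) \<le> \<bar>h\<bar> * (l2n (weyl_err k0 k1 k2 D h) + l2n (ham k0 k1 k2 D))"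
    if "h \<noteq> 0" for h
  proof -
    have "l2n (\<lambda>x. weyl_err k0 k1 k2 D h x + (- \<i>) * ham k0 k1 k2 D x)
        \<le> l2n (weyl_err k0 k1 k2 D h) + l2n (\<lambda>x. (- \<i>) * ham k0 k1 k2 D x)"
      by (intro l2n_triangle L2_weyl_err L2_cmult L2_ham D)
    also have "l2n (\<lambda>x. (- \<i>) * ham k0 k1 k2 D x) = l2n (ham k0 k1 k2 D)"
      by (subst l2n_cmult) simp
    finally show ?thesis
      unfolding weyl_increment[OF that] l2n_cmult by (simp add: mult_left_mono)
  qed
  then show "\<forall>\<^sub>F h in at 0. norm (l2n (\<lambda>x. ev k0 k1 k2 h (D 0) x - D 0 x))
      \<le> \<bar>h\<bar> * (l2n (weyl_err k0 k1 k2 D h) + l2n (ham k0 k1 k2 D))"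
    by (auto simp: eventually_at_filter)
qed

text \<open>Unitarity transfers continuity from the dense set of test functions to all of
  L2.\<close>

lemma ev_continuous_0:
  assumes f: "L2 f" shows "((\<lambda>h. l2n (\<lambda>x. ev k0 k1 k2 h f x - f x)) \<longlongrightarrow> 0) (at 0)"
proof (rule tendstoI)
  fix e :: real assume e: "e > 0"
  obtain D where D: "test_fun D" "l2n (\<lambda>x. f x - D 0 x) < e / 3" using test_dense[OF f, of "e / 3"] e by auto
  have LD: "L2 (D 0)" using test_fun_L2 D by blast
  have "\<forall>\<^sub>F h in at 0. l2n (\<lambda>x. ev k0 k1 k2 h (D 0) x - D 0 x) < e / 3"
    by (rule order_tendstoD(2)[OF ev_continuous_0_test[OF D(1)]]) (use e in simp)
  then show "\<forall>\<^sub>F h in at 0. dist (l2n (\<lambda>x. ev k0 k1 k2 h f x - f x)) 0 < e"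
  proof eventually_elim
    case (elim h)
    have "l2n (\<lambda>x. ev k0 k1 k2 h f x - f x)
       = l2n (\<lambda>x. ev k0 k1 k2 h (\<lambda>x. f x - D 0 x) x + ((ev k0 k1 k2 h (D 0) x - D 0 x) + (D 0 x - f x)))"
      by (simp add: weyl_minus)
    also have "\<dots> \<le> l2n (ev k0 k1 k2 h (\<lambda>x. f x - D 0 x)) + l2n (\<lambda>x. (ev k0 k1 k2 h (D 0) x - D 0 x) + (D 0 x - f x))"
      by (intro l2n_triangle L2_weyl L2_add L2_diff f LD)
    also have "l2n (\<lambda>x. (ev k0 k1 k2 h (D 0) x - D 0 x) + (D 0 x - f x)) \<le> l2n (\<lambda>x. ev k0 k1 k2 h (D 0) x - D 0 x) + l2n (\<lambda>x. D 0 x - f x)"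
      by (intro l2n_triangle L2_weyl L2_add L2_diff f LD)
    finally show ?case using elim D(2) l2n_minus_commute[of f "D 0"] by (simp add: l2n_weyl)
  qed
qed

lemma ev_continuous:
  assumes f: "L2 f"
  shows "((\<lambda>s. l2n (\<lambda>x. ev k0 k1 k2 s f x - ev k0 k1 k2 t f x)) \<longlongrightarrow> 0) (at t within S)"
proof -
  have "l2n (\<lambda>x. ev k0 k1 k2 s f x - ev k0 k1 k2 t f x) = l2n (\<lambda>x. ev k0 k1 k2 (s - t) f x - f x)" for s
    by (subst ev_diff[where s=s and t=t]) (simp add: weyl_minus[symmetric] l2n_weyl)
  then show ?thesis
    using filterlim_compose[OF ev_continuous_0[OF f] filterlim_minus_at_0] by simp
qed

lemma ip_tendsto:
  assumes f: "\<forall>\<^sub>F s in F. L2 (f s)" "L2 g" "((\<lambda>s. l2n (\<lambda>x. f s x - g x)) \<longlongrightarrow> 0) F"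
    and d: "\<forall>\<^sub>F s in F. L2 (d s)" "L2 e" "((\<lambda>s. l2n (\<lambda>x. d s x - e x)) \<longlongrightarrow> 0) F"
  shows "((\<lambda>s. ip (f s) (d s)) \<longlongrightarrow> ip g e) F"
proof (rule LIM_zero_cancel, rule Lim_null_comparison)
  let ?p = "\<lambda>s. l2n (\<lambda>x. f s x - g x)" and ?q = "\<lambda>s. l2n (\<lambda>x. d s x - e x)"
  show "((\<lambda>s. ?p s * ?q s + ?p s * l2n e + l2n g * ?q s) \<longlongrightarrow> 0) F"
    by (rule tendsto_eq_intros f(3) d(3) | simp)+
  show "\<forall>\<^sub>F s in F. norm (ip (f s) (d s) - ip g e) \<le> ?p s * ?q s + ?p s * l2n e + l2n g * ?q s"
    using f(1) d(1)
  proof eventually_elim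
    case (elim s)
    let ?A = "ip (\<lambda>x. f s x - g x) (\<lambda>x. d s x - e x)" and ?B = "ip (\<lambda>x. f s x - g x) e"
      and ?C = "ip g (\<lambda>x. d s x - e x)"
    have eq: "ip (f s) (d s) - ip g e = ?A + ?B + ?C"
      using elim f(2) d(2) by (simp add: ip_diff_left ip_diff_right L2_diff)
    have "cmod (?A + ?B + ?C) \<le> cmod ?A + cmod ?B + cmod ?C"
      using norm_triangle_ineq[of "?A + ?B" ?C] norm_triangle_ineq[of ?A ?B] by linarith
    also have "\<dots> \<le> ?p s * ?q s + ?p s * l2n e + l2n g * ?q s"
      by (intro add_mono ip_Cauchy_Schwarz L2_diff elim f(2) d(2))
    finally show ?case unfolding eq .
  qed
qed

lemma ip_tendsto_left:
  assumes "\<forall>\<^sub>F s in F. L2 (f s)" "L2 g" "((\<lambda>s. l2n (\<lambda>x. f s x - g x)) \<longlongrightarrow> 0) F" "L2 e"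
  shows "((\<lambda>s. ip (f s) e) \<longlongrightarrow> ip g e) F"
  using assms by (intro ip_tendsto) auto

text \<open>The second factor is differentiated, while continuity in time is enough for the first.
  The sign is + i because the inner product is antilinear in its second argument.\<close>

lemma ip_increment_tendsto:
  assumes f: "\<forall>\<^sub>F s in at t within S. L2 (f s)" "L2 g" "((\<lambda>s. l2n (\<lambda>x. f s x - g x)) \<longlongrightarrow> 0) (at t within S)"
    and D: "test_fun D"
  shows "((\<lambda>s. (1 / (s - t)) *\<^sub>R ip (f s) (\<lambda>x. ev k0 k1 k2 (s - t) (D 0) x - D 0 x)) \<longlongrightarrow> \<i> * ip g (ham k0 k1 k2 D)) (at t within S)"
proof -
  have 1: "((\<lambda>s. ip (f s) (weyl_err k0 k1 k2 D (s - t))) \<longlongrightarrow> ip g (\<lambda>x. 0)) (at t within S)"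
    using filterlim_compose[OF weyl_err_tendsto[OF D] filterlim_minus_at_0]
    by (intro ip_tendsto f) (auto intro!: always_eventually L2_weyl_err D L2_zero)
  have 2: "((\<lambda>s. ip (f s) (ham k0 k1 k2 D)) \<longlongrightarrow> ip g (ham k0 k1 k2 D)) (at t within S)"
    by (intro ip_tendsto_left f L2_ham D)
  have "((\<lambda>s. ip (f s) (weyl_err k0 k1 k2 D (s - t)) + \<i> * ip (f s) (ham k0 k1 k2 D)) \<longlongrightarrow> ip g (\<lambda>x. 0) + \<i> * ip g (ham k0 k1 k2 D)) (at t within S)"
    by (intro tendsto_intros 1 2)
  moreover have "\<forall>\<^sub>F s in at t within S. ip (f s) (weyl_err k0 k1 k2 D (s - t)) + \<i> * ip (f s) (ham k0 k1 k2 D)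
      = (1 / (s - t)) *\<^sub>R ip (f s) (\<lambda>x. ev k0 k1 k2 (s - t) (D 0) x - D 0 x)"
    using f(1) eventually_at_filter[of "\<lambda>s. s \<noteq> t" t S, THEN iffD2, OF always_eventually]
  proof (rule eventually_elim2, goal_cases)
    case (2 s)
    then have n: "s - t \<noteq> 0" by simp
    have "ip (f s) (\<lambda>x. ev k0 k1 k2 (s - t) (D 0) x - D 0 x)
       = of_real (s - t) * (ip (f s) (weyl_err k0 k1 k2 D (s - t)) + \<i> * ip (f s) (ham k0 k1 k2 D))"
      unfolding weyl_increment[OF n] ip_cmult_right
        ip_add_right[OF 2(1) L2_weyl_err[OF D] L2_cmult[OF L2_ham[OF D]]] by simp
    then show ?case using n by (simp add: scaleR_conv_of_real)
  qed auto
  ultimately show ?thesis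
    by (simp add: ip_def filterlim_cong)
qed

text \<open>The group need not be differentiable on a general \<open>f\<close>. Unitarity moves the
  increment onto the test function, where the inverse group acts, with the generator of opposite
  sign.\<close>

lemma ev_weak_derivative:
  assumes f: "L2 f" and D: "test_fun D"
  shows "((\<lambda>s. ip (ev k0 k1 k2 s f) (D 0)) has_vector_derivative - \<i> * ip (ev k0 k1 k2 t f) (ham k0 k1 k2 D)) (at t within S)"
proof -
  let ?g = "ev k0 k1 k2 t f"
  have g: "L2 ?g" using f by (rule L2_weyl)
  have "((\<lambda>s. (1 / (s - t)) *\<^sub>R ip ?g (\<lambda>x. ev (- k0) (- k1) (- k2) (s - t) (D 0) x - D 0 x)) \<longlongrightarrow> \<i> * ip ?g (ham (- k0) (- k1) (- k2) D)) (at t within S)"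
    by (intro ip_increment_tendsto) (use g D in auto)
  moreover have "ip ?g (\<lambda>x. ev (- k0) (- k1) (- k2) (s - t) (D 0) x - D 0 x) = ip (ev k0 k1 k2 s f) (D 0) - ip ?g (D 0)" for s
  proof -
    have "ip (ev k0 k1 k2 s f) (D 0) = ip ?g (ev (- k0) (- k1) (- k2) (s - t) (D 0))"
      by (subst ev_diff'[where s=s and t=t]) (simp add: ip_weyl)
    then show ?thesis using g D by (simp add: ip_diff_right L2_weyl test_fun_L2)
  qed
  moreover have "ip ?g (ham (- k0) (- k1) (- k2) D) = - ip ?g (ham k0 k1 k2 D)"
    using ip_ham_scale[of _ "-1"] by simp
  ultimately show ?thesis
    unfolding has_vector_derivative_iff_quotient by simp
qed

text \<open>Duality: \<open>s \<mapsto> ip (f s) (ev s D)\<close> is constant along every weak solution, which determines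
  \<open>f \<tau>\<close> on all test functions.\<close>

lemma weak_solution_unique:
  assumes tau: "\<tau> \<ge> 0"
    and L: "\<And>t. t \<in> {0..\<tau>} \<Longrightarrow> L2 (f t)"
    and cont: "\<And>t. t \<in> {0..\<tau>} \<Longrightarrow> ((\<lambda>s. l2n (\<lambda>x. f s x - f t x)) \<longlongrightarrow> 0) (at t within {0..\<tau>})"
    and weak: "\<And>D t. test_fun D \<Longrightarrow> t \<in> {0..\<tau>} \<Longrightarrow>
        ip (f t) (D 0) = ip (f 0) (D 0) - \<i> * integral {0..t} (\<lambda>s. ip (f s) (ham k0 k1 k2 D))"
  shows "l2n (\<lambda>x. f \<tau> x - ev k0 k1 k2 \<tau> (f 0) x) = 0"
proof -
  have evL: "\<forall>\<^sub>F s in at t within {0..\<tau>}. L2 (f s)" for t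
    using L by (auto simp: eventually_at_filter)
  have main: "ip (f \<tau>) (ev k0 k1 k2 \<tau> (D 0)) = ip (f 0) (D 0)" if D: "test_fun D" for D
  proof -
    define G where "G s = ip (f s) (ev k0 k1 k2 s (D 0))" for s
    have "(G has_vector_derivative 0) (at t within {0..\<tau>})" if t: "t \<in> {0..\<tau>}" for t
    proof -
      \<comment> \<open>The test function transported to time \<open>t\<close>. Then G s - G t = <f
        s, W E - E> + <f s - f t, E>, with W the evolution over s - t, involves a single fixed test
        function; the limits of the two difference quotients are opposite.\<close>
      define E where "E = weylD (t * k0) (t * k1) (t * k2) D"
      let ?i = "\<lambda>s. ip (f s) (\<lambda>x. ev k0 k1 k2 (s - t) (E 0) x - E 0 x)" and ?A = "at t within {0..\<tau>}"
      have E: "test_fun E" unfolding E_def by (rule test_fun_weylD[OF D])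
      have E0: "E 0 = ev k0 k1 k2 t (D 0)" by (simp add: E_def weylD_0)
      have c: "continuous_on {0..\<tau>} (\<lambda>s. ip (f s) (ham k0 k1 k2 E))"
        unfolding continuous_on_def by (intro ballI ip_tendsto_left evL L cont L2_ham E)
      have "((\<lambda>s. ip (f 0) (E 0) - \<i> * integral {0..s} (\<lambda>s. ip (f s) (ham k0 k1 k2 E))) has_vector_derivative
          0 - \<i> * ip (f t) (ham k0 k1 k2 E)) ?A"
        by (intro derivative_intros has_vector_derivative_mult_right integral_has_vector_derivative[OF c t])
      then have "((\<lambda>s. ip (f s) (E 0)) has_vector_derivative - \<i> * ip (f t) (ham k0 k1 k2 E)) ?A"
        unfolding has_vector_derivative_def diff_0 mult_minus_left[symmetric]
        by (rule has_derivative_transform[OF t, rotated]) (rule weak[OF E])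
      then have 1: "((\<lambda>s. (1 / (s - t)) *\<^sub>R (ip (f s) (E 0) - ip (f t) (E 0))) \<longlongrightarrow> - \<i> * ip (f t) (ham k0 k1 k2 E)) ?A"
        by (simp add: has_vector_derivative_iff_quotient)
      have 2: "((\<lambda>s. (1 / (s - t)) *\<^sub>R ?i s) \<longlongrightarrow> \<i> * ip (f t) (ham k0 k1 k2 E)) ?A"
        by (intro ip_increment_tendsto evL L t cont E)
      have "((\<lambda>s. (1 / (s - t)) *\<^sub>R ?i s + (1 / (s - t)) *\<^sub>R (ip (f s) (E 0) - ip (f t) (E 0))) \<longlongrightarrow> 0) ?A"
        using tendsto_add[OF 2 1] by simp
      moreover have "\<forall>\<^sub>F s in ?A. (1 / (s - t)) *\<^sub>R ?i s + (1 / (s - t)) *\<^sub>R (ip (f s) (E 0) - ip (f t) (E 0))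
          = (1 / (s - t)) *\<^sub>R (G s - G t)"
        using evL[of t]
      proof eventually_elim
        case (elim s)
        have "?i s = ip (f s) (ev k0 k1 k2 (s - t) (E 0)) - ip (f s) (E 0)"
          by (intro ip_diff_right elim L2_weyl test_fun_L2 E)
        moreover have "ev k0 k1 k2 (s - t) (E 0) = ev k0 k1 k2 s (D 0)"
          unfolding E0 by (rule ev_diff'[symmetric])
        ultimately show ?case by (simp add: G_def E0 flip: scaleR_add_right)
      qed
      ultimately show ?thesis
        unfolding has_vector_derivative_iff_quotient by (rule Lim_transform_eventually)
    qed
    then obtain k where "\<And>s. s \<in> {0..\<tau>} \<Longrightarrow> G s = k"
      using has_vector_derivative_zero_constant[of "{0..\<tau>}" G] by auto
    then have "G \<tau> = G 0" using tau by simp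
    then show ?thesis by (simp add: G_def)
  qed
  \<comment> \<open>Undoing the evolution turns the constancy of G into orthogonality of
    \<open>?g\<close> to every test function.\<close>
  let ?g = "\<lambda>x. ev (- k0) (- k1) (- k2) \<tau> (f \<tau>) x - f 0 x"
  have L\<tau>: "L2 (f \<tau>)" "L2 (f 0)" using L tau by auto
  have "l2n ?g = 0"
  proof (rule L2_eq_0_if_orthogonal)
    show "L2 ?g" by (intro L2_diff L2_weyl L\<tau>)
    show "ip ?g (D 0) = 0" if "test_fun D" for D
      using main[OF that] ip_weyl[of "\<tau> * - k0" "\<tau> * - k1" "\<tau> * - k2" "f \<tau>" "D 0"] that
      by (simp add: ip_diff_left L\<tau> L2_weyl test_fun_L2)
  qed
  moreover have "ev k0 k1 k2 \<tau> ?g = (\<lambda>x. f \<tau> x - ev k0 k1 k2 \<tau> (f 0) x)"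
    using weyl_inverse[of "\<tau> * k0" "\<tau> * k1" "\<tau> * k2" "f \<tau>"] by (simp add: weyl_minus)
  ultimately show ?thesis using l2n_weyl[of "\<tau> * k0" "\<tau> * k1" "\<tau> * k2" ?g] by simp
qed

section \<open>Four-component states and elementary segments\<close>

lemma comp_UNIV: "(UNIV :: comp set) = {GG, EG, GE, EE}"
  using comp.exhaust by auto

instance comp :: finite
  by standard (simp add: comp_UNIV)

lemma norm4_L2_set: "norm4 f = L2_set (\<lambda>j. l2n (f j)) UNIV"
  by (simp add: norm4_def L2_set_def comp_UNIV l2n_sq)

lemma norm4_nonneg [simp]: "0 \<le> norm4 f"
  by (simp add: norm4_L2_set L2_set_nonneg)

lemma norm4_sq: "(norm4 f)\<^sup>2 = (\<Sum>j\<in>UNIV. (l2n (f j))\<^sup>2)"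
  by (simp add: norm4_L2_set L2_set_def sum_nonneg)

lemma l2n_le_norm4: "l2n (f j) \<le> norm4 f"
  unfolding norm4_L2_set by (rule member_le_L2_set) auto

lemma norm4_le_sum: "norm4 f \<le> (\<Sum>j\<in>UNIV. l2n (f j))"
  unfolding norm4_L2_set by (rule L2_set_le_sum) auto

lemma norm4_eq_0_iff: "norm4 f = 0 \<longleftrightarrow> (\<forall>j. l2n (f j) = 0)"
  unfolding norm4_L2_set by (subst L2_set_eq_0_iff) auto

lemma norm4_tendsto_0_iff: "((\<lambda>s. norm4 (f s)) \<longlongrightarrow> 0) F \<longleftrightarrow> (\<forall>j. ((\<lambda>s. l2n (f s j)) \<longlongrightarrow> 0) F)"
proof (intro iffI allI)
  show "((\<lambda>s. l2n (f s j)) \<longlongrightarrow> 0) F" if "((\<lambda>s. norm4 (f s)) \<longlongrightarrow> 0) F" for j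
    by (rule Lim_null_comparison[OF always_eventually that]) (simp add: l2n_le_norm4)
  show "((\<lambda>s. norm4 (f s)) \<longlongrightarrow> 0) F" if "\<forall>j. ((\<lambda>s. l2n (f s j)) \<longlongrightarrow> 0) F"
  proof (rule Lim_null_comparison[OF always_eventually])
    show "((\<lambda>s. \<Sum>j\<in>UNIV. l2n (f s j)) \<longlongrightarrow> 0) F"
      using that by (intro tendsto_null_sum) auto
  qed (simp add: norm4_le_sum)
qed

lemma L2_4D: "L2_4 f \<Longrightarrow> L2 (f j)"
  by (simp add: L2_4_def)

lemma L2_4_diff4: "L2_4 f \<Longrightarrow> L2_4 g \<Longrightarrow> L2_4 (diff4 f g)"
  by (simp add: L2_4_def diff4_def L2_diff)

lemma norm4_diff4_commute: "norm4 (diff4 f g) = norm4 (diff4 g f)"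
  by (simp add: norm4_def diff4_def norm_minus_commute)

lemma norm4_diff4_self [simp]: "norm4 (diff4 f f) = 0"
  by (simp add: norm4_def diff4_def)

lemma norm4_diff4_triangle:
  assumes "L2_4 f" "L2_4 g" "L2_4 h"
  shows "norm4 (diff4 f h) \<le> norm4 (diff4 f g) + norm4 (diff4 g h)"
proof -
  have "l2n (diff4 f h j) \<le> l2n (diff4 f g j) + l2n (diff4 g h j)" for j
  proof -
    have "diff4 f h j = (\<lambda>x. diff4 f g j x + diff4 g h j x)" by (simp add: diff4_def)
    then show ?thesis
      using l2n_triangle[of "diff4 f g j" "diff4 g h j"] L2_4_diff4 assms by (simp add: L2_4_def)
  qed
  then have "norm4 (diff4 f h) \<le> L2_set (\<lambda>j. l2n (diff4 f g j) + l2n (diff4 g h j)) UNIV"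
    unfolding norm4_L2_set by (intro L2_set_mono) auto
  also have "\<dots> \<le> norm4 (diff4 f g) + norm4 (diff4 g h)"
    unfolding norm4_L2_set by (rule L2_set_triangle_ineq)
  finally show ?thesis .
qed

lemma norm4_le_diff4:
  assumes "L2_4 f" "L2_4 g" shows "norm4 f \<le> norm4 (diff4 f g) + norm4 g"
proof -
  have "L2_4 (\<lambda>j x. 0)" by (simp add: L2_4_def L2_zero)
  then show ?thesis using norm4_diff4_triangle[of f g "\<lambda>j x. 0"] assms by (simp add: diff4_def)
qed

section \<open>Grouping the four components by the level of one ion\<close>

fun flip :: "bool \<Rightarrow> comp \<Rightarrow> comp" where
  "flip True GG = EG" | "flip True EG = GG" | "flip True GE = EE" | "flip True EE = GE"
| "flip False GG = GE" | "flip False GE = GG" | "flip False EG = EE" | "flip False EE = EG"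

fun isg :: "bool \<Rightarrow> comp \<Rightarrow> bool" where
  "isg True j = (j = GG \<or> j = GE)"
| "isg False j = (j = GG \<or> j = EG)"

lemma flip_flip [simp]: "flip k (flip k j) = j"
  by (cases k; cases j) auto

lemma isg_flip [simp]: "isg k (flip k j) = (\<not> isg k j)"
  by (cases k; cases j) auto

lemma isg_flip_other: "k' \<noteq> k \<Longrightarrow> isg k' (flip k j) = isg k' j"
  by (cases k; cases k'; cases j) auto

lemma sum_flip_pairs: "(\<Sum>j\<in>UNIV. f j) = (\<Sum>j\<in>{j. isg k j}. f j + f (flip k j))" for f :: "comp \<Rightarrow> real"
proof (cases k)
  case True
  then have "{j. isg k j} = {GG, GE}" by auto
  then show ?thesis using True by (simp add: comp_UNIV)
next
  case False
  then have "{j. isg k j} = {GG, EG}" by auto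
  then show ?thesis using False by (simp add: comp_UNIV)
qed

lemma norm4_cong_pairs:
  assumes "\<And>j. isg k j \<Longrightarrow> (l2n (f j))\<^sup>2 + (l2n (f (flip k j)))\<^sup>2 = (l2n (g j))\<^sup>2 + (l2n (g (flip k j)))\<^sup>2"
  shows "norm4 f = norm4 g"
proof -
  have "(norm4 f)\<^sup>2 = (norm4 g)\<^sup>2"
    unfolding norm4_sq sum_flip_pairs[of _ k] using assms by (intro sum.cong) auto
  then show ?thesis by simp
qed

lemma parallelogram:
  assumes "L2 f" "L2 g"
  shows "(l2n (\<lambda>x. f x + g x))\<^sup>2 + (l2n (\<lambda>x. f x - g x))\<^sup>2 = 2 * (l2n f)\<^sup>2 + 2 * (l2n g)\<^sup>2"
proof -
  have "(cmod (a + b))\<^sup>2 + (cmod (a - b))\<^sup>2 = 2 * (cmod a)\<^sup>2 + 2 * (cmod b)\<^sup>2" for a b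
    unfolding cmod_power2 by (simp add: power2_eq_square algebra_simps)
  then have "(\<integral>x. (cmod (f x + g x))\<^sup>2 + (cmod (f x - g x))\<^sup>2 \<partial>lborel) = (\<integral>x. 2 * (cmod (f x))\<^sup>2 + 2 * (cmod (g x))\<^sup>2 \<partial>lborel)"
    by simp
  then show ?thesis
    using L2_integrable[OF assms(1)] L2_integrable[OF assms(2)]
      L2_integrable[OF L2_add[OF assms]] L2_integrable[OF L2_diff[OF assms]]
    by (simp add: l2n_sq)
qed

text \<open>The entry of the coupling matrix in the equation of component \<open>j\<close>:
  \<open>z\<close> where ion \<open>k\<close> is in its ground level, the conjugate where it is
  excited.\<close>

definition ph :: "bool \<Rightarrow> complex \<Rightarrow> comp \<Rightarrow> complex" where
  "ph k z j = (if isg k j then z else cnj z)"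

lemma ph_flip: "ph k z (flip k j) = cnj (ph k z j)"
  by (simp add: ph_def)

lemma ph_mult_cnj: "cmod z = 1 \<Longrightarrow> ph k z j * cnj (ph k z j) = 1"
  by (simp add: ph_def complex_norm_square[symmetric] mult.commute[of "cnj z"])

lemma cmod_ph: "cmod z = 1 \<Longrightarrow> cmod (ph k z j) = 1"
  by (simp add: ph_def)

text \<open>The propagator of ion \<open>k\<close> (the first ion for \<open>True\<close>) driven with phase \<open>z\<close>: the combinations
  \<open>\<phi> j \<plusminus> ph k z j * \<phi> (flip k j)\<close> decouple and evolve by a Weyl operator and its inverse.\<close>

definition seg :: "bool \<Rightarrow> complex \<Rightarrow> real \<Rightarrow> real \<Rightarrow> real \<Rightarrow> state \<Rightarrow> state" where
  "seg k z a b c \<phi> j x =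
     (weyl a b c (\<lambda>x. \<phi> j x + ph k z j * \<phi> (flip k j) x) x
      + weyl (- a) (- b) (- c) (\<lambda>x. \<phi> j x - ph k z j * \<phi> (flip k j) x) x) / 2"

text \<open>The phase of the flipped component is the conjugate, so its sum and difference are those
  of \<open>j\<close> up to the factor \<open>cnj (ph k z j)\<close> and a sign. Both components of
  a pair are thus expressed by the same two functions.\<close>

lemma seg_flip:
  assumes "cmod z = 1"
  shows "ph k z j * seg k z a b c \<phi> (flip k j) x =
     (weyl a b c (\<lambda>x. \<phi> j x + ph k z j * \<phi> (flip k j) x) x
      - weyl (- a) (- b) (- c) (\<lambda>x. \<phi> j x - ph k z j * \<phi> (flip k j) x) x) / 2"
proof -
  let ?y = "ph k z j"
  have y: "?y * cnj ?y = 1" using assms by (rule ph_mult_cnj)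
  have "?y * (p + cnj ?y * q) = q + ?y * p" "?y * (p - cnj ?y * q) = - (q - ?y * p)" for p q
    using y by (simp_all add: algebra_simps)
  then have "?y * (c * (p + cnj ?y * q)) = c * (q + ?y * p)" "?y * (c * (p - cnj ?y * q)) = - (c * (q - ?y * p))" for p q c
    by (metis mult.left_commute, metis mult.left_commute mult_minus_right)
  then show ?thesis
    by (simp add: seg_def ph_flip weyl_def distrib_left y)
qed

lemma seg_plus:
  assumes "cmod z = 1"
  shows "(\<lambda>x. seg k z a b c \<phi> j x + ph k z j * seg k z a b c \<phi> (flip k j) x) = weyl a b c (\<lambda>x. \<phi> j x + ph k z j * \<phi> (flip k j) x)"
  unfolding seg_flip[OF assms] by (simp add: seg_def fun_eq_iff field_simps)

lemma seg_minus:
  assumes "cmod z = 1"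
  shows "(\<lambda>x. seg k z a b c \<phi> j x - ph k z j * seg k z a b c \<phi> (flip k j) x) = weyl (- a) (- b) (- c) (\<lambda>x. \<phi> j x - ph k z j * \<phi> (flip k j) x)"
  unfolding seg_flip[OF assms] by (simp add: seg_def fun_eq_iff field_simps)

lemma seg_inverse:
  assumes "cmod z = 1" shows "seg k z (- a) (- b) (- c) (seg k z a b c \<phi>) = \<phi>"
proof (intro ext)
  fix j x
  show "seg k z (- a) (- b) (- c) (seg k z a b c \<phi>) j x = \<phi> j x"
    unfolding seg_def[of k z "- a" "- b" "- c"] seg_plus[OF assms] seg_minus[OF assms]
    using weyl_inverse[of a b c] weyl_inverse[of "- a" "- b" "- c"] by simp
qed

lemma L2_4_seg: "L2_4 \<phi> \<Longrightarrow> L2_4 (seg k z a b c \<phi>)"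
proof -
  assume L: "L2_4 \<phi>"
  have "L2 (\<lambda>x. (1/2) * (weyl a b c (\<lambda>x. \<phi> j x + ph k z j * \<phi> (flip k j) x) x
      + weyl (- a) (- b) (- c) (\<lambda>x. \<phi> j x - ph k z j * \<phi> (flip k j) x) x))" for j
    by (intro L2_cmult L2_add L2_weyl L2_diff L2_4D L)
  then show ?thesis by (simp add: L2_4_def seg_def[abs_def])
qed

lemma seg_diff4: "seg k z a b c (diff4 f g) = diff4 (seg k z a b c f) (seg k z a b c g)"
  by (intro ext) (simp add: seg_def diff4_def weyl_def field_simps)

lemma norm4_seg:
  assumes z: "cmod z = 1" and L: "L2_4 \<phi>"
  shows "norm4 (seg k z a b c \<phi>) = norm4 \<phi>"
proof (rule norm4_cong_pairs)
  fix j
  let ?y = "ph k z j" and ?S = "seg k z a b c \<phi>"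
  have LS: "L2_4 ?S" by (rule L2_4_seg[OF L])
  have *: "2 * (l2n (\<psi> j))\<^sup>2 + 2 * (l2n (\<psi> (flip k j)))\<^sup>2
      = (l2n (\<lambda>x. \<psi> j x + ?y * \<psi> (flip k j) x))\<^sup>2 + (l2n (\<lambda>x. \<psi> j x - ?y * \<psi> (flip k j) x))\<^sup>2"
    if "L2_4 \<psi>" for \<psi>
    using parallelogram[OF L2_4D[OF that] L2_cmult[OF L2_4D[OF that]], of j ?y "flip k j"] z
    by (simp add: l2n_cmult cmod_ph)
  show "(l2n (?S j))\<^sup>2 + (l2n (?S (flip k j)))\<^sup>2 = (l2n (\<phi> j))\<^sup>2 + (l2n (\<phi> (flip k j)))\<^sup>2"
    using *[OF LS] *[OF L] unfolding seg_plus[OF z] seg_minus[OF z] l2n_weyl by linarith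
qed

section \<open>Weak solutions of the controlled system\<close>

text \<open>A control bundles \<open>u1, u1r, u1b, u2, u2r, u2b\<close> as the values at \<open>0, \<dots>, 5\<close>.\<close>

definition sol :: "(real \<Rightarrow> nat \<Rightarrow> complex) \<Rightarrow> real \<Rightarrow> state \<Rightarrow> (real \<Rightarrow> state) \<Rightarrow> bool" where
  "sol u T = is_solution (\<lambda>t. u t 0) (\<lambda>t. u t 1) (\<lambda>t. u t 2) (\<lambda>t. u t 3) (\<lambda>t. u t 4) (\<lambda>t. u t 5) T"

text \<open>The right-hand side sees the controls only through their current values. Removing the
  time argument makes it insensitive to the shift of time in a concatenation.\<close>

definition rv :: "(nat \<Rightarrow> complex) \<Rightarrow> state \<Rightarrow> comp \<Rightarrow> (nat \<Rightarrow> real \<Rightarrow> complex) \<Rightarrow> complex" where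
  "rv v f j D = rhs (\<lambda>_. v 0) (\<lambda>_. v 1) (\<lambda>_. v 2) (\<lambda>_. v 3) (\<lambda>_. v 4) (\<lambda>_. v 5) f 0 j D"

lemma sol_iff:
  "sol u T phi0 phi \<longleftrightarrow>
     (\<forall>t\<in>{0..T}. L2_4 (phi t))
   \<and> (\<forall>t\<in>{0..T}. ((\<lambda>s. norm4 (diff4 (phi s) (phi t))) \<longlongrightarrow> 0) (at t within {0..T}))
   \<and> norm4 (diff4 (phi 0) phi0) = 0
   \<and> (\<forall>D j t. test_fun D \<longrightarrow> t \<in> {0..T} \<longrightarrow>
        set_integrable lborel {0..t} (\<lambda>s. rv (u s) (phi s) j D)
      \<and> ip (phi t j) (D 0) = ip (phi 0 j) (D 0)
           - \<i> * (LINT s:{0..t}|lborel. rv (u s) (phi s) j D))"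
proof -
  have "rhs (\<lambda>t. u t 0) (\<lambda>t. u t 1) (\<lambda>t. u t 2) (\<lambda>t. u t 3) (\<lambda>t. u t 4) (\<lambda>t. u t 5) f s j D = rv (u s) f j D" for f s j D
    by (cases j) (simp_all add: rv_def rhs_def)
  then show ?thesis by (simp add: sol_def is_solution_def)
qed

text \<open>Since x = (a + a^dagger) / sqrt 2 and p = i (a^dagger - a) / sqrt 2, the last two
  nonzero entries are \<open>z\<close> times the coefficients of a^dagger and a in k1 x + k2
  p.\<close>

definition seg_ctrl :: "bool \<Rightarrow> complex \<Rightarrow> real \<Rightarrow> real \<Rightarrow> real \<Rightarrow> nat \<Rightarrow> complex" where
  "seg_ctrl k z k0 k1 k2 m =
    (if m = (if k then 0 else 3) then z * of_real k0
     else if m = (if k then 1 else 4) then z * ((of_real k1 + \<i> * of_real k2) / of_real (sqrt 2))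
     else if m = (if k then 2 else 5) then z * ((of_real k1 - \<i> * of_real k2) / of_real (sqrt 2))
     else 0)"

lemma of_real_sqrt2_sq: "complex_of_real (sqrt 2) * complex_of_real (sqrt 2) = 2"
  by (simp flip: of_real_mult)

lemma wk_ham:
  assumes f: "L2 f" and D: "test_fun D"
  shows "wk (z * of_real k0) (z * ((of_real k1 + \<i> * of_real k2) / of_real (sqrt 2)))
      (z * ((of_real k1 - \<i> * of_real k2) / of_real (sqrt 2))) f D = z * ip f (ham k0 k1 k2 D)"
proof -
  let ?s = "complex_of_real (sqrt 2)"
  let ?X = "ip f (\<lambda>x. of_real x * D 0 x)" and ?P = "ip f (D 1)"
  have "ann D = (\<lambda>x. (1 / ?s) * (of_real x * D 0 x + D 1 x))" by (simp add: ann_def fun_eq_iff)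
  then have a: "ip f (ann D) = (?X + ?P) / ?s"
    using ip_add_right[OF f test_fun_L2(2)[OF D] test_fun_L2(1)[OF D], of 0 1]
    by (simp only: ip_cmult_right) simp
  have "cre D = (\<lambda>x. (1 / ?s) * (of_real x * D 0 x - D 1 x))" by (simp add: cre_def fun_eq_iff)
  then have c: "ip f (cre D) = (?X - ?P) / ?s"
    using ip_diff_right[OF f test_fun_L2(2)[OF D] test_fun_L2(1)[OF D], of 0 1]
    by (simp only: ip_cmult_right) simp
  have "ip f (ham k0 k1 k2 D) = ip f (\<lambda>x. of_real k0 * D 0 x + of_real k1 * (of_real x * D 0 x)) - ip f (\<lambda>x. \<i> * of_real k2 * D 1 x)"
    unfolding ham_def by (intro ip_diff_right f L2_add L2_cmult test_fun_L2 D)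
  also have "ip f (\<lambda>x. of_real k0 * D 0 x + of_real k1 * (of_real x * D 0 x)) = ip f (\<lambda>x. of_real k0 * D 0 x) + ip f (\<lambda>x. of_real k1 * (of_real x * D 0 x))"
    by (intro ip_add_right f L2_add L2_cmult test_fun_L2 D)
  finally have h: "ip f (ham k0 k1 k2 D) = of_real k0 * ip f (D 0) + of_real k1 * ?X + \<i> * of_real k2 * ?P"
    by (simp only: ip_cmult_right) simp
  have e: "z * (p / ?s) * ((X + P) / ?s) = z * (p * (X + P)) / 2" for p X P
    using of_real_sqrt2_sq by (simp add: field_simps)
  have e': "z * (p / ?s) * ((X - P) / ?s) = z * (p * (X - P)) / 2" for p X P
    using e[of p X "- P"] by simp
  show ?thesis
    unfolding wk_def a c h e e' by (simp add: field_simps)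
qed

lemma wk_zero: "wk 0 0 0 f D = 0"
  by (simp add: wk_def)

text \<open>In the excited equation the controls are conjugated and the red and blue ones change
  places. As \<open>k0\<close>, \<open>k1\<close>, \<open>k2\<close> are real, this preserves the
  Hamiltonian and only conjugates \<open>z\<close>.\<close>

lemma rv_seg_ctrl:
  assumes f: "L2_4 f" and D: "test_fun D"
  shows "rv (seg_ctrl k z k0 k1 k2) f j D = ph k z j * ip (f (flip k j)) (ham k0 k1 k2 D)"
proof -
  have w: "wk (cnj z * of_real k0) (cnj z * ((of_real k1 + \<i> * of_real k2) / of_real (sqrt 2)))
      (cnj z * ((of_real k1 - \<i> * of_real k2) / of_real (sqrt 2))) (f i) D = cnj z * ip (f i) (ham k0 k1 k2 D)"
    "wk (z * of_real k0) (z * ((of_real k1 + \<i> * of_real k2) / of_real (sqrt 2)))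
      (z * ((of_real k1 - \<i> * of_real k2) / of_real (sqrt 2))) (f i) D = z * ip (f i) (ham k0 k1 k2 D)" for i
    by (intro wk_ham L2_4D f D)+
  show ?thesis
    using w by (cases k; cases j) (simp_all add: rv_def rhs_def seg_ctrl_def ph_def wk_zero)
qed

lemma seg_continuous:
  assumes L: "L2_4 \<phi>"
  shows "((\<lambda>s. norm4 (diff4 (seg k z (s * k0) (s * k1) (s * k2) \<phi>) (seg k z (t * k0) (t * k1) (t * k2) \<phi>))) \<longlongrightarrow> 0) (at t within S)"
  unfolding norm4_tendsto_0_iff
proof
  fix j
  let ?d = "\<lambda>s. diff4 (seg k z (s * k0) (s * k1) (s * k2) \<phi>) (seg k z (t * k0) (t * k1) (t * k2) \<phi>) j"
  let ?p = "\<lambda>x. \<phi> j x + ph k z j * \<phi> (flip k j) x" and ?m = "\<lambda>x. \<phi> j x - ph k z j * \<phi> (flip k j) x"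
  have Lp: "L2 ?p" and Lm: "L2 ?m" by (intro L2_add L2_diff L2_cmult L2_4D L)+
  let ?A = "\<lambda>s. \<lambda>x. ev k0 k1 k2 s ?p x - ev k0 k1 k2 t ?p x"
  let ?B = "\<lambda>s. \<lambda>x. ev (- k0) (- k1) (- k2) s ?m x - ev (- k0) (- k1) (- k2) t ?m x"
  show "((\<lambda>s. l2n (?d s)) \<longlongrightarrow> 0) (at t within S)"
  proof (rule Lim_null_comparison[OF always_eventually])
    have "((\<lambda>s. (l2n (?A s) + l2n (?B s)) / 2) \<longlongrightarrow> (0 + 0) / 2) (at t within S)"
      by (intro tendsto_intros ev_continuous Lp Lm) auto
    then show "((\<lambda>s. (l2n (?A s) + l2n (?B s)) / 2) \<longlongrightarrow> 0) (at t within S)" by simp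
    show "\<forall>s. norm (l2n (?d s)) \<le> (l2n (?A s) + l2n (?B s)) / 2"
    proof
      fix s
      have "?d s
         = (\<lambda>x. (1/2) * (?A s x + ?B s x))"
        by (simp add: diff4_def seg_def fun_eq_iff field_simps)
      moreover have "l2n (\<lambda>x. ?A s x + ?B s x) \<le> l2n (?A s) + l2n (?B s)"
        by (intro l2n_triangle L2_diff L2_weyl Lp Lm)
      moreover have "l2n (\<lambda>x. (1/2) * (?A s x + ?B s x)) = (1/2) * l2n (\<lambda>x. ?A s x + ?B s x)"
        unfolding l2n_cmult by simp
      ultimately show "norm (l2n (?d s)) \<le> (l2n (?A s) + l2n (?B s)) / 2"
        by (simp only: real_norm_def) simp
    qed
  qed
qed

lemma seg_zero: "seg k z 0 0 0 \<phi> = \<phi>"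
  by (intro ext) (simp add: seg_def)

text \<open>The two decoupled functions evolve with opposite generators, so differentiating their
  sum, which is component \<open>j\<close>, produces their difference, which is the coupling to
  \<open>flip k j\<close>. Integration in time gives the weak form.\<close>

lemma seg_solution:
  assumes z: "cmod z = 1" and L: "L2_4 \<phi>"
  shows "sol (\<lambda>_. seg_ctrl k z k0 k1 k2) T \<phi> (\<lambda>t. seg k z (t * k0) (t * k1) (t * k2) \<phi>)"
  unfolding sol_iff
proof (intro conjI ballI allI impI)
  let ?\<phi> = "\<lambda>t. seg k z (t * k0) (t * k1) (t * k2) \<phi>"
  show L\<phi>: "L2_4 (?\<phi> t)" for t using L by (rule L2_4_seg)
  show cont: "((\<lambda>s. norm4 (diff4 (?\<phi> s) (?\<phi> t))) \<longlongrightarrow> 0) (at t within {0..T})" for t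
    using L by (rule seg_continuous)
  show "norm4 (diff4 (?\<phi> 0) \<phi>) = 0" by (simp add: seg_zero)
  fix D j t assume D: "test_fun D" and t: "t \<in> {0..T}"
  let ?R = "\<lambda>s. rv (seg_ctrl k z k0 k1 k2) (?\<phi> s) j D"
  let ?y = "ph k z j"
  let ?p = "\<lambda>x. \<phi> j x + ?y * \<phi> (flip k j) x" and ?m = "\<lambda>x. \<phi> j x - ?y * \<phi> (flip k j) x"
  let ?h = "ham k0 k1 k2 D"
  let ?P = "\<lambda>s. ev k0 k1 k2 s ?p" and ?Q = "\<lambda>s. ev (- k0) (- k1) (- k2) s ?m"
  have Lp: "L2 ?p" and Lm: "L2 ?m" by (intro L2_add L2_diff L2_cmult L2_4D L)+
  have R: "?R s = ?y * ip (?\<phi> s (flip k j)) ?h" for s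
    by (rule rv_seg_ctrl[OF L\<phi> D])
  have cR: "continuous_on UNIV ?R"
    unfolding R continuous_on_def
  proof
    fix t
    have "((\<lambda>s. l2n (\<lambda>x. ?\<phi> s (flip k j) x - ?\<phi> t (flip k j) x)) \<longlongrightarrow> 0) (at t within UNIV)"
      using seg_continuous[OF L, of k z k0 k1 k2 t UNIV] unfolding norm4_tendsto_0_iff diff4_def by blast
    then show "((\<lambda>s. ?y * ip (?\<phi> s (flip k j)) ?h) \<longlongrightarrow> ?y * ip (?\<phi> t (flip k j)) ?h) (at t within UNIV)"
      by (intro tendsto_intros ip_tendsto_left always_eventually allI L2_4D L\<phi> L2_ham D)
  qed
  have si: "set_integrable lborel {0..t} ?R"
    by (rule borel_integrable_atLeastAtMost'[OF continuous_on_subset[OF cR]]) simp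
  then show "set_integrable lborel {0..t} ?R" .
  have ph: "?\<phi> s j = (\<lambda>x. (1/2) * (?P s x + ?Q s x))" for s
    by (simp add: seg_def fun_eq_iff)
  have ip_ph: "ip (?\<phi> s j) (D 0) = (1/2) * (ip (?P s) (D 0) + ip (?Q s) (D 0))" for s
    unfolding ph ip_cmult_left by (subst ip_add_left) (intro L2_weyl Lp Lm test_fun_L2 D refl)+
  have ip_fl: "?y * ip (?\<phi> s (flip k j)) ?h
      = (1/2) * (ip (?P s) ?h - ip (?Q s) ?h)" for s
  proof -
    have "(\<lambda>x. ?y * ?\<phi> s (flip k j) x) = (\<lambda>x. (1/2) * (?P s x - ?Q s x))"
      unfolding seg_flip[OF z] by (simp add: fun_eq_iff)
    then have "?y * ip (?\<phi> s (flip k j)) ?h = ip (\<lambda>x. (1/2) * (?P s x - ?Q s x)) ?h"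
      unfolding ip_cmult_left[symmetric] by simp
    also have "\<dots> = (1/2) * (ip (?P s) ?h - ip (?Q s) ?h)"
      unfolding ip_cmult_left by (subst ip_diff_left) (intro L2_weyl Lp Lm L2_ham D refl)+
    finally show ?thesis .
  qed
  have hneg: "ip g (ham (- k0) (- k1) (- k2) D) = - ip g ?h" for g
    using ip_ham_scale[of _ "-1"] by simp
  have "((\<lambda>s. ip (?\<phi> s j) (D 0)) has_vector_derivative - \<i> * ?R s) (at s within {0..t})" for s
  proof -
    have "((\<lambda>s. (1/2) * (ip (?P s) (D 0) + ip (?Q s) (D 0))) has_vector_derivative
       (1/2) * (- \<i> * ip (?P s) ?h + - \<i> * ip (?Q s) (ham (- k0) (- k1) (- k2) D))) (at s within {0..t})"
      by (intro has_vector_derivative_mult_right has_vector_derivative_add ev_weak_derivative Lp Lm D)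
    then show ?thesis
      unfolding ip_ph R ip_fl hneg by (rule has_vector_derivative_eq_rhs) (simp add: algebra_simps)
  qed
  then have "((\<lambda>s. - \<i> * ?R s) has_integral (ip (?\<phi> t j) (D 0) - ip (?\<phi> 0 j) (D 0))) {0..t}"
    using t by (intro fundamental_theorem_of_calculus) auto
  then have "integral {0..t} (\<lambda>s. - \<i> * ?R s) = ip (?\<phi> t j) (D 0) - ip (?\<phi> 0 j) (D 0)"
    by (rule integral_unique)
  moreover have "(LINT s:{0..t}|lborel. ?R s) = integral {0..t} ?R"
    by (rule set_borel_integral_eq_integral(2)[OF si])
  ultimately show "ip (?\<phi> t j) (D 0) = ip (?\<phi> 0 j) (D 0) - \<i> * (LINT s:{0..t}|lborel. ?R s)"
    by (simp add: algebra_simps)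
qed

text \<open>For an arbitrary weak solution,
  \<open>\<psi> j \<plusminus> ph k z j * \<psi> (flip k j)\<close> are weak solutions of scalar
  equations with opposite Hamiltonians, to which \<open>weak_solution_unique\<close>
  applies.\<close>

lemma seg_solution_unique:
  assumes z: "cmod z = 1" and L: "L2_4 \<phi>" and T: "T \<ge> 0"
    and s: "sol (\<lambda>_. seg_ctrl k z k0 k1 k2) T \<phi> \<psi>"
  shows "norm4 (diff4 (\<psi> T) (seg k z (T * k0) (T * k1) (T * k2) \<phi>)) = 0"
proof -
  have L\<psi>: "\<And>t. t \<in> {0..T} \<Longrightarrow> L2_4 (\<psi> t)"
    and cont: "\<And>t. t \<in> {0..T} \<Longrightarrow> ((\<lambda>s. norm4 (diff4 (\<psi> s) (\<psi> t))) \<longlongrightarrow> 0) (at t within {0..T})"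
    and init: "norm4 (diff4 (\<psi> 0) \<phi>) = 0"
    and si: "\<And>D j t. test_fun D \<Longrightarrow> t \<in> {0..T} \<Longrightarrow> set_integrable lborel {0..t} (\<lambda>s. rv (seg_ctrl k z k0 k1 k2) (\<psi> s) j D)"
    and eq: "\<And>D j t. test_fun D \<Longrightarrow> t \<in> {0..T} \<Longrightarrow> ip (\<psi> t j) (D 0) = ip (\<psi> 0 j) (D 0)
           - \<i> * (LINT s:{0..t}|lborel. rv (seg_ctrl k z k0 k1 k2) (\<psi> s) j D)"
    using s unfolding sol_iff by blast+
  have T0: "0 \<in> {0..T}" "T \<in> {0..T}" using T by auto
  have intg: "(\<lambda>s. ip (\<psi> s j) (ham k0 k1 k2 D)) integrable_on {0..t}" (is ?a)
    and eq': "ip (\<psi> t j) (D 0) = ip (\<psi> 0 j) (D 0) - \<i> * (ph k z j * integral {0..t} (\<lambda>s. ip (\<psi> s (flip k j)) (ham k0 k1 k2 D)))" (is ?b)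
    if D: "test_fun D" and t: "t \<in> {0..T}" for D j t
  proof -
    have r: "rv (seg_ctrl k z k0 k1 k2) (\<psi> s) i D = ph k z i * ip (\<psi> s (flip k i)) (ham k0 k1 k2 D)" if "s \<in> {0..t}" for s i
      by (rule rv_seg_ctrl[OF L\<psi> D]) (use that t in auto)
    have "(\<lambda>s. cnj (ph k z (flip k j)) * rv (seg_ctrl k z k0 k1 k2) (\<psi> s) (flip k j) D) integrable_on {0..t}"
      using set_borel_integral_eq_integral(1)[OF si[OF D t]] by (rule integrable_on_mult_right)
    then show ?a
      by (rule integrable_eq) (use ph_mult_cnj[OF z, of k "flip k j"] in \<open>simp add: r mult.assoc[symmetric] mult.commute\<close>)
    have "integral {0..t} (\<lambda>s. rv (seg_ctrl k z k0 k1 k2) (\<psi> s) j D) = integral {0..t} (\<lambda>s. ph k z j * ip (\<psi> s (flip k j)) (ham k0 k1 k2 D))"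
      by (rule integral_cong) (rule r)
    then show ?b
      using eq[OF D t, of j] set_borel_integral_eq_integral(2)[OF si[OF D t], of j] by simp
  qed
  \<comment> \<open>The sign is carried twice, as the complex coefficient \<open>\<sigma>\<close>
    and as the real \<open>r\<close> in the parameters of \<open>ham\<close>, so that both
    combinations are treated at once.\<close>
  have main: "l2n (\<lambda>x. (\<psi> T j x + \<sigma> * (ph k z j * \<psi> T (flip k j) x)) - ev (r * k0) (r * k1) (r * k2) T (\<lambda>x. \<psi> 0 j x + \<sigma> * (ph k z j * \<psi> 0 (flip k j) x)) x) = 0"
    if \<sigma>: "\<sigma> = of_real r" "r = 1 \<or> r = - 1" for \<sigma> r j
  proof (rule weak_solution_unique[where f="\<lambda>t x. \<psi> t j x + \<sigma> * (ph k z j * \<psi> t (flip k j) x)", OF T])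
    have \<sigma>2: "\<sigma> * \<sigma> = 1" "cmod \<sigma> = 1" using \<sigma> by auto
    let ?y = "ph k z j"
    let ?f = "\<lambda>s x. \<psi> s j x + \<sigma> * (?y * \<psi> s (flip k j) x)"
    fix t assume t: "t \<in> {0..T}"
    show "L2 (?f t)"
      by (intro L2_add L2_cmult L2_4D L\<psi> t)
    have c: "((\<lambda>s. l2n (\<lambda>x. \<psi> s i x - \<psi> t i x)) \<longlongrightarrow> 0) (at t within {0..T})" for i
      using cont[OF t] unfolding norm4_tendsto_0_iff by (simp add: diff4_def)
    show "((\<lambda>s. l2n (\<lambda>x. ?f s x - ?f t x)) \<longlongrightarrow> 0) (at t within {0..T})"
    proof (rule Lim_null_comparison)
      show "((\<lambda>s. l2n (\<lambda>x. \<psi> s j x - \<psi> t j x) + l2n (\<lambda>x. \<psi> s (flip k j) x - \<psi> t (flip k j) x)) \<longlongrightarrow> 0) (at t within {0..T})"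
        using tendsto_add[OF c[of j] c[of "flip k j"]] by simp
      have "l2n (\<lambda>x. ?f s x - ?f t x)
          \<le> l2n (\<lambda>x. \<psi> s j x - \<psi> t j x) + l2n (\<lambda>x. \<psi> s (flip k j) x - \<psi> t (flip k j) x)" if s: "s \<in> {0..T}" for s
      proof -
        have "l2n (\<lambda>x. ?f s x - ?f t x)
          = l2n (\<lambda>x. (\<psi> s j x - \<psi> t j x) + (\<sigma> * ?y) * (\<psi> s (flip k j) x - \<psi> t (flip k j) x))"
          by (simp add: algebra_simps)
        also have "\<dots> \<le> l2n (\<lambda>x. \<psi> s j x - \<psi> t j x) + l2n (\<lambda>x. (\<sigma> * ?y) * (\<psi> s (flip k j) x - \<psi> t (flip k j) x))"
          by (intro l2n_triangle L2_cmult L2_diff L2_4D L\<psi> s t)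
        also have "l2n (\<lambda>x. (\<sigma> * ?y) * (\<psi> s (flip k j) x - \<psi> t (flip k j) x)) = l2n (\<lambda>x. \<psi> s (flip k j) x - \<psi> t (flip k j) x)"
          unfolding l2n_cmult by (simp add: norm_mult \<sigma>2 cmod_ph z)
        finally show ?thesis .
      qed
      then show "\<forall>\<^sub>F s in at t within {0..T}. norm (l2n (\<lambda>x. ?f s x - ?f t x))
          \<le> l2n (\<lambda>x. \<psi> s j x - \<psi> t j x) + l2n (\<lambda>x. \<psi> s (flip k j) x - \<psi> t (flip k j) x)"
        by (auto simp: eventually_at_filter)
    qed
    fix D assume D: "test_fun D"
    let ?h = "ham k0 k1 k2 D"
    have ipc: "ip (?f s) g = ip (\<psi> s j) g + \<sigma> * (?y * ip (\<psi> s (flip k j)) g)"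
      if "s \<in> {0..T}" "L2 g" for s g
      using ip_add_left[OF L2_4D[OF L\<psi>[OF that(1)]] L2_cmult[OF L2_cmult[OF L2_4D[OF L\<psi>[OF that(1)]]]] that(2), of j \<sigma> ?y "flip k j"]
      by (simp only: ip_cmult_left)
    have hr: "ip g (ham (r * k0) (r * k1) (r * k2) D) = \<sigma> * ip g ?h" for g
      using \<sigma>(1) by (simp only: ip_ham_scale)
    have alg: "\<sigma> * A + \<sigma> * (y * (\<sigma> * B)) = \<sigma> * A + y * B" for A B y using \<sigma>2(1) by algebra
    let ?I = "integral {0..t} (\<lambda>s. ip (\<psi> s j) ?h)" and ?J = "integral {0..t} (\<lambda>s. ip (\<psi> s (flip k j)) ?h)"
    have "integral {0..t} (\<lambda>s. ip (?f s) (ham (r * k0) (r * k1) (r * k2) D))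
      = integral {0..t} (\<lambda>s. \<sigma> * ip (\<psi> s j) ?h + ?y * ip (\<psi> s (flip k j)) ?h)"
    proof (rule integral_cong)
      fix s assume "s \<in> {0..t}"
      then have "s \<in> {0..T}" using t by auto
      then show "ip (?f s) (ham (r * k0) (r * k1) (r * k2) D) = \<sigma> * ip (\<psi> s j) ?h + ?y * ip (\<psi> s (flip k j)) ?h"
        unfolding hr ipc[OF \<open>s \<in> {0..T}\<close> L2_ham[OF D]] by (simp only: alg)
    qed
    also have "\<dots> = \<sigma> * ?I + ?y * ?J"
      using intg[OF D t, of j] intg[OF D t, of "flip k j"]
      by (subst Henstock_Kurzweil_Integration.integral_add) (auto intro!: integrable_on_mult_right)
    finally have i: "integral {0..t} (\<lambda>s. ip (?f s) (ham (r * k0) (r * k1) (r * k2) D)) = \<sigma> * ?I + ?y * ?J" .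
    have "ip (\<psi> t (flip k j)) (D 0) = ip (\<psi> 0 (flip k j)) (D 0) - \<i> * (cnj ?y * ?I)"
      using eq'[OF D t, of "flip k j"] by (simp add: ph_flip)
    then have "\<sigma> * (?y * ip (\<psi> t (flip k j)) (D 0)) = \<sigma> * (?y * ip (\<psi> 0 (flip k j)) (D 0)) - \<i> * (\<sigma> * ((?y * cnj ?y) * ?I))"
      by (simp only:) (simp add: algebra_simps)
    then show "ip (?f t) (D 0) = ip (?f 0) (D 0)
        - \<i> * integral {0..t} (\<lambda>s. ip (?f s) (ham (r * k0) (r * k1) (r * k2) D))"
      unfolding i ipc[OF t test_fun_L2(1)[OF D]] ipc[OF T0(1) test_fun_L2(1)[OF D]] eq'[OF D t, of j] ph_mult_cnj[OF z]
      by (simp add: algebra_simps)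
  qed
  let ?S = "seg k z (T * k0) (T * k1) (T * k2)"
  have "norm4 (diff4 (\<psi> T) (?S (\<psi> 0))) = 0"
    unfolding norm4_eq_0_iff
  proof
    fix j
    let ?y = "ph k z j"
    let ?p = "\<lambda>x. \<psi> 0 j x + ?y * \<psi> 0 (flip k j) x" and ?m = "\<lambda>x. \<psi> 0 j x - ?y * \<psi> 0 (flip k j) x"
    let ?A = "\<lambda>x. (\<psi> T j x + ?y * \<psi> T (flip k j) x) - ev k0 k1 k2 T ?p x"
    let ?B = "\<lambda>x. (\<psi> T j x - ?y * \<psi> T (flip k j) x) - ev (- k0) (- k1) (- k2) T ?m x"
    have A: "l2n ?A = 0" using main[of 1 1 j] by simp
    have B: "l2n ?B = 0" using main[of "-1" "-1" j] by simp
    have "diff4 (\<psi> T) (?S (\<psi> 0)) j = (\<lambda>x. (1/2) * (?A x + ?B x))"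
      by (simp add: diff4_def seg_def fun_eq_iff field_simps)
    moreover have "l2n (\<lambda>x. ?A x + ?B x) \<le> l2n ?A + l2n ?B"
      by (intro l2n_triangle L2_add L2_diff L2_cmult L2_weyl L2_4D L\<psi> T0)
    moreover have "l2n (\<lambda>x. (1/2) * (?A x + ?B x)) = (1/2) * l2n (\<lambda>x. ?A x + ?B x)"
      unfolding l2n_cmult by simp
    ultimately show "l2n (diff4 (\<psi> T) (?S (\<psi> 0)) j) = 0"
      using A B l2n_nonneg[of "\<lambda>x. ?A x + ?B x"] by (simp only:)
  qed
  \<comment> \<open>A solution takes its initial value only up to a null set, so
    \<open>\<psi> 0\<close> still has to be replaced by \<open>\<phi>\<close>.\<close>
  moreover have "norm4 (diff4 (?S (\<psi> 0)) (?S \<phi>)) = 0"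
    using norm4_seg[OF z L2_4_diff4[OF L\<psi>[OF T0(1)] L]] init by (simp add: seg_diff4)
  moreover have "norm4 (diff4 (\<psi> T) (?S \<phi>)) \<le> norm4 (diff4 (\<psi> T) (?S (\<psi> 0))) + norm4 (diff4 (?S (\<psi> 0)) (?S \<phi>))"
    by (intro norm4_diff4_triangle L2_4_seg L L\<psi> T0)
  ultimately show ?thesis using norm4_nonneg[of "diff4 (\<psi> T) (?S \<phi>)"] by linarith
qed

section \<open>Concatenation of controls\<close>

definition cat :: "real \<Rightarrow> (real \<Rightarrow> nat \<Rightarrow> complex) \<Rightarrow> (real \<Rightarrow> nat \<Rightarrow> complex) \<Rightarrow> real \<Rightarrow> nat \<Rightarrow> complex" where
  "cat T u v t = (if t < T then u t else v (t - T))"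

text \<open>A concatenated control already takes its second value at the switching time, where the
  first piece still expects its own. A single endpoint does not affect the integrals.\<close>

lemma
  fixes F :: "real \<Rightarrow> complex"
  shows set_integrable_Icc_Ico: "set_integrable lborel {a..b} F \<longleftrightarrow> set_integrable lborel {a..<b} F"
    and set_integral_Icc_Ico: "(LINT s:{a..b}|lborel. F s) = (LINT s:{a..<b}|lborel. F s)"
  unfolding set_integrable_def set_lebesgue_integral_def
  by (rule integrable_discrete_difference[where X="{b}"] integral_discrete_difference[where X="{b}"];
      auto simp: indicator_def)+

lemma
  fixes F :: "real \<Rightarrow> complex"
  shows set_integrable_shift: "set_integrable lborel {T..T + t} F \<longleftrightarrow> set_integrable lborel {0..t} (\<lambda>s. F (T + s))"
    and set_integral_shift: "(LINT s:{T..T + t}|lborel. F s) = (LINT s:{0..t}|lborel. F (T + s))"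
proof -
  have i: "indicator {T..T + t} (T + s) = (indicator {0..t} s :: real)" for s by (auto simp: indicator_def)
  show "set_integrable lborel {T..T + t} F \<longleftrightarrow> set_integrable lborel {0..t} (\<lambda>s. F (T + s))"
    unfolding set_integrable_def
    using lborel_integrable_real_affine_iff[of 1 "\<lambda>s. indicator {T..T + t} s *\<^sub>R F s" T] by (simp add: i)
  show "(LINT s:{T..T + t}|lborel. F s) = (LINT s:{0..t}|lborel. F (T + s))"
    unfolding set_lebesgue_integral_def
    using lborel_integral_real_affine[of 1 "\<lambda>s. indicator {T..T + t} s *\<^sub>R F s" T] by (simp add: i)
qed

lemma
  fixes F G H :: "real \<Rightarrow> complex"
  assumes T: "0 \<le> T" and t: "0 \<le> t"
    and G: "\<And>s. 0 \<le> s \<Longrightarrow> s < T \<Longrightarrow> F s = G s" and H: "\<And>s. 0 \<le> s \<Longrightarrow> s \<le> t \<Longrightarrow> F (T + s) = H s"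
  shows cat_integrable: "set_integrable lborel {0..T + t} F \<longleftrightarrow> set_integrable lborel {0..T} G \<and> set_integrable lborel {0..t} H"
    and cat_integral: "set_integrable lborel {0..T} G \<Longrightarrow> set_integrable lborel {0..t} H \<Longrightarrow>
       (LINT s:{0..T + t}|lborel. F s) = (LINT s:{0..T}|lborel. G s) + (LINT s:{0..t}|lborel. H s)"
proof -
  have U: "{0..T + t} = {0..<T} \<union> {T..T + t}" using T t by auto
  have 1: "set_integrable lborel {0..T} G \<longleftrightarrow> set_integrable lborel {0..<T} F"
    unfolding set_integrable_Icc_Ico by (rule set_integrable_cong) (use G in auto)
  have 2: "set_integrable lborel {0..t} H \<longleftrightarrow> set_integrable lborel {T..T + t} F"
    unfolding set_integrable_shift by (rule set_integrable_cong) (use H in auto)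
  have I1: "(LINT s:{0..T}|lborel. G s) = (LINT s:{0..<T}|lborel. F s)"
    unfolding set_integral_Icc_Ico by (rule set_lebesgue_integral_cong) (use G in auto)
  have I2: "(LINT s:{0..t}|lborel. H s) = (LINT s:{T..T + t}|lborel. F s)"
    unfolding set_integral_shift by (rule set_lebesgue_integral_cong) (use H in auto)
  have u: "set_integrable lborel ({0..<T} \<union> {T..T + t}) F \<longleftrightarrow> set_integrable lborel {0..<T} F \<and> set_integrable lborel {T..T + t} F"
    by (auto intro!: set_integrable_Un intro: set_integrable_subset)
  then show "set_integrable lborel {0..T + t} F \<longleftrightarrow> set_integrable lborel {0..T} G \<and> set_integrable lborel {0..t} H"
    unfolding U 1 2 .
  show "(LINT s:{0..T + t}|lborel. F s) = (LINT s:{0..T}|lborel. G s) + (LINT s:{0..t}|lborel. H s)"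
    if "set_integrable lborel {0..T} G" "set_integrable lborel {0..t} H"
    using that unfolding U 1 2 I1 I2 by (intro set_integral_Un) auto
qed

lemma at_within_shift:
  fixes f :: "real \<Rightarrow> real"
  shows "((\<lambda>s. f (T + s)) \<longlongrightarrow> l) (at t within {0..S}) \<longleftrightarrow> (f \<longlongrightarrow> l) (at (T + t) within {T..T + S})"
proof
  have 1: "filterlim (\<lambda>s. T + s) (at (T + t) within {T..T + S}) (at t within {0..S})"
    unfolding filterlim_at by (auto simp: eventually_at_filter intro!: tendsto_intros)
  have 2: "filterlim (\<lambda>s. s - T) (at t within {0..S}) (at (T + t) within {T..T + S})"
    unfolding filterlim_at by (auto simp: eventually_at_filter intro!: tendsto_eq_intros)
  show "(f \<longlongrightarrow> l) (at (T + t) within {T..T + S})" if "((\<lambda>s. f (T + s)) \<longlongrightarrow> l) (at t within {0..S})"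
    using filterlim_compose[OF that 2] by simp
  show "((\<lambda>s. f (T + s)) \<longlongrightarrow> l) (at t within {0..S})" if "(f \<longlongrightarrow> l) (at (T + t) within {T..T + S})"
    using filterlim_compose[OF that 1] .
qed

text \<open>Restriction to the first piece. Together with restriction to the second it makes
  uniqueness of the end state pass to concatenations.\<close>

lemma sol_cat_left:
  assumes T: "0 \<le> T" "0 \<le> S" and s: "sol (cat T u v) (T + S) \<phi> \<psi>"
  shows "sol u T \<phi> \<psi>"
  unfolding sol_iff
proof (intro conjI ballI allI impI)
  note s' = s[unfolded sol_iff]
  have sub: "t \<in> {0..T + S}" if "t \<in> {0..T}" for t using that T by auto
  show "L2_4 (\<psi> t)" if "t \<in> {0..T}" for t using s' sub[OF that] by blast
  show "((\<lambda>s. norm4 (diff4 (\<psi> s) (\<psi> t))) \<longlongrightarrow> 0) (at t within {0..T})" if "t \<in> {0..T}" for t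
    by (rule tendsto_within_subset[where S="{0..T + S}"]) (use s' sub that in blast)+
  show "norm4 (diff4 (\<psi> 0) \<phi>) = 0" using s' by blast
  fix D j t assume D: "test_fun D" and t: "t \<in> {0..T}"
  have e: "set_integrable lborel {0..t} (\<lambda>s. rv (cat T u v s) (\<psi> s) j D) \<longleftrightarrow> set_integrable lborel {0..t} (\<lambda>s. rv (u s) (\<psi> s) j D)"
    unfolding set_integrable_Icc_Ico by (rule set_integrable_cong) (use t in \<open>auto simp: cat_def\<close>)
  have i: "(LINT s:{0..t}|lborel. rv (cat T u v s) (\<psi> s) j D) = (LINT s:{0..t}|lborel. rv (u s) (\<psi> s) j D)"
    unfolding set_integral_Icc_Ico by (rule set_lebesgue_integral_cong) (use t in \<open>auto simp: cat_def\<close>)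
  show "set_integrable lborel {0..t} (\<lambda>s. rv (u s) (\<psi> s) j D)"
    using s' D sub[OF t] e by blast
  show "ip (\<psi> t j) (D 0) = ip (\<psi> 0 j) (D 0) - \<i> * (LINT s:{0..t}|lborel. rv (u s) (\<psi> s) j D)"
    using s' D sub[OF t] unfolding i[symmetric] by blast
qed

text \<open>The first piece determines its end state only up to a null set, which is why the new
  datum \<open>\<phi>'\<close> is compared with \<open>\<psi> T\<close> in norm.\<close>

lemma sol_cat_right:
  assumes T: "0 \<le> T" "0 \<le> S" and s: "sol (cat T u v) (T + S) \<phi> \<psi>" and e: "norm4 (diff4 (\<psi> T) \<phi>') = 0"
  shows "sol v S \<phi>' (\<lambda>t. \<psi> (T + t))"
  unfolding sol_iff
proof (intro conjI ballI allI impI)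
  note s' = s[unfolded sol_iff]
  have sub: "T + t \<in> {0..T + S}" if "t \<in> {0..S}" for t using that T by auto
  show "L2_4 (\<psi> (T + t))" if "t \<in> {0..S}" for t using s' sub[OF that] by blast
  show "((\<lambda>s. norm4 (diff4 (\<psi> (T + s)) (\<psi> (T + t)))) \<longlongrightarrow> 0) (at t within {0..S})" if "t \<in> {0..S}" for t
    unfolding at_within_shift[where f="\<lambda>s. norm4 (diff4 (\<psi> s) (\<psi> (T + t)))"]
    by (rule tendsto_within_subset[where S="{0..T + S}"]) (use s' sub[OF that] T in auto)
  show "norm4 (diff4 (\<psi> (T + 0)) \<phi>') = 0" using e by simp
  fix D j t assume D: "test_fun D" and t: "t \<in> {0..S}"
  let ?F = "\<lambda>s. rv (cat T u v s) (\<psi> s) j D" and ?G = "\<lambda>s. rv (u s) (\<psi> s) j D" and ?H = "\<lambda>s. rv (v s) (\<psi> (T + s)) j D"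
  have l: "sol u T \<phi> \<psi>" by (rule sol_cat_left[OF T s])
  have TT: "T \<in> {0..T}" using T by auto
  have G: "set_integrable lborel {0..T} ?G" "ip (\<psi> T j) (D 0) = ip (\<psi> 0 j) (D 0) - \<i> * (LINT s:{0..T}|lborel. ?G s)"
    using l D TT unfolding sol_iff by blast+
  have F: "set_integrable lborel {0..T + t} ?F" "ip (\<psi> (T + t) j) (D 0) = ip (\<psi> 0 j) (D 0) - \<i> * (LINT s:{0..T + t}|lborel. ?F s)"
    using s' D sub[OF t] by blast+
  have c: "?F s = ?G s" if "s < T" for s using that by (simp add: cat_def)
  have c': "?F (T + s) = ?H s" if "0 \<le> s" for s using that by (simp add: cat_def)
  show H: "set_integrable lborel {0..t} ?H"
    using cat_integrable[of T t ?F ?G ?H] F(1) c c' T t by auto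
  have "(LINT s:{0..T + t}|lborel. ?F s) = (LINT s:{0..T}|lborel. ?G s) + (LINT s:{0..t}|lborel. ?H s)"
    by (rule cat_integral) (use c c' T t G(1) H in auto)
  then show "ip (\<psi> (T + t) j) (D 0) = ip (\<psi> (T + 0) j) (D 0) - \<i> * (LINT s:{0..t}|lborel. ?H s)"
    using F(2) G(2) by (simp add: distrib_left)
qed

text \<open>Gluing asks for \<open>\<eta> 0 = \<psi> T\<close> as functions, so that the two
  formulas agree at the switching time.\<close>

lemma sol_cat:
  assumes T: "0 \<le> T" "0 \<le> S" and a: "sol u T \<phi> \<psi>" and b: "sol v S (\<psi> T) \<eta>" "\<eta> 0 = \<psi> T"
  shows "sol (cat T u v) (T + S) \<phi> (\<lambda>t. if t \<le> T then \<psi> t else \<eta> (t - T))"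
proof -
  define p where "p t = (if t \<le> T then \<psi> t else \<eta> (t - T))" for t
  note a' = a[unfolded sol_iff] and b' = b(1)[unfolded sol_iff]
  have p1: "p t = \<psi> t" if "t \<le> T" for t using that by (simp add: p_def)
  have p2: "p (T + t) = \<eta> t" if "t \<ge> 0" for t using that b(2) by (cases "t = 0") (auto simp: p_def)
  have split: "t \<in> {0..T} \<or> (\<exists>s\<in>{0..S}. t = T + s)" if "t \<in> {0..T + S}" for t
    using that by (cases "t \<le> T") (auto intro!: bexI[of _ "t - T"])
  have "sol (cat T u v) (T + S) \<phi> p"
    unfolding sol_iff
  proof (intro conjI ballI allI impI)
    show "L2_4 (p t)" if "t \<in> {0..T + S}" for t
      using split[OF that]
    proof
      assume "t \<in> {0..T}"
      then show ?thesis using a' p1[of t] by simp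
    next
      assume "\<exists>s\<in>{0..S}. t = T + s"
      then obtain r where "r \<in> {0..S}" "t = T + r" by blast
      then show ?thesis using b' p2[of r] by simp
    qed
    show "norm4 (diff4 (p 0) \<phi>) = 0" using a' p1[of 0] T by simp
    show "((\<lambda>s. norm4 (diff4 (p s) (p t))) \<longlongrightarrow> 0) (at t within {0..T + S})" if t: "t \<in> {0..T + S}" for t
    proof -
      \<comment> \<open>Continuity is checked on the two closed pieces separately; on a piece that
        does not contain \<open>t\<close> the filter is trivial.\<close>
      have U: "{0..T + S} = {0..T} \<union> {T..T + S}" using T by auto
      have "((\<lambda>s. norm4 (diff4 (p s) (p t))) \<longlongrightarrow> 0) (at t within {0..T})"
      proof (cases "t \<in> {0..T}")
        case True
        have "((\<lambda>s. norm4 (diff4 (\<psi> s) (\<psi> t))) \<longlongrightarrow> 0) (at t within {0..T})" using a' True by blast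
        then show ?thesis
          by (rule Lim_transform_eventually) (use True p1 in \<open>auto simp: eventually_at_filter\<close>)
      next
        case False
        then have "at t within {0..T} = bot" by (intro not_in_closure_trivial_limitI) simp
        then show ?thesis by simp
      qed
      moreover have "((\<lambda>s. norm4 (diff4 (p s) (p t))) \<longlongrightarrow> 0) (at t within {T..T + S})"
      proof (cases "t \<ge> T")
        case True
        define r where "r = t - T"
        have r: "t = T + r" "r \<in> {0..S}" using True t by (auto simp: r_def)
        have "((\<lambda>s. norm4 (diff4 (\<eta> s) (\<eta> r))) \<longlongrightarrow> 0) (at r within {0..S})" using b' r(2) by blast
        then have "((\<lambda>s. norm4 (diff4 (p (T + s)) (p t))) \<longlongrightarrow> 0) (at r within {0..S})"
          by (rule Lim_transform_eventually) (use r p2[of r] p2 in \<open>auto simp: eventually_at_filter\<close>)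
        then show ?thesis
          unfolding r(1) at_within_shift[where f="\<lambda>s. norm4 (diff4 (p s) (p (T + r)))"] .
      next
        case False
        then have "at t within {T..T + S} = bot" by (intro not_in_closure_trivial_limitI) simp
        then show ?thesis by simp
      qed
      ultimately show ?thesis unfolding U by (simp only: Lim_within_Un)
    qed
    fix D j t assume D: "test_fun D" and t: "t \<in> {0..T + S}"
    let ?F = "\<lambda>s. rv (cat T u v s) (p s) j D" and ?G = "\<lambda>s. rv (u s) (\<psi> s) j D" and ?H = "\<lambda>s. rv (v s) (\<eta> s) j D"
    have c: "?F s = ?G s" if "s < T" for s using that p1[of s] by (simp add: cat_def)
    have c': "?F (T + s) = ?H s" if "0 \<le> s" for s using p2[OF that] that by (simp add: cat_def)
    have "set_integrable lborel {0..t} ?F \<and> ip (p t j) (D 0) = ip (p 0 j) (D 0) - \<i> * (LINT s:{0..t}|lborel. ?F s)"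
      using split[OF t]
    proof
      assume t: "t \<in> {0..T}"
      have e: "set_integrable lborel {0..t} ?F \<longleftrightarrow> set_integrable lborel {0..t} ?G"
        unfolding set_integrable_Icc_Ico by (rule set_integrable_cong) (use t c in auto)
      have i: "(LINT s:{0..t}|lborel. ?F s) = (LINT s:{0..t}|lborel. ?G s)"
        unfolding set_integral_Icc_Ico by (rule set_lebesgue_integral_cong) (use t c in auto)
      have "p t = \<psi> t" "p 0 = \<psi> 0" using t T p1 by auto
      moreover have "set_integrable lborel {0..t} ?G" "ip (\<psi> t j) (D 0) = ip (\<psi> 0 j) (D 0) - \<i> * (LINT s:{0..t}|lborel. ?G s)"
        using a' D t by blast+
      ultimately show ?thesis unfolding e i by simp
    next
      assume "\<exists>s\<in>{0..S}. t = T + s"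
      then obtain r where r: "r \<in> {0..S}" "t = T + r" by blast
      have TT: "T \<in> {0..T}" using T by auto
      have G: "set_integrable lborel {0..T} ?G" "ip (\<psi> T j) (D 0) = ip (\<psi> 0 j) (D 0) - \<i> * (LINT s:{0..T}|lborel. ?G s)"
        using a' D TT by blast+
      have H: "set_integrable lborel {0..r} ?H" "ip (\<eta> r j) (D 0) = ip (\<eta> 0 j) (D 0) - \<i> * (LINT s:{0..r}|lborel. ?H s)"
        using b' D r by blast+
      have F: "set_integrable lborel {0..T + r} ?F"
        using cat_integrable[of T r ?F ?G ?H] c c' T r G H by auto
      have "(LINT s:{0..T + r}|lborel. ?F s) = (LINT s:{0..T}|lborel. ?G s) + (LINT s:{0..r}|lborel. ?H s)"
        by (rule cat_integral) (use c c' T r G(1) H(1) in auto)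
      then show ?thesis
        using F G H b(2) p1[of 0] p2[of r] T r by (simp add: distrib_left)
    qed
    then show "set_integrable lborel {0..t} ?F" "ip (p t j) (D 0) = ip (p 0 j) (D 0) - \<i> * (LINT s:{0..t}|lborel. ?F s)"
      by blast+
  qed
  then show ?thesis unfolding p_def .
qed

text \<open>Existence and uniqueness of the end state for all initial data, the form that survives
  composition. Existence is asked with \<open>\<psi> 0 = \<phi>\<close> exactly, as gluing
  requires.\<close>

definition steers :: "(real \<Rightarrow> nat \<Rightarrow> complex) \<Rightarrow> real \<Rightarrow> (state \<Rightarrow> state) \<Rightarrow> bool" where
  "steers u T E \<longleftrightarrow> 0 \<le> T \<and> (\<forall>\<phi>. L2_4 \<phi> \<longrightarrow> L2_4 (E \<phi>) \<and> (\<exists>\<psi>. sol u T \<phi> \<psi> \<and> \<psi> 0 = \<phi>)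
     \<and> (\<forall>\<psi>. sol u T \<phi> \<psi> \<longrightarrow> norm4 (diff4 (\<psi> T) (E \<phi>)) = 0))"

lemma steers_seg:
  assumes "cmod z = 1" "0 \<le> T"
  shows "steers (\<lambda>_. seg_ctrl k z k0 k1 k2) T (seg k z (T * k0) (T * k1) (T * k2))"
  unfolding steers_def
proof (intro conjI allI impI exI)
  fix \<phi> assume L: "L2_4 \<phi>"
  show "L2_4 (seg k z (T * k0) (T * k1) (T * k2) \<phi>)" by (rule L2_4_seg[OF L])
  show "sol (\<lambda>_. seg_ctrl k z k0 k1 k2) T \<phi> (\<lambda>t. seg k z (t * k0) (t * k1) (t * k2) \<phi>)"
    by (rule seg_solution[OF assms(1) L])
  show "seg k z (0 * k0) (0 * k1) (0 * k2) \<phi> = \<phi>" by (simp add: seg_zero)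
  show "norm4 (diff4 (\<psi> T) (seg k z (T * k0) (T * k1) (T * k2) \<phi>)) = 0"
    if "sol (\<lambda>_. seg_ctrl k z k0 k1 k2) T \<phi> \<psi>" for \<psi>
    by (rule seg_solution_unique[OF assms(1) L assms(2) that])
qed (use assms in simp)

lemma steers_cat:
  assumes u: "steers u T E" and v: "steers v S F"
  shows "steers (cat T u v) (T + S) (\<lambda>\<phi>. F (E \<phi>))"
proof -
  have TS: "0 \<le> T" "0 \<le> S" using u v by (auto simp: steers_def)
  show ?thesis
    unfolding steers_def
  proof (intro conjI allI impI)
    fix \<phi> assume L: "L2_4 \<phi>"
    have LE: "L2_4 (E \<phi>)" using u L by (auto simp: steers_def)
    then show "L2_4 (F (E \<phi>))" using v by (auto simp: steers_def)
    obtain \<psi> where \<psi>: "sol u T \<phi> \<psi>" "\<psi> 0 = \<phi>" using u L by (auto simp: steers_def)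
    then have "L2_4 (\<psi> T)" using TS by (auto simp: sol_iff)
    then obtain \<eta> where \<eta>: "sol v S (\<psi> T) \<eta>" "\<eta> 0 = \<psi> T" using v by (auto simp: steers_def)
    show "\<exists>\<psi>. sol (cat T u v) (T + S) \<phi> \<psi> \<and> \<psi> 0 = \<phi>"
      using sol_cat[OF TS \<psi>(1) \<eta>] \<psi>(2) TS by (intro exI[of _ "\<lambda>t. if t \<le> T then \<psi> t else \<eta> (t - T)"]) simp
    show "norm4 (diff4 (\<psi> (T + S)) (F (E \<phi>))) = 0" if s: "sol (cat T u v) (T + S) \<phi> \<psi>" for \<psi>
    proof -
      have "norm4 (diff4 (\<psi> T) (E \<phi>)) = 0" using sol_cat_left[OF TS s] u L by (auto simp: steers_def)
      from sol_cat_right[OF TS s this] show ?thesis using v LE by (auto simp: steers_def)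
    qed
  qed (use TS in simp)
qed

section \<open>Products of propagators\<close>

inductive impl :: "(state \<Rightarrow> state) \<Rightarrow> bool" where
  seg: "cmod z = 1 \<Longrightarrow> impl (seg k z a b c)"
| comp: "impl E \<Longrightarrow> impl F \<Longrightarrow> impl (\<lambda>\<phi>. E (F \<phi>))"

lemma seg_ctrl_le: "cmod z = 1 \<Longrightarrow> cmod (seg_ctrl k z k0 k1 k2 m) \<le> \<bar>k0\<bar> + \<bar>k1\<bar> + \<bar>k2\<bar>"
proof -
  assume z: "cmod z = 1"
  have 1: "cmod (of_real k1 + \<i> * of_real k2) \<le> \<bar>k1\<bar> + \<bar>k2\<bar>"
    using norm_triangle_ineq[of "of_real k1" "\<i> * complex_of_real k2"] by (simp add: norm_mult)
  have 2: "cmod (of_real k1 - \<i> * of_real k2) \<le> \<bar>k1\<bar> + \<bar>k2\<bar>"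
    using norm_triangle_ineq4[of "of_real k1" "\<i> * complex_of_real k2"] by (simp add: norm_mult)
  have "w / sqrt 2 \<le> \<bar>k0\<bar> + \<bar>k1\<bar> + \<bar>k2\<bar>" if "w \<le> \<bar>k1\<bar> + \<bar>k2\<bar>" "w \<ge> 0" for w
  proof -
    have "w / sqrt 2 \<le> w" using that(2) by (simp add: divide_le_eq mult_left_mono[of 1 "sqrt 2" w, simplified])
    then show ?thesis using that by linarith
  qed
  then show ?thesis
    unfolding seg_ctrl_def using z 1 2 by (auto simp: norm_mult norm_divide)
qed

text \<open>Slowing down time by a factor \<open>T\<close> divides the controls by \<open>T\<close>.\<close>

lemma impl_steers:
  assumes "impl E" "c > 0"
  shows "\<exists>u T. steers u T E \<and> (\<forall>m. (\<lambda>t. u t m) \<in> borel_measurable borel) \<and> (\<forall>t m. cmod (u t m) \<le> c)"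
  using assms(1)
proof (induction rule: impl.induct)
  case (seg z k a b d)
  \<comment> \<open>The quotient brings the slowed controls below \<open>c\<close>; the added 1
    keeps \<open>T\<close> positive when all parameters vanish.\<close>
  define T where "T = (\<bar>a\<bar> + \<bar>b\<bar> + \<bar>d\<bar>) / c + 1"
  have T: "T > 0" "(\<bar>a\<bar> + \<bar>b\<bar> + \<bar>d\<bar>) / T \<le> c" using assms(2) by (auto simp: T_def field_simps add_nonneg_pos)
  have "steers (\<lambda>_. seg_ctrl k z (a / T) (b / T) (d / T)) T (seg k z a b d)"
    using steers_seg[OF seg, of T k "a / T" "b / T" "d / T"] T by simp
  moreover have "cmod (seg_ctrl k z (a / T) (b / T) (d / T) m) \<le> c" for m
    using seg_ctrl_le[OF seg, of k "a / T" "b / T" "d / T" m] T by (simp add: add_divide_distrib)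
  ultimately show ?case by (intro exI[of _ "\<lambda>_. seg_ctrl k z (a / T) (b / T) (d / T)"] exI[of _ T]) auto
next
  case (comp E F)
  then obtain u T v S where u: "steers u T E" "\<forall>m. (\<lambda>t. u t m) \<in> borel_measurable borel" "\<forall>t m. cmod (u t m) \<le> c"
    and v: "steers v S F" "\<forall>m. (\<lambda>t. v t m) \<in> borel_measurable borel" "\<forall>t m. cmod (v t m) \<le> c" by blast
  \<comment> \<open>\<open>F\<close> acts before \<open>E\<close>, so its control \<open>v\<close>
    comes first.\<close>
  have "(\<lambda>t. cat S v u t m) \<in> borel_measurable borel" for m
  proof -
    have [measurable]: "(\<lambda>t. v t m) \<in> borel_measurable borel" "(\<lambda>t. u t m) \<in> borel_measurable borel" using u v by auto
    have [measurable]: "(\<lambda>t. u (t - S) m) \<in> borel_measurable borel"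
      by (rule measurable_compose[of "\<lambda>t. t - S" borel borel]) auto
    have "(\<lambda>t. cat S v u t m) = (\<lambda>t. if t < S then v t m else u (t - S) m)" by (auto simp: cat_def)
    then show ?thesis by simp
  qed
  moreover have "\<forall>t m. cmod (cat S v u t m) \<le> c" using u(3) v(3) by (simp add: cat_def)
  ultimately show ?case
    using steers_cat[OF v(1) u(1)] by (intro exI[of _ "cat S v u"] exI[of _ "S + T"]) auto
qed

lemma impl_L2_4: "impl E \<Longrightarrow> L2_4 \<phi> \<Longrightarrow> L2_4 (E \<phi>)"
  by (induction arbitrary: \<phi> rule: impl.induct) (auto simp: L2_4_seg)

lemma impl_diff4: "impl E \<Longrightarrow> E (diff4 f g) = diff4 (E f) (E g)"
  by (induction arbitrary: f g rule: impl.induct) (auto simp: seg_diff4)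

lemma impl_norm4: "impl E \<Longrightarrow> L2_4 \<phi> \<Longrightarrow> norm4 (E \<phi>) = norm4 \<phi>"
  by (induction arbitrary: \<phi> rule: impl.induct) (auto simp: norm4_seg impl_L2_4)

text \<open>Negating the three parameters of a segment inverts it and gives a segment again; a
  product is undone in reverse order.\<close>

lemma impl_inverse: "impl E \<Longrightarrow> \<exists>F. impl F \<and> (\<forall>\<phi>. F (E \<phi>) = \<phi>)"
proof (induction rule: impl.induct)
  case (seg z k a b c)
  then show ?case using seg_inverse[OF seg] impl.seg[OF seg] by blast
next
  case (comp E F)
  then obtain E' F' where "impl E'" "\<forall>\<phi>. E' (E \<phi>) = \<phi>" "impl F'" "\<forall>\<phi>. F' (F \<phi>) = \<phi>" by blast
  then show ?case by (intro exI[of _ "\<lambda>\<phi>. F' (E' \<phi>)"]) (auto intro: impl.comp)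
qed

section \<open>Position-dependent spin rotations\<close>

text \<open>A pair \<open>(a, b)\<close> with \<open>|a|\<^sup>2 + |b|\<^sup>2 = 1\<close> stands for the matrix
  \<open>((a, b), (- cnj b, cnj a))\<close> of SU(2).\<close>

definition qmul :: "complex \<times> complex \<Rightarrow> complex \<times> complex \<Rightarrow> complex \<times> complex" where
  "qmul p q = (fst p * fst q - snd p * cnj (snd q), fst p * snd q + snd p * cnj (fst q))"

definition gate :: "bool \<Rightarrow> (real \<Rightarrow> complex \<times> complex) \<Rightarrow> state \<Rightarrow> state" where
  "gate k V \<phi> j x =
     (if isg k j then fst (V x) * \<phi> j x + snd (V x) * \<phi> (flip k j) x
      else cnj (fst (V x)) * \<phi> j x - cnj (snd (V x)) * \<phi> (flip k j) x)"

lemma gate_gate: "gate k V (gate k W \<phi>) = gate k (\<lambda>x. qmul (V x) (W x)) \<phi>"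
  by (intro ext) (simp add: gate_def qmul_def algebra_simps)

lemma norm_pair_sq: "(norm (p :: complex \<times> complex))\<^sup>2 = (cmod (fst p))\<^sup>2 + (cmod (snd p))\<^sup>2"
  by (simp add: norm_prod_def)

text \<open>Multiplicativity of the determinant |a|^2 + |b|^2, that is Euler's four-square
  identity.\<close>

lemma norm_qmul: "norm (qmul p q) = norm p * norm q"
proof -
  have "(cmod (a * c - b * cnj d))\<^sup>2 + (cmod (a * d + b * cnj c))\<^sup>2 = ((cmod a)\<^sup>2 + (cmod b)\<^sup>2) * ((cmod c)\<^sup>2 + (cmod d)\<^sup>2)" for a b c d
    unfolding cmod_power2 by (simp add: power2_eq_square algebra_simps)
  then have "(norm (qmul p q))\<^sup>2 = (norm p * norm q)\<^sup>2"
    by (simp add: norm_pair_sq power_mult_distrib qmul_def)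
  then show ?thesis by (simp add: power2_eq_iff_nonneg)
qed

lemma qmul_diff_left: "qmul (p - p') q = qmul p q - qmul p' q"
  by (simp add: qmul_def prod_eq_iff algebra_simps)

lemma qmul_diff_right: "qmul p (q - q') = qmul p q - qmul p q'"
  by (simp add: qmul_def prod_eq_iff algebra_simps)

fun qpow :: "complex \<times> complex \<Rightarrow> nat \<Rightarrow> complex \<times> complex" where
  "qpow p 0 = (1, 0)"
| "qpow p (Suc n) = qmul p (qpow p n)"

lemma norm_qpow: "norm p = 1 \<Longrightarrow> norm (qpow p n) = 1"
  by (induction n) (simp_all add: norm_qmul norm_Pair)

text \<open>Telescoping with factors of norm one makes the error grow only linearly. For N^2
  iterations it therefore suffices that a single step is accurate to o(1 / N^2).\<close>

lemma norm_qpow_diff: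
  assumes "norm p = 1" "norm q = 1" shows "norm (qpow p n - qpow q n) \<le> real n * norm (p - q)"
proof (induction n)
  case (Suc n)
  have "qpow p (Suc n) - qpow q (Suc n) = qmul p (qpow p n - qpow q n) + qmul (p - q) (qpow q n)"
    by (simp add: qmul_diff_left qmul_diff_right)
  then have "norm (qpow p (Suc n) - qpow q (Suc n)) \<le> norm (qpow p n - qpow q n) + norm (p - q)"
    using norm_triangle_ineq[of "qmul p (qpow p n - qpow q n)" "qmul (p - q) (qpow q n)"] assms
    by (simp add: norm_qmul norm_qpow)
  then show ?case using Suc by (simp add: algebra_simps)
qed simp

section \<open>The rotations exp (i t sigma) for the three Pauli matrices and their
  commutators\<close>

definition rx :: "real \<Rightarrow> complex \<times> complex" where "rx t = (of_real (cos t), \<i> * of_real (sin t))"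
definition ry :: "real \<Rightarrow> complex \<times> complex" where "ry t = (of_real (cos t), of_real (sin t))"
definition rz :: "real \<Rightarrow> complex \<times> complex" where "rz t = (cis t, 0)"

text \<open>Conjugation by a rotation with angle pi / 4 is a quarter turn of the Bloch sphere and
  carries one axis to another; the next two lemmas rest on the same fact.\<close>

lemma rz_conv: "qmul (qmul (ry (pi / 4)) (rx t)) (ry (- (pi / 4))) = rz t"
  by (simp add: qmul_def rx_def ry_def rz_def cos_45 sin_45 complex_eq_iff field_simps)

lemma rx_conv: "qmul (qmul (ry (- (pi / 4))) (rz t)) (ry (pi / 4)) = rx t"
  by (simp add: qmul_def rx_def ry_def rz_def cos_45 sin_45 complex_eq_iff field_simps)

lemma ry_conv: "qmul (qmul (rx (pi / 4)) (rz t)) (rx (- (pi / 4))) = ry t"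
  by (simp add: qmul_def rx_def ry_def rz_def cos_45 sin_45 complex_eq_iff field_simps)

lemma rz_add: "qmul (rz s) (rz t) = rz (s + t)"
  by (simp add: qmul_def rz_def cis_mult)

lemma qpow_rz: "qpow (rz t) n = rz (real n * t)"
proof (induction n)
  case (Suc n)
  then show ?case by (simp add: rz_add algebra_simps)
qed (simp add: rz_def)

lemma norm_rz: "norm (rz t) = 1"
  by (simp add: rz_def norm_prod_def)

lemma norm_rx: "norm (rx t) = 1"
  by (simp add: rx_def norm_prod_def norm_mult)

lemma norm_ry: "norm (ry t) = 1"
  by (simp add: ry_def norm_prod_def)

definition qcomm :: "real \<Rightarrow> real \<Rightarrow> complex \<times> complex" where
  "qcomm u v = qmul (qmul (qmul (rx u) (ry v)) (rx (- u))) (ry (- v))"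

lemma norm_qcomm: "norm (qcomm u v) = 1"
  by (simp add: qcomm_def norm_qmul norm_rx norm_ry)

text \<open>For small u and v the only second-order term is - 2 u v in the imaginary part of the
  diagonal, as the Lie bracket predicts. The real part deviates from 1 to fourth order, and the
  off-diagonal entries are of third order.\<close>

lemma qcomm_eq:
  "qcomm u v = (Complex (1 - 2 * (sin v)\<^sup>2 * (sin u)\<^sup>2) (- 2 * sin v * cos v * sin u * cos u),
     Complex (- 2 * sin v * cos v * (sin u)\<^sup>2) (2 * (sin v)\<^sup>2 * sin u * cos u))"
proof -
  have u: "cos u * cos u = 1 - sin u * sin u" and v: "cos v * cos v = 1 - sin v * sin v"
    using sin_cos_squared_add3[of u] sin_cos_squared_add3[of v] by linarith+
  have 1: "qmul (qmul (rx u) (ry v)) (rx (- u)) = (Complex (cos v) (- 2 * sin u * cos u * sin v), Complex (sin v * (1 - 2 * (sin u * sin u))) 0)"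
  proof -
    have "cos u * cos v * cos u + sin u * cos v * sin u = cos v"
      using u by algebra
    moreover have "cos u * sin v * cos u - sin u * sin v * sin u = sin v * (1 - 2 * (sin u * sin u))"
      using u by algebra
    ultimately show ?thesis
      by (simp add: qmul_def rx_def ry_def complex_eq_iff algebra_simps)
  qed
  have 2: "cos v * cos v + sin v * (1 - 2 * (sin u * sin u)) * sin v = 1 - 2 * (sin v)\<^sup>2 * (sin u)\<^sup>2"
    using v by (simp add: power2_eq_square algebra_simps)
  show ?thesis
    unfolding qcomm_def 1 using 2
    by (simp add: qmul_def ry_def complex_eq_iff power2_eq_square algebra_simps)
qed

lemma tendsto_quotient_sin: "((\<lambda>h::real. sin (a * h) / h) \<longlongrightarrow> a) (at 0)"
proof -
  have "((\<lambda>h. sin (a * h)) has_real_derivative a) (at 0)"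
    by (auto intro!: derivative_eq_intros)
  then show ?thesis by (simp add: has_field_derivative_iff)
qed

lemma tendsto_quotient_cos: "((\<lambda>h::real. (cos (a * h) - 1) / h) \<longlongrightarrow> 0) (at 0)"
proof -
  have "((\<lambda>h. cos (a * h)) has_real_derivative 0) (at 0)"
    by (auto intro!: derivative_eq_intros)
  then show ?thesis by (simp add: has_field_derivative_iff)
qed

lemma filterlim_square_at_0: "filterlim (\<lambda>h::real. h\<^sup>2) (at 0) (at 0)"
  unfolding filterlim_at by (auto simp: eventually_at_filter intro!: tendsto_eq_intros)

text \<open>\<open>?A\<close> to \<open>?D\<close> are the four real coordinates of the error
  divided by h^2, arranged so that only quotients with known limits occur. In \<open>?B\<close> the
  limits - 2 a b and 2 a b cancel.\<close>

lemma qcomm_error_tendsto: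
  "((\<lambda>h. norm (qcomm (a * h) (b * h) - rz (- (2 * a * b) * h\<^sup>2)) / h\<^sup>2) \<longlongrightarrow> 0) (at 0)"
proof -
  have abs4: "(\<bar>k * A\<bar> + \<bar>k * B\<bar>) + (\<bar>k * C\<bar> + \<bar>k * D\<bar>) = k * (\<bar>A\<bar> + \<bar>B\<bar> + (\<bar>C\<bar> + \<bar>D\<bar>))"
    if "k \<ge> 0" for k A B C D :: real
    using that by (simp add: abs_mult distrib_left)
  let ?w = "2 * a * b"
  let ?su = "\<lambda>h. sin (a * h)" and ?sv = "\<lambda>h. sin (b * h)" and ?cu = "\<lambda>h. cos (a * h)" and ?cv = "\<lambda>h. cos (b * h)"
  let ?A = "\<lambda>h. - 2 * (?sv h / h)\<^sup>2 * (?su h)\<^sup>2 - (cos (?w * h\<^sup>2) - 1) / h\<^sup>2"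
  let ?B = "\<lambda>h. - 2 * (?sv h / h) * (?su h / h) * ?cv h * ?cu h + sin (?w * h\<^sup>2) / h\<^sup>2"
  let ?C = "\<lambda>h. - 2 * (?sv h / h) * (?su h / h) * ?cv h * ?su h"
  let ?D = "\<lambda>h. 2 * (?sv h / h)\<^sup>2 * ?su h * ?cu h"
  have s: "((\<lambda>h. sin (c * h)) \<longlongrightarrow> 0) (at 0)" and c: "((\<lambda>h. cos (c * h)) \<longlongrightarrow> 1) (at 0)" for c :: real
    by (auto intro!: tendsto_eq_intros)
  have "((\<lambda>h. \<bar>?A h\<bar> + \<bar>?B h\<bar> + (\<bar>?C h\<bar> + \<bar>?D h\<bar>)) \<longlongrightarrow> \<bar>- 2 * b\<^sup>2 * 0\<^sup>2 - 0\<bar> + \<bar>- 2 * b * a * 1 * 1 + ?w\<bar> + (\<bar>- 2 * b * a * 1 * 0\<bar> + \<bar>2 * b\<^sup>2 * 0 * 1\<bar>)) (at 0)"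
    by (intro tendsto_intros s c tendsto_quotient_sin filterlim_compose[OF tendsto_quotient_sin filterlim_square_at_0]
        filterlim_compose[OF tendsto_quotient_cos filterlim_square_at_0])
  then have lim: "((\<lambda>h. \<bar>?A h\<bar> + \<bar>?B h\<bar> + (\<bar>?C h\<bar> + \<bar>?D h\<bar>)) \<longlongrightarrow> 0) (at 0)" by simp
  show ?thesis
  proof (rule Lim_null_comparison[OF _ lim])
    have "norm (qcomm (a * h) (b * h) - rz (- ?w * h\<^sup>2)) / h\<^sup>2 \<le> \<bar>?A h\<bar> + \<bar>?B h\<bar> + (\<bar>?C h\<bar> + \<bar>?D h\<bar>)" if h: "h \<noteq> 0" for h
    proof -
      have e: "qcomm (a * h) (b * h) - rz (- ?w * h\<^sup>2) = (Complex (h\<^sup>2 * ?A h) (h\<^sup>2 * ?B h), Complex (h\<^sup>2 * ?C h) (h\<^sup>2 * ?D h))"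
        using h by (simp add: qcomm_eq rz_def complex_eq_iff field_simps power2_eq_square)
      have "norm (qcomm (a * h) (b * h) - rz (- ?w * h\<^sup>2)) \<le> cmod (Complex (h\<^sup>2 * ?A h) (h\<^sup>2 * ?B h)) + cmod (Complex (h\<^sup>2 * ?C h) (h\<^sup>2 * ?D h))"
        unfolding e norm_prod_def by (simp only: fst_conv snd_conv) (intro sqrt_sum_squares_le_sum norm_ge_zero)
      also have "\<dots> \<le> (\<bar>h\<^sup>2 * ?A h\<bar> + \<bar>h\<^sup>2 * ?B h\<bar>) + (\<bar>h\<^sup>2 * ?C h\<bar> + \<bar>h\<^sup>2 * ?D h\<bar>)"
        using cmod_le[of "Complex (h\<^sup>2 * ?A h) (h\<^sup>2 * ?B h)"] cmod_le[of "Complex (h\<^sup>2 * ?C h) (h\<^sup>2 * ?D h)"]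
        by (simp only: complex.sel)
      also have "\<dots> = h\<^sup>2 * (\<bar>?A h\<bar> + \<bar>?B h\<bar> + (\<bar>?C h\<bar> + \<bar>?D h\<bar>))"
        by (rule abs4) simp
      finally show ?thesis using h by (simp only: divide_le_eq) (simp add: mult.commute)
    qed
    then show "\<forall>\<^sub>F h in at 0. norm (norm (qcomm (a * h) (b * h) - rz (- ?w * h\<^sup>2)) / h\<^sup>2) \<le> \<bar>?A h\<bar> + \<bar>?B h\<bar> + (\<bar>?C h\<bar> + \<bar>?D h\<bar>)"
      by (simp add: eventually_at_filter)
  qed
qed

text \<open>The group commutator of \<open>exp (i (a/N) \<sigma>\<^sub>x)\<close> and \<open>exp (i (b/N) \<sigma>\<^sub>y)\<close>, iterated \<open>N\<^sup>2\<close> times,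
  tends to the exponential of the Lie bracket.\<close>

lemma qcomm_power_tendsto:
  "(\<lambda>n. qpow (qcomm (a / real (Suc n)) (b / real (Suc n))) ((Suc n)\<^sup>2)) \<longlonglongrightarrow> rz (- (2 * a * b))"
proof (rule LIM_zero_cancel, rule tendsto_norm_zero_cancel, rule Lim_null_comparison)
  let ?h = "\<lambda>n. 1 / real (Suc n)"
  have "filterlim ?h (at 0) sequentially"
    unfolding filterlim_at using LIMSEQ_Suc[OF lim_inverse_n'] by simp
  from filterlim_compose[OF qcomm_error_tendsto this]
  show "(\<lambda>n. norm (qcomm (a * ?h n) (b * ?h n) - rz (- (2 * a * b) * (?h n)\<^sup>2)) / (?h n)\<^sup>2) \<longlonglongrightarrow> 0" .
  have "norm (qpow (qcomm (a / real (Suc n)) (b / real (Suc n))) ((Suc n)\<^sup>2) - rz (- (2 * a * b)))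
      \<le> norm (qcomm (a * ?h n) (b * ?h n) - rz (- (2 * a * b) * (?h n)\<^sup>2)) / (?h n)\<^sup>2" for n
  proof -
    have "real ((Suc n)\<^sup>2) * (- (2 * a * b) * (?h n)\<^sup>2) = - (2 * a * b)"
      by (simp add: power_divide del: of_nat_Suc)
    then have "rz (- (2 * a * b)) = qpow (rz (- (2 * a * b) * (?h n)\<^sup>2)) ((Suc n)\<^sup>2)"
      by (simp only: qpow_rz)
    then have "norm (qpow (qcomm (a * ?h n) (b * ?h n)) ((Suc n)\<^sup>2) - rz (- (2 * a * b)))
       \<le> real ((Suc n)\<^sup>2) * norm (qcomm (a * ?h n) (b * ?h n) - rz (- (2 * a * b) * (?h n)\<^sup>2))"
      by (simp only: norm_qpow_diff norm_qcomm norm_rz)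
    then show ?thesis by (simp add: power_divide mult.commute)
  qed
  then show "\<forall>\<^sub>F n in sequentially. norm (norm (qpow (qcomm (a / real (Suc n)) (b / real (Suc n))) ((Suc n)\<^sup>2) - rz (- (2 * a * b))))
     \<le> norm (qcomm (a * ?h n) (b * ?h n) - rz (- (2 * a * b) * (?h n)\<^sup>2)) / (?h n)\<^sup>2"
    by (intro always_eventually allI) (simp only: real_norm_def abs_norm_cancel)
qed

section \<open>Approximately implementable operators\<close>

text \<open>Approximation in the strong sense: the implementing product may depend on the state as
  well as on \<open>e\<close>.\<close>

definition appr :: "(state \<Rightarrow> state) \<Rightarrow> bool" where
  "appr E \<longleftrightarrow> (\<forall>\<phi>. L2_4 \<phi> \<longrightarrow> L2_4 (E \<phi>)) \<and>
     (\<forall>\<phi> e. L2_4 \<phi> \<longrightarrow> e > 0 \<longrightarrow> (\<exists>F. impl F \<and> norm4 (diff4 (F \<phi>) (E \<phi>)) < e))"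

lemma appr_impl: "impl E \<Longrightarrow> appr E"
  unfolding appr_def using impl_L2_4 by (auto intro!: exI[of _ E])

text \<open>The outer product is chosen for the exact state \<open>F \<phi>\<close>; being a linear
  isometry, it passes on the inner error unchanged.\<close>

lemma appr_comp: assumes "appr E" "appr F" shows "appr (\<lambda>\<phi>. E (F \<phi>))"
  unfolding appr_def
proof (intro conjI allI impI)
  fix \<phi> assume L: "L2_4 \<phi>"
  have LF: "L2_4 (F \<phi>)" using assms L by (auto simp: appr_def)
  then show LE: "L2_4 (E (F \<phi>))" using assms by (auto simp: appr_def)
  fix e :: real assume e: "e > 0"
  then have e2: "e / 2 > 0" by simp
  obtain F' where F': "impl F'" "norm4 (diff4 (F' \<phi>) (F \<phi>)) < e / 2"
    using assms(2) L e2 unfolding appr_def by blast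
  have LF': "L2_4 (F' \<phi>)" by (rule impl_L2_4[OF F'(1) L])
  obtain E' where E': "impl E'" "norm4 (diff4 (E' (F \<phi>)) (E (F \<phi>))) < e / 2"
    using assms(1) LF e2 unfolding appr_def by blast
  have "norm4 (diff4 (E' (F' \<phi>)) (E (F \<phi>))) \<le> norm4 (diff4 (E' (F' \<phi>)) (E' (F \<phi>))) + norm4 (diff4 (E' (F \<phi>)) (E (F \<phi>)))"
    by (rule norm4_diff4_triangle[OF impl_L2_4[OF E'(1) LF'] impl_L2_4[OF E'(1) LF] LE])
  also have "norm4 (diff4 (E' (F' \<phi>)) (E' (F \<phi>))) = norm4 (diff4 (F' \<phi>) (F \<phi>))"
    unfolding impl_diff4[OF E'(1), symmetric] by (rule impl_norm4[OF E'(1) L2_4_diff4[OF LF' LF]])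
  finally have "norm4 (diff4 (E' (F' \<phi>)) (E (F \<phi>))) < e" using F' E' by linarith
  then show "\<exists>G. impl G \<and> norm4 (diff4 (G \<phi>) (E (F \<phi>))) < e"
    using impl.comp[OF E'(1) F'(1)] by (intro exI[of _ "\<lambda>\<phi>. E' (F' \<phi>)"]) auto
qed

text \<open>Measurability and unit norm accompany approximability because limits of gates are taken
  by dominated convergence, with the sum of the moduli of the two coupled components as
  majorant.\<close>

definition gate_ok :: "bool \<Rightarrow> (real \<Rightarrow> complex \<times> complex) \<Rightarrow> bool" where
  "gate_ok k V \<longleftrightarrow> (\<lambda>x. fst (V x)) \<in> borel_measurable borel \<and> (\<lambda>x. snd (V x)) \<in> borel_measurable borel
     \<and> (\<forall>x. norm (V x) = 1) \<and> appr (gate k V)"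

lemma cnj_measurable: "f \<in> borel_measurable borel \<Longrightarrow> (\<lambda>x. cnj (f x)) \<in> borel_measurable (borel :: real measure)"
  by (rule measurable_compose[where N=borel]) (auto intro!: borel_measurable_continuous_onI continuous_intros)

lemma gate_measurable:
  assumes "(\<lambda>x. fst (V x)) \<in> borel_measurable borel" "(\<lambda>x. snd (V x)) \<in> borel_measurable borel" "L2_4 \<phi>"
  shows "gate k V \<phi> j \<in> borel_measurable borel"
proof -
  note [measurable] = assms(1,2) cnj_measurable[OF assms(1)] cnj_measurable[OF assms(2)]
  have [measurable]: "\<phi> i \<in> borel_measurable borel" for i using assms(3) L2_4D L2_measurable by blast
  show ?thesis unfolding gate_def by measurable
qed

lemma gate_bound:
  assumes "norm (V x) = 1"
  shows "cmod (gate k V \<phi> j x) \<le> cmod (\<phi> j x) + cmod (\<phi> (flip k j) x)"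
proof -
  have "cmod (fst (V x)) \<le> 1" "cmod (snd (V x)) \<le> 1"
    using norm_fst_le[of "fst (V x)" "snd (V x)"] norm_snd_le[of "snd (V x)" "fst (V x)"] assms by auto
  then have "cmod (fst (V x)) * cmod (\<phi> j x) \<le> cmod (\<phi> j x)" "cmod (snd (V x)) * cmod (\<phi> (flip k j) x) \<le> cmod (\<phi> (flip k j) x)"
    by (auto intro: mult_left_le_one_le)
  then show ?thesis
    unfolding gate_def
    using norm_triangle_ineq[of "fst (V x) * \<phi> j x" "snd (V x) * \<phi> (flip k j) x"]
      norm_triangle_ineq4[of "cnj (fst (V x)) * \<phi> j x" "cnj (snd (V x)) * \<phi> (flip k j) x"]
    by (simp add: norm_mult)
qed

lemma L2_pair_bound: "L2_4 \<phi> \<Longrightarrow> integrable lborel (\<lambda>x. (cmod (\<phi> i x) + cmod (\<phi> j x))\<^sup>2)"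
proof -
  assume L: "L2_4 \<phi>"
  have "(\<lambda>x. complex_of_real (cmod (\<phi> n x))) \<in> borel_measurable borel" for n
    using L2_measurable[OF L2_4D[OF L, of n]] by simp
  then have "L2 (\<lambda>x. complex_of_real (cmod (\<phi> n x)))" for n
    using L2_integrable[OF L2_4D[OF L, of n]] by (intro L2_dominated[where w="\<lambda>x. cmod (\<phi> n x)"]) auto
  then have "L2 (\<lambda>x. complex_of_real (cmod (\<phi> i x)) + complex_of_real (cmod (\<phi> j x)))"
    by (intro L2_add)
  then show ?thesis
    unfolding L2_def by (simp flip: of_real_add)
qed

lemma L2_4_gate:
  assumes "(\<lambda>x. fst (V x)) \<in> borel_measurable borel" "(\<lambda>x. snd (V x)) \<in> borel_measurable borel"
    "\<And>x. norm (V x) = 1" "L2_4 \<phi>"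
  shows "L2_4 (gate k V \<phi>)"
  unfolding L2_4_def
proof
  fix j
  show "L2 (gate k V \<phi> j)"
    by (rule L2_dominated[OF gate_measurable[OF assms(1,2,4)] L2_pair_bound[OF assms(4), of j "flip k j"]])
      (intro AE_I2 gate_bound assms(3))
qed

lemma gate_ok_mult:
  assumes "gate_ok k V" "gate_ok k W" shows "gate_ok k (\<lambda>x. qmul (V x) (W x))"
proof -
  have "gate k (\<lambda>x. qmul (V x) (W x)) = (\<lambda>\<phi>. gate k V (gate k W \<phi>))" by (simp add: gate_gate)
  then have "appr (gate k (\<lambda>x. qmul (V x) (W x)))" using assms by (simp add: gate_ok_def appr_comp)
  then show ?thesis
    using assms unfolding gate_ok_def by (auto simp: norm_qmul) (auto simp: qmul_def intro!: cnj_measurable borel_measurable_diff borel_measurable_add borel_measurable_times)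
qed

text \<open>Convergence of the matrices at each x, without any uniformity, already gives strong
  convergence of the gates.\<close>

lemma gate_ok_limit:
  assumes V: "\<And>n. gate_ok k (V n)" and lim: "\<And>x. (\<lambda>n. V n x) \<longlonglongrightarrow> W x"
  shows "gate_ok k W"
proof -
  have m1: "(\<lambda>x. fst (W x)) \<in> borel_measurable borel"
    by (rule borel_measurable_LIMSEQ_metric[where f="\<lambda>n x. fst (V n x)"])
      (use V lim in \<open>auto simp: gate_ok_def intro: tendsto_fst\<close>)
  have m2: "(\<lambda>x. snd (W x)) \<in> borel_measurable borel"
    by (rule borel_measurable_LIMSEQ_metric[where f="\<lambda>n x. snd (V n x)"])
      (use V lim in \<open>auto simp: gate_ok_def intro: tendsto_snd\<close>)
  have n: "norm (W x) = 1" for x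
    using LIMSEQ_unique[OF tendsto_norm[OF lim[of x]]] V by (auto simp: gate_ok_def)
  have "appr (gate k W)"
    unfolding appr_def
  proof (intro conjI allI impI)
    fix \<phi> assume L: "L2_4 \<phi>"
    show LW: "L2_4 (gate k W \<phi>)" by (rule L2_4_gate[OF m1 m2 n L])
    have LV: "L2_4 (gate k (V n) \<phi>)" for n using V[of n] L by (auto simp: gate_ok_def appr_def)
    fix e :: real assume e: "e > 0"
    have "(\<lambda>n. norm4 (diff4 (gate k (V n) \<phi>) (gate k W \<phi>))) \<longlonglongrightarrow> 0"
      unfolding norm4_tendsto_0_iff diff4_def
    proof
      fix j
      show "(\<lambda>n. l2n (\<lambda>x. gate k (V n) \<phi> j x - gate k W \<phi> j x)) \<longlonglongrightarrow> 0"
      proof (rule l2n_dominated_convergence[OF _ _ L2_pair_bound[OF L, of j "flip k j"]])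
        show "gate k (V n) \<phi> j \<in> borel_measurable borel" for n using V[of n] L by (auto simp: gate_ok_def intro: gate_measurable)
        show "gate k W \<phi> j \<in> borel_measurable borel" by (rule gate_measurable[OF m1 m2 L])
        show "AE x in lborel. (\<lambda>n. gate k (V n) \<phi> j x) \<longlonglongrightarrow> gate k W \<phi> j x"
          unfolding gate_def using lim by (auto intro!: AE_I2 tendsto_intros)
        show "AE x in lborel. cmod (gate k (V n) \<phi> j x) \<le> cmod (\<phi> j x) + cmod (\<phi> (flip k j) x)" for n
          using V[of n] by (auto simp: gate_ok_def intro!: gate_bound)
      qed
    qed
    then obtain n where n: "norm4 (diff4 (gate k (V n) \<phi>) (gate k W \<phi>)) < e / 2"
      using tendsto_0_less[of _ "e / 2"] e by auto
    have "e / 2 > 0" using e by simp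
    then obtain F where F: "impl F" "norm4 (diff4 (F \<phi>) (gate k (V n) \<phi>)) < e / 2"
      using V[of n] L unfolding gate_ok_def appr_def by blast
    have "norm4 (diff4 (F \<phi>) (gate k W \<phi>)) \<le> norm4 (diff4 (F \<phi>) (gate k (V n) \<phi>)) + norm4 (diff4 (gate k (V n) \<phi>) (gate k W \<phi>))"
      by (rule norm4_diff4_triangle[OF impl_L2_4[OF F(1) L] LV LW])
    then show "\<exists>F. impl F \<and> norm4 (diff4 (F \<phi>) (gate k W \<phi>)) < e" using n F by (intro exI[of _ F]) auto
  qed
  then show ?thesis using m1 m2 n by (simp add: gate_ok_def)
qed

text \<open>Without a momentum term nothing is translated, and a segment rotates at each x by an
  angle affine in x. The phase \<open>z\<close> selects the axis: -1 gives \<open>rx\<close>, and i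
  gives \<open>ry\<close>.\<close>

lemma seg_gate: "seg k z a b 0 = gate k (\<lambda>x. (of_real (cos (a + b * x)), - \<i> * z * of_real (sin (a + b * x))))"
proof (intro ext)
  fix \<phi> j x
  have c: "cis (- t) = of_real (cos t) - \<i> * of_real (sin t)" "cis t = of_real (cos t) + \<i> * of_real (sin t)" for t
    by (simp_all add: complex_eq_iff)
  have w1: "weyl a b 0 f x = (of_real (cos (a + b * x)) - \<i> * of_real (sin (a + b * x))) * f x" for f
    unfolding weyl_def using c(1)[of "a + b * x"] by simp
  have w2: "weyl (- a) (- b) (- 0) f x = (of_real (cos (a + b * x)) + \<i> * of_real (sin (a + b * x))) * f x" for f
    unfolding weyl_def using c(2)[of "a + b * x"] by (simp add: algebra_simps)
  show "seg k z a b 0 \<phi> j x = gate k (\<lambda>x. (of_real (cos (a + b * x)), - \<i> * z * of_real (sin (a + b * x)))) \<phi> j x"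
    unfolding seg_def w1 w2 by (simp add: gate_def ph_def field_simps)
qed

lemma gate_ok_seg:
  assumes "cmod z = 1" shows "gate_ok k (\<lambda>x. (of_real (cos (a + b * x)), - \<i> * z * of_real (sin (a + b * x))))"
  unfolding gate_ok_def
proof (intro conjI allI)
  show "appr (gate k (\<lambda>x. (of_real (cos (a + b * x)), - \<i> * z * of_real (sin (a + b * x)))))"
    using appr_impl[OF impl.seg[OF assms, of k a b 0]] by (simp add: seg_gate)
  show "norm (complex_of_real (cos (a + b * x)), - \<i> * z * of_real (sin (a + b * x))) = 1" for x
    using assms by (simp add: norm_prod_def norm_mult)
qed (auto intro!: borel_measurable_continuous_onI continuous_intros)

lemma gate_ok_rx: "gate_ok k (\<lambda>x. rx (a + b * x))"
  using gate_ok_seg[of "-1" k a b] by (simp add: rx_def)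

lemma gate_ok_ry: "gate_ok k (\<lambda>x. ry (a + b * x))"
  using gate_ok_seg[of "\<i>" k a b] by (simp add: ry_def)

lemma gate_ok_qpow: assumes "gate_ok k V" shows "gate_ok k (\<lambda>x. qpow (V x) n)"
proof (induction n)
  case 0
  then show ?case using gate_ok_rx[of k 0 0] by (simp add: rx_def)
next
  case (Suc n)
  then show ?case using gate_ok_mult[OF assms Suc] by simp
qed

text \<open>All real multiples are demanded, since forming products divides the angles by N and
  reverses their signs.\<close>

definition good :: "bool \<Rightarrow> (real \<Rightarrow> real) \<Rightarrow> bool" where
  "good k F \<longleftrightarrow> (\<forall>s. gate_ok k (\<lambda>x. rz (s * F x)))"

lemma good_affine: "good k (\<lambda>x. a + b * x)"
  unfolding good_def
proof
  fix s
  have "gate_ok k (\<lambda>x. qmul (qmul (ry (pi / 4 + 0 * x)) (rx (s * a + (s * b) * x))) (ry (- (pi / 4) + 0 * x)))"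
    by (intro gate_ok_mult gate_ok_rx gate_ok_ry)
  moreover have "s * a + (s * b) * x = s * (a + b * x)" for x by (simp add: algebra_simps)
  ultimately show "gate_ok k (\<lambda>x. rz (s * (a + b * x)))" by (simp only: mult_zero_left add_0_right rz_conv)
qed

lemma good_rx: "good k F \<Longrightarrow> gate_ok k (\<lambda>x. rx (s * F x))"
proof -
  assume "good k F"
  then have "gate_ok k (\<lambda>x. qmul (qmul (ry (- (pi / 4) + 0 * x)) (rz (s * F x))) (ry (pi / 4 + 0 * x)))"
    by (intro gate_ok_mult gate_ok_ry) (auto simp: good_def)
  then show ?thesis by (simp only: mult_zero_left add_0_right rx_conv)
qed

lemma good_ry: "good k F \<Longrightarrow> gate_ok k (\<lambda>x. ry (s * F x))"
proof -
  assume "good k F"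
  then have "gate_ok k (\<lambda>x. qmul (qmul (rx (pi / 4 + 0 * x)) (rz (s * F x))) (rx (- (pi / 4) + 0 * x)))"
    by (intro gate_ok_mult gate_ok_rx) (auto simp: good_def)
  then show ?thesis by (simp only: mult_zero_left add_0_right ry_conv)
qed

lemma good_add: assumes "good k F" "good k G" shows "good k (\<lambda>x. F x + G x)"
  unfolding good_def
proof
  fix s
  have "gate_ok k (\<lambda>x. qmul (rz (s * F x)) (rz (s * G x)))"
    using assms by (intro gate_ok_mult) (auto simp: good_def)
  then show "gate_ok k (\<lambda>x. rz (s * (F x + G x)))" by (simp add: rz_add distrib_left)
qed

text \<open>At each x the iterated commutator of rotations by F / N and b / N converges to the
  z-rotation by - 2 F b; the choice b = - (s / 2) G gives s F G.\<close>

lemma good_mult: assumes F: "good k F" and G: "good k G" shows "good k (\<lambda>x. F x * G x)"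
  unfolding good_def
proof
  fix s
  show "gate_ok k (\<lambda>x. rz (s * (F x * G x)))"
  proof (rule gate_ok_limit)
    fix n :: nat
    let ?N = "real (Suc n)"
    have "gate_ok k (\<lambda>x. qmul (qmul (qmul (rx ((1 / ?N) * F x)) (ry ((- (s / 2) / ?N) * G x))) (rx ((- (1 / ?N)) * F x))) (ry ((- (- (s / 2) / ?N)) * G x)))"
      by (intro gate_ok_mult good_rx[OF F] good_ry[OF G])
    then have "gate_ok k (\<lambda>x. qcomm (F x / ?N) ((- (s / 2) * G x) / ?N))"
      by (simp add: qcomm_def)
    then show "gate_ok k (\<lambda>x. qpow (qcomm (F x / ?N) ((- (s / 2) * G x) / ?N)) ((Suc n)\<^sup>2))"
      by (rule gate_ok_qpow)
  next
    fix x
    have "- (2 * F x * (- (s / 2) * G x)) = s * (F x * G x)" by simp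
    then show "(\<lambda>n. qpow (qcomm (F x / real (Suc n)) ((- (s / 2) * G x) / real (Suc n))) ((Suc n)\<^sup>2)) \<longlonglongrightarrow> rz (s * (F x * G x))"
      using qcomm_power_tendsto[of "F x" "- (s / 2) * G x"] by (simp only:)
  qed
qed

lemma good_limit: assumes F: "\<And>n. good k (F n)" and lim: "\<And>x. (\<lambda>n. F n x) \<longlonglongrightarrow> G x" shows "good k G"
  unfolding good_def
proof
  fix s
  show "gate_ok k (\<lambda>x. rz (s * G x))"
  proof (rule gate_ok_limit)
    show "gate_ok k (\<lambda>x. rz (s * F n x))" for n using F by (auto simp: good_def)
    show "(\<lambda>n. rz (s * F n x)) \<longlonglongrightarrow> rz (s * G x)" for x
      unfolding rz_def by (intro tendsto_intros lim)
  qed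
qed

lemma good_polynomial: "real_polynomial_function F \<Longrightarrow> good k F"
proof (induction rule: real_polynomial_function.induct)
  case (linear f)
  then obtain c where "f = (\<lambda>x. x * c)" using real_bounded_linear by blast
  then show ?case using good_affine[of k 0 c] by (simp add: mult.commute)
next
  case (const c)
  then show ?case using good_affine[of k c 0] by simp
qed (auto intro: good_add good_mult)

text \<open>Weierstrass approximation on [-n, n] with error 1 / (n + 1). The polynomials are
  uncontrolled elsewhere, which is harmless because only convergence at each point counts.\<close>

lemma good_continuous: assumes "continuous_on UNIV F" shows "good k F"
proof -
  have "\<exists>g. real_polynomial_function g \<and> (\<forall>x\<in>{- real n..real n}. \<bar>F x - g x\<bar> < 1 / real (Suc n))" for n
  proof -
    have "continuous_on {- real n..real n} F" using assms continuous_on_subset by blast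
    then obtain g where "real_polynomial_function g" "\<And>x. x \<in> {- real n..real n} \<Longrightarrow> \<bar>F x - g x\<bar> < 1 / real (Suc n)"
      using Stone_Weierstrass_real_polynomial_function[of "{- real n..real n}" F "1 / real (Suc n)"] by auto
    then show ?thesis by blast
  qed
  then obtain g where g: "\<And>n. real_polynomial_function (g n)"
    "\<And>n x. x \<in> {- real n..real n} \<Longrightarrow> \<bar>F x - g n x\<bar> < 1 / real (Suc n)" by metis
  show ?thesis
  proof (rule good_limit)
    show "good k (g n)" for n using good_polynomial g by blast
    fix x
    obtain m where m: "\<bar>x\<bar> \<le> real m" using real_arch_simple by blast
    have "(\<lambda>n. g n x - F x) \<longlonglongrightarrow> 0"
    proof (rule Lim_null_comparison[OF _ LIMSEQ_Suc[OF lim_inverse_n']])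
      show "\<forall>\<^sub>F n in sequentially. norm (g n x - F x) \<le> 1 / real (Suc n)"
        unfolding eventually_sequentially
      proof (intro exI allI impI)
        fix n assume "m \<le> n"
        then have "x \<in> {- real n..real n}" using m by (auto simp: abs_le_iff)
        then show "norm (g n x - F x) \<le> 1 / real (Suc n)" using g(2)[of x n] by (simp add: abs_minus_commute)
      qed
    qed
    then show "(\<lambda>n. g n x) \<longlonglongrightarrow> F x" by (simp add: LIM_zero_iff)
  qed
qed

text \<open>Ramps of slope n that reach 1 exactly at c: they equal 1 from c on and are eventually 0
  at each point to the left.\<close>

lemma good_halfline: "good k (\<lambda>x. if c \<le> x then 1 else 0)"
proof (rule good_limit)
  show "good k (\<lambda>x. max 0 (min 1 (1 + real n * (x - c))))" for n
    by (intro good_continuous continuous_intros)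
  fix x
  show "(\<lambda>n. max 0 (min 1 (1 + real n * (x - c)))) \<longlonglongrightarrow> (if c \<le> x then 1 else 0)"
  proof (cases "c \<le> x")
    case True
    then have "max 0 (min 1 (1 + real n * (x - c))) = 1" for n by (simp add: min_def max_def)
    then show ?thesis using True by simp
  next
    case False
    obtain m where m: "1 / (c - x) \<le> real m" using real_arch_simple by blast
    have "\<forall>\<^sub>F n in sequentially. max 0 (min 1 (1 + real n * (x - c))) = 0"
      unfolding eventually_sequentially
    proof (intro exI allI impI)
      fix n assume "m \<le> n"
      then have "1 / (c - x) \<le> real n" using m by linarith
      then have "1 \<le> real n * (c - x)" using False by (simp add: divide_le_eq)
      then have "1 + real n * (x - c) \<le> 0" by (simp add: algebra_simps)
      then show "max 0 (min 1 (1 + real n * (x - c))) = 0" by simp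
    qed
    then show ?thesis using False by (simp add: tendsto_eventually)
  qed
qed

section \<open>Approximate reachability\<close>

definition reach :: "state \<Rightarrow> state \<Rightarrow> bool" where
  "reach \<phi> \<psi> \<longleftrightarrow> L2_4 \<phi> \<and> L2_4 \<psi> \<and> (\<forall>e>0. \<exists>E. impl E \<and> norm4 (diff4 (E \<phi>) \<psi>) < e)"

lemma reach_appr: "appr E \<Longrightarrow> L2_4 \<phi> \<Longrightarrow> reach \<phi> (E \<phi>)"
  by (auto simp: reach_def appr_def)

lemma reach_refl: "L2_4 \<phi> \<Longrightarrow> reach \<phi> \<phi>"
  using reach_appr[OF appr_impl[OF impl.seg[of 1 True 0 0 0]]] by (simp add: seg_zero)

text \<open>The inverse of an implementing product is an isometry of the same kind, so it carries
  the error at the target to an equal error at the start.\<close>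

lemma reach_sym: assumes "reach \<phi> \<psi>" shows "reach \<psi> \<phi>"
  unfolding reach_def
proof (intro conjI allI impI)
  have L: "L2_4 \<phi>" "L2_4 \<psi>" using assms by (auto simp: reach_def)
  then show "L2_4 \<psi>" "L2_4 \<phi>" by auto
  fix e :: real assume "e > 0"
  then obtain E where E: "impl E" "norm4 (diff4 (E \<phi>) \<psi>) < e" using assms unfolding reach_def by blast
  obtain F where F: "impl F" "\<And>\<phi>. F (E \<phi>) = \<phi>" using impl_inverse[OF E(1)] by blast
  have "norm4 (diff4 (F \<psi>) \<phi>) = norm4 (F (diff4 \<psi> (E \<phi>)))" by (simp add: impl_diff4[OF F(1)] F(2))
  also have "\<dots> = norm4 (diff4 \<psi> (E \<phi>))"
    by (rule impl_norm4[OF F(1) L2_4_diff4[OF L(2) impl_L2_4[OF E(1) L(1)]]])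
  finally show "\<exists>E. impl E \<and> norm4 (diff4 (E \<psi>) \<phi>) < e"
    using F(1) E(2) by (intro exI[of _ F]) (simp add: norm4_diff4_commute)
qed

text \<open>Isometries send nearby starting points to nearby end points, so both ends of a pair may
  be perturbed. This permits working with compactly supported states and step functions
  only.\<close>

lemma reach_closed:
  assumes L: "L2_4 \<phi>" "L2_4 \<psi>"
    and *: "\<And>e. e > 0 \<Longrightarrow> \<exists>\<phi>' \<psi>'. reach \<phi>' \<psi>' \<and> norm4 (diff4 \<phi> \<phi>') < e \<and> norm4 (diff4 \<psi> \<psi>') < e"
  shows "reach \<phi> \<psi>"
  unfolding reach_def
proof (intro conjI allI impI L)
  fix e :: real assume "e > 0"
  then have e3: "e / 3 > 0" by simp
  then obtain \<phi>' \<psi>' where r: "reach \<phi>' \<psi>'" "norm4 (diff4 \<phi> \<phi>') < e / 3" "norm4 (diff4 \<psi> \<psi>') < e / 3"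
    using * by blast
  then obtain E where E: "impl E" "norm4 (diff4 (E \<phi>') \<psi>') < e / 3" using e3 unfolding reach_def by blast
  have L': "L2_4 \<phi>'" "L2_4 \<psi>'" using r by (auto simp: reach_def)
  note LE = impl_L2_4[OF E(1) L(1)] impl_L2_4[OF E(1) L'(1)]
  have "norm4 (diff4 (E \<phi>) (E \<phi>')) = norm4 (diff4 \<phi> \<phi>')"
    unfolding impl_diff4[OF E(1), symmetric] by (rule impl_norm4[OF E(1) L2_4_diff4[OF L(1) L'(1)]])
  then have "norm4 (diff4 (E \<phi>) \<psi>) < e"
    using norm4_diff4_triangle[OF LE(1) LE(2) L(2)] norm4_diff4_triangle[OF LE(2) L'(2) L(2)] r E
      norm4_diff4_commute[of \<psi> \<psi>'] by linarith
  then show "\<exists>E. impl E \<and> norm4 (diff4 (E \<phi>) \<psi>) < e" using E by blast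
qed

lemma reach_trans: assumes "reach \<phi> \<psi>" "reach \<psi> \<eta>" shows "reach \<phi> \<eta>"
proof (rule reach_closed)
  fix e :: real assume e: "e > 0"
  obtain E where E: "impl E" "norm4 (diff4 (E \<phi>) \<psi>) < e" using assms e unfolding reach_def by blast
  obtain F where F: "impl F" "norm4 (diff4 (F \<psi>) \<eta>) < e" using assms e unfolding reach_def by blast
  have L: "L2_4 \<phi>" "L2_4 \<psi>" "L2_4 \<eta>" using assms by (auto simp: reach_def)
  obtain G where G: "impl G" "\<And>\<phi>. G (E \<phi>) = \<phi>" using impl_inverse[OF E(1)] by blast
  have "norm4 (diff4 \<phi> (G \<psi>)) = norm4 (G (diff4 (E \<phi>) \<psi>))" by (simp add: impl_diff4[OF G(1)] G(2))
  also have "\<dots> = norm4 (diff4 (E \<phi>) \<psi>)"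
    by (rule impl_norm4[OF G(1) L2_4_diff4[OF impl_L2_4[OF E(1) L(1)] L(2)]])
  finally have 1: "norm4 (diff4 \<phi> (G \<psi>)) < e" using E by simp
  \<comment> \<open>The inverses are known as left inverses. \<open>H\<close> undoes
    \<open>G\<close>, so \<open>F\<close> after \<open>H\<close> carries \<open>G \<psi>\<close> to
    \<open>F \<psi>\<close>.\<close>
  obtain H where H: "impl H" "\<And>\<phi>. H (G \<phi>) = \<phi>" using impl_inverse[OF G(1)] by blast
  have "reach (G \<psi>) (F (H (G \<psi>)))"
    by (rule reach_appr[OF appr_impl[OF impl.comp[OF F(1) H(1)]] impl_L2_4[OF G(1) L(2)]])
  then have "reach (G \<psi>) (F \<psi>)" by (simp add: H(2))
  then show "\<exists>\<phi>' \<psi>'. reach \<phi>' \<psi>' \<and> norm4 (diff4 \<phi> \<phi>') < e \<and> norm4 (diff4 \<eta> \<psi>') < e"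
    using 1 F(2) norm4_diff4_commute[of \<eta> "F \<psi>"] by (intro exI[of _ "G \<psi>"] exI[of _ "F \<psi>"]) auto
qed (use assms in \<open>auto simp: reach_def\<close>)

lemma reach_norm4: assumes "reach \<phi> \<psi>" shows "norm4 \<phi> = norm4 \<psi>"
proof -
  have L: "L2_4 \<phi>" "L2_4 \<psi>" using assms by (auto simp: reach_def)
  have le: "\<bar>norm4 \<phi> - norm4 \<psi>\<bar> \<le> 0 + e" if e: "e > 0" for e :: real
  proof -
    obtain E where E: "impl E" "norm4 (diff4 (E \<phi>) \<psi>) < e" using assms e unfolding reach_def by blast
    note LE = impl_L2_4[OF E(1) L(1)]
    show ?thesis
      using norm4_le_diff4[OF LE L(2)] norm4_le_diff4[OF L(2) LE] norm4_diff4_commute[of "E \<phi>" \<psi>]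
        impl_norm4[OF E(1) L(1)] E(2) by linarith
  qed
  have "\<bar>norm4 \<phi> - norm4 \<psi>\<bar> \<le> 0" by (rule field_le_epsilon[OF le])
  then show ?thesis by simp
qed

section \<open>Spin-dependent translations and emptying of the excited levels\<close>

definition shift :: "bool \<Rightarrow> real \<Rightarrow> state \<Rightarrow> state" where
  "shift k c \<phi> j x = \<phi> j (if isg k j then x - c else x + c)"

lemma appr_gate_ok: "gate_ok k V \<Longrightarrow> appr (gate k V)"
  by (simp add: gate_ok_def)

text \<open>A pure momentum segment translates the sum and the difference of the two levels in
  opposite directions; constant rotations by pi / 4 on either side exchange these combinations with
  the levels themselves.\<close>

lemma appr_shift: "appr (shift k c)"
proof -
  have "shift k c = (\<lambda>\<phi>. gate k (\<lambda>x. ry (pi / 4 + 0 * x)) (seg k 1 0 0 c (gate k (\<lambda>x. ry (- (pi / 4) + 0 * x)) \<phi>)))"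
    by (intro ext) (simp add: shift_def gate_def seg_def weyl_def ry_def ph_def cos_45 sin_45 of_real_sqrt2_sq field_simps)
  moreover have "appr (\<lambda>\<phi>. gate k (\<lambda>x. ry (pi / 4 + 0 * x)) (seg k 1 0 0 c (gate k (\<lambda>x. ry (- (pi / 4) + 0 * x)) \<phi>)))"
    by (rule appr_comp[OF appr_gate_ok[OF gate_ok_ry] appr_comp[OF appr_impl[OF impl.seg] appr_gate_ok[OF gate_ok_ry]]]) simp
  ultimately show ?thesis by simp
qed

lemma good_left_halfline: "good k (\<lambda>x. if x < c then 1 else 0)"
proof -
  have "good k (\<lambda>x. - 1 * (if c \<le> x then 1 else 0))"
    by (rule good_mult[OF good_affine[of k "-1" 0, simplified] good_halfline])
  from good_add[OF good_affine[of k 1 0] this]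
  have "good k (\<lambda>x. (1 + 0 * x) + - 1 * (if c \<le> x then 1 else 0))" .
  moreover have "(\<lambda>x. (1 + 0 * x) + - 1 * (if c \<le> x then 1 else 0)) = (\<lambda>x. if x < c then 1 else (0::real))"
    by auto
  ultimately show ?thesis by simp
qed

text \<open>Shifting the two levels of ion \<open>k\<close> apart and flipping the excited one empties its excited level.\<close>

lemma reach_ground:
  assumes L: "L2_4 \<phi>" and supp: "\<And>j x. \<bar>x\<bar> > R \<Longrightarrow> \<phi> j x = 0" and R: "R \<ge> 0"
  shows "\<exists>\<psi>. reach \<phi> \<psi> \<and> (\<forall>j x. \<bar>x\<bar> > 2 * R + 2 \<longrightarrow> \<psi> j x = 0) \<and> (\<forall>j x. \<not> isg k j \<longrightarrow> \<psi> j x = 0)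
     \<and> (\<forall>k'. k' \<noteq> k \<longrightarrow> (\<forall>j x. \<not> isg k' j \<longrightarrow> \<phi> j x = 0) \<longrightarrow> (\<forall>j x. \<not> isg k' j \<longrightarrow> \<psi> j x = 0))"
proof -
  \<comment> \<open>After displacement by \<open>R + 1\<close> the ground level lives on x >= 1 and
    the excited one on x <= -1. A rotation by pi / 2 exchanges the levels up to sign; applied for x
    < 0 only, it lowers the excited part and meets no ground part.\<close>
  define \<psi> where "\<psi> = gate k (\<lambda>x. ry ((pi / 2) * (if x < 0 then 1 else 0))) (shift k (R + 1) \<phi>)"
  have 1: "reach \<phi> (shift k (R + 1) \<phi>)" by (rule reach_appr[OF appr_shift L])
  have "reach (shift k (R + 1) \<phi>) \<psi>"
    unfolding \<psi>_def
    by (rule reach_appr[OF appr_gate_ok[OF good_ry[OF good_left_halfline]]]) (use 1 in \<open>simp add: reach_def\<close>)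
  then have r: "reach \<phi> \<psi>" using reach_trans 1 by blast
  have g: "\<psi> j x = (if x < 0 then \<phi> (flip k j) (x + (R + 1)) else \<phi> j (x - (R + 1)))" if "isg k j" for j x
    using that by (simp add: \<psi>_def gate_def shift_def ry_def)
  have e: "\<psi> j x = 0" if "\<not> isg k j" for j x
  proof (cases "x < 0")
    case True
    then have "\<phi> (flip k j) (x - (R + 1)) = 0" using R by (intro supp) auto
    then show ?thesis using that True by (simp add: \<psi>_def gate_def shift_def ry_def)
  next
    case False
    then have "\<phi> j (x + (R + 1)) = 0" using R by (intro supp) auto
    then show ?thesis using that False by (simp add: \<psi>_def gate_def shift_def ry_def)
  qed
  have s: "\<psi> j x = 0" if "\<bar>x\<bar> > 2 * R + 2" for j x
  proof (cases "isg k j")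
    case True
    have "\<bar>x + (R + 1)\<bar> > R" "\<bar>x - (R + 1)\<bar> > R" using that R by linarith+
    then show ?thesis using g[OF True, of x] supp by auto
  qed (use e in blast)
  have o: "\<psi> j x = 0" if k': "k' \<noteq> k" "\<forall>j x. \<not> isg k' j \<longrightarrow> \<phi> j x = 0" "\<not> isg k' j" for k' j x
  proof (cases "isg k j")
    case True
    then show ?thesis using g[OF True, of x] k' isg_flip_other[OF k'(1), of j] by simp
  qed (use e in blast)
  show ?thesis using r g e s o by blast
qed

text \<open>States with the second ion in its ground level: \<open>f\<close> and \<open>g\<close>
  are the ground and excited amplitudes of the first ion.\<close>

definition pe :: "(real \<Rightarrow> complex) \<Rightarrow> (real \<Rightarrow> complex) \<Rightarrow> state" where
  "pe f g j = (if j = GG then f else if j = EG then g else (\<lambda>x. 0))"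

abbreviation gg :: "(real \<Rightarrow> complex) \<Rightarrow> state" where
  "gg f \<equiv> pe f (\<lambda>x. 0)"

lemma L2_4_pe: "L2 f \<Longrightarrow> L2 g \<Longrightarrow> L2_4 (pe f g)"
  by (simp add: L2_4_def pe_def L2_zero)

lemma L2_4_gg: "L2 f \<Longrightarrow> L2_4 (gg f)"
  by (simp add: L2_4_pe L2_zero)

lemma gate_pe: "gate True V (pe f g) = pe (\<lambda>x. fst (V x) * f x + snd (V x) * g x) (\<lambda>x. cnj (fst (V x)) * g x - cnj (snd (V x)) * f x)"
  by (intro ext, rename_tac j x, case_tac j) (simp_all add: gate_def pe_def)

lemma shift_pe: "shift True c (pe f g) = pe (\<lambda>x. f (x - c)) (\<lambda>x. g (x + c))"
  by (intro ext, rename_tac j x, case_tac j) (simp_all add: shift_def pe_def)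

lemma norm4_gg: "norm4 (gg f) = l2n f"
  by (simp add: norm4_def pe_def l2n_def)

lemma diff4_gg: "diff4 (gg f) (gg g) = gg (\<lambda>x. f x - g x)"
  by (intro ext) (simp add: diff4_def pe_def)

text \<open>The ions are emptied in turn. The support bound in \<open>reach_ground\<close> permits
  the second application, and its last clause ensures that emptying the second ion does not refill
  the first.\<close>

lemma reach_gg_compact:
  assumes L: "L2_4 \<phi>" and supp: "\<And>j x. \<bar>x\<bar> > R \<Longrightarrow> \<phi> j x = 0" and R: "R \<ge> 0"
  shows "\<exists>f. L2 f \<and> reach \<phi> (gg f)"
proof -
  obtain \<psi> where \<psi>: "reach \<phi> \<psi>" "\<forall>j x. \<bar>x\<bar> > 2 * R + 2 \<longrightarrow> \<psi> j x = 0" "\<forall>j x. \<not> isg True j \<longrightarrow> \<psi> j x = 0"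
    using reach_ground[OF L supp R, of True] by blast
  have L\<psi>: "L2_4 \<psi>" using \<psi>(1) by (simp add: reach_def)
  have "\<exists>\<eta>. reach \<psi> \<eta> \<and> (\<forall>j x. \<not> isg False j \<longrightarrow> \<eta> j x = 0) \<and> (\<forall>j x. \<not> isg True j \<longrightarrow> \<eta> j x = 0)"
  proof -
    have R': "2 * R + 2 \<ge> 0" using R by simp
    have "\<psi> j x = 0" if "\<bar>x\<bar> > 2 * R + 2" for j x using \<psi>(2) that by blast
    from reach_ground[OF L\<psi> this R', of False] obtain \<eta> where "reach \<psi> \<eta>" "\<forall>j x. \<not> isg False j \<longrightarrow> \<eta> j x = 0"
      "\<forall>k'. k' \<noteq> False \<longrightarrow> (\<forall>j x. \<not> isg k' j \<longrightarrow> \<psi> j x = 0) \<longrightarrow> (\<forall>j x. \<not> isg k' j \<longrightarrow> \<eta> j x = 0)"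
      by blast
    then show ?thesis using \<psi>(3) by blast
  qed
  then obtain \<eta> where \<eta>: "reach \<psi> \<eta>" "\<And>j x. \<not> isg False j \<Longrightarrow> \<eta> j x = 0" "\<And>j x. \<not> isg True j \<Longrightarrow> \<eta> j x = 0"
    by blast
  have "\<eta> = gg (\<eta> GG)"
  proof (intro ext)
    fix j x show "\<eta> j x = gg (\<eta> GG) j x"
      using \<eta>(2)[of j x] \<eta>(3)[of j x] by (cases j) (simp_all add: pe_def)
  qed
  moreover have "reach \<phi> \<eta>" using reach_trans \<psi>(1) \<eta>(1) by blast
  moreover have "L2 (\<eta> GG)" using \<eta>(1) by (simp add: reach_def L2_4_def)
  ultimately show ?thesis by metis
qed

section \<open>Merging the bins of a step function\<close>

text \<open>\<open>p\<close> and \<open>q\<close> are the amplitudes of the ground and excited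
  level. The phase \<open>\<alpha>\<close> gives both the argument (\<mu> + \<nu>) / 2, and
  \<open>\<beta>\<close> is the polar angle of the real vector (|p|, |q|), which is thereby turned
  onto its first axis.\<close>

lemma rotate_to_ground:
  "\<exists>\<alpha> \<beta>. of_real (cos \<beta>) * (cnj (cis \<alpha>) * q) - of_real (sin \<beta>) * (cis \<alpha> * p) = (0::complex)"
proof -
  define \<mu> \<nu> where "\<mu> = Arg p" and "\<nu> = Arg q"
  have p: "p = of_real (cmod p) * cis \<mu>" and q: "q = of_real (cmod q) * cis \<nu>"
    using rcis_cmod_Arg[of p] rcis_cmod_Arg[of q] by (simp_all add: rcis_def \<mu>_def \<nu>_def)
  define \<alpha> where "\<alpha> = (\<nu> - \<mu>) / 2"
  have 1: "cis \<alpha> * p = of_real (cmod p) * cis ((\<mu> + \<nu>) / 2)"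
  proof -
    have "cis \<alpha> * p = of_real (cmod p) * (cis \<alpha> * cis \<mu>)" by (subst p) simp
    also have "cis \<alpha> * cis \<mu> = cis ((\<mu> + \<nu>) / 2)" unfolding cis_mult \<alpha>_def by (simp add: field_simps)
    finally show ?thesis .
  qed
  have 2: "cnj (cis \<alpha>) * q = of_real (cmod q) * cis ((\<mu> + \<nu>) / 2)"
  proof -
    have "cnj (cis \<alpha>) * q = of_real (cmod q) * (cis (- \<alpha>) * cis \<nu>)" by (subst q) (simp add: cis_cnj)
    also have "cis (- \<alpha>) * cis \<nu> = cis ((\<mu> + \<nu>) / 2)" unfolding cis_mult \<alpha>_def by (simp add: field_simps)
    finally show ?thesis .
  qed
  define w where "w = Complex (cmod p) (cmod q)"
  have "w = rcis (cmod w) (Arg w)" by (simp add: rcis_cmod_Arg)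
  then have "cmod p = cmod w * cos (Arg w)" "cmod q = cmod w * sin (Arg w)"
    by (metis Re_rcis w_def complex.sel(1), metis Im_rcis w_def complex.sel(2))
  then have "cos (Arg w) * cmod q - sin (Arg w) * cmod p = 0" by (simp only:) simp
  then have "complex_of_real (cos (Arg w)) * of_real (cmod q) - of_real (sin (Arg w)) * of_real (cmod p) = 0"
    by (simp only: of_real_mult[symmetric] of_real_diff[symmetric]) simp
  then have "complex_of_real (cos (Arg w)) * (cnj (cis \<alpha>) * q) - of_real (sin (Arg w)) * (cis \<alpha> * p) = 0"
    unfolding 1 2 by (simp add: mult.assoc[symmetric] left_diff_distrib[symmetric])
  then show ?thesis by blast
qed

lemma step_Suc: "step a d c (Suc n) x = step a d c n x + c n * indicator {a + real n * d..<a + real (Suc n) * d} x"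
  by (simp add: step_def)

lemma step_translate: "step a d c n (x - h) = step (a + h) d c n x"
proof -
  have "indicator {a + u..<a + v} (x - h) = (indicator {a + h + u..<a + h + v} x :: complex)" for u v
    by (auto simp: indicator_def)
  then show ?thesis by (simp add: step_def)
qed

lemma step_cong: "(\<And>i. i < n \<Longrightarrow> c i = c' i) \<Longrightarrow> step a d c n x = step a d c' n x"
  unfolding step_def by (intro sum.cong) auto

text \<open>Lift the last bin to the excited level, slide it over the previous one by shifting the two
  levels against each other, and rotate the two amplitudes into the ground level.\<close>

lemma merge_last_bin:
  assumes d: "d > 0"
  shows "\<exists>a' c'. reach (gg (step a d c (Suc (Suc m)))) (gg (step a' d c' (Suc m)))"
proof -
  let ?n = "Suc m"
  define p where "p = a + real ?n * d"
  \<comment> \<open>The levels move by \<open>d / 2\<close> in opposite directions, hence by one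
    whole bin relative to each other.\<close>
  define a' where "a' = a + d / 2"
  define q where "q = a' + real m * d"
  let ?I = "\<lambda>x. indicator {p..<p + d} x :: complex" and ?J = "\<lambda>x. indicator {q..<q + d} x :: complex"
  have pd: "a + real (Suc ?n) * d = p + d" by (simp add: p_def algebra_simps)
  have qd: "a' + real (Suc m) * d = q + d" by (simp add: q_def algebra_simps)
  have LI: "L2 (\<lambda>x. k * ?I x)" "L2 (\<lambda>x. k * ?J x)" for k by (rule L2_indicator)+
  define f0 where "f0 = step a d c (Suc ?n)"
  have f0: "f0 x = step a d c ?n x + c ?n * ?I x" for x
    unfolding f0_def step_Suc[of a d c ?n] pd by (simp add: p_def)
  have z0: "step a d c ?n x = 0" if "x \<ge> p" for x by (rule step_outside[OF d]) (use that in \<open>simp add: p_def\<close>)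
  have 1: "reach (gg f0) (pe (step a d c ?n) (\<lambda>x. - c ?n * ?I x))"
  proof -
    \<comment> \<open>The minus sign stems from the second row of the matrix: a rotation by pi / 2
      puts minus the ground amplitude into the excited level.\<close>
    have h: "gate True (\<lambda>x. ry ((pi / 2) * (if p \<le> x then 1 else 0))) (gg f0) = pe (step a d c ?n) (\<lambda>x. - c ?n * ?I x)"
      unfolding gate_pe
      by (intro arg_cong2[where f=pe] ext) (use z0 in \<open>auto simp: ry_def f0 indicator_def\<close>)
    show ?thesis
      by (subst h[symmetric], rule reach_appr[OF appr_gate_ok[OF good_ry[OF good_halfline]]])
        (simp add: L2_4_gg f0_def L2_step)
  qed
  have 2: "reach (pe (step a d c ?n) (\<lambda>x. - c ?n * ?I x)) (pe (step a' d c ?n) (\<lambda>x. - c ?n * ?J x))"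
  proof -
    have "?I (x + d / 2) = ?J x" for x by (auto simp: indicator_def p_def q_def a'_def algebra_simps)
    then have h: "shift True (d / 2) (pe (step a d c ?n) (\<lambda>x. - c ?n * ?I x)) = pe (step a' d c ?n) (\<lambda>x. - c ?n * ?J x)"
      unfolding shift_pe by (simp add: step_translate a'_def)
    show ?thesis
      by (subst h[symmetric], rule reach_appr[OF appr_shift L2_4_pe[OF L2_step LI(1)]])
  qed
  obtain \<alpha> \<beta> where ab: "of_real (cos \<beta>) * (cnj (cis \<alpha>) * (- c ?n)) - of_real (sin \<beta>) * (cis \<alpha> * c m) = 0"
    using rotate_to_ground by blast
  define C where "C = of_real (cos \<beta>) * (cis \<alpha> * c m) + of_real (sin \<beta>) * (cnj (cis \<alpha>) * (- c ?n))"
  let ?H = "\<lambda>x. if q \<le> x then 1 else (0::real)"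
  \<comment> \<open>From \<open>q\<close> on, only the two superposed bins are present, so the
    rotation just found can be switched on there without disturbing the other bins.\<close>
  let ?V = "\<lambda>x. qmul (ry (\<beta> * ?H x)) (rz (\<alpha> * ?H x))"
  have V: "gate_ok True ?V"
    using good_halfline[of True q] by (intro gate_ok_mult good_ry) (auto simp: good_def)
  have 3: "reach (pe (step a' d c ?n) (\<lambda>x. - c ?n * ?J x)) (gg (step a' d (c(m := C)) ?n))"
  proof -
    have s: "step a' d c ?n x = step a' d c m x + c m * ?J x" "step a' d (c(m := C)) ?n x = step a' d c m x + C * ?J x" for x
    proof -
      show "step a' d c ?n x = step a' d c m x + c m * ?J x"
        unfolding step_Suc[of a' d c m] qd by (simp add: q_def)
      have "step a' d (c(m := C)) m x = step a' d c m x" by (rule step_cong) auto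
      then show "step a' d (c(m := C)) ?n x = step a' d c m x + C * ?J x"
        unfolding step_Suc[of a' d _ m] qd by (simp add: q_def)
    qed
    have z: "step a' d c m x = 0" if "x \<ge> q" for x by (rule step_outside[OF d]) (use that in \<open>simp add: q_def\<close>)
    have h: "gate True ?V (pe (step a' d c ?n) (\<lambda>x. - c ?n * ?J x)) = gg (step a' d (c(m := C)) ?n)"
      unfolding gate_pe
    proof (intro arg_cong2[where f=pe] ext)
      fix x
      show "fst (?V x) * step a' d c ?n x + snd (?V x) * (- c ?n * ?J x) = step a' d (c(m := C)) ?n x"
        unfolding s by (cases "q \<le> x") (use z in \<open>auto simp: qmul_def ry_def rz_def C_def indicator_def algebra_simps\<close>)
      show "cnj (fst (?V x)) * (- c ?n * ?J x) - cnj (snd (?V x)) * step a' d c ?n x = 0"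
        unfolding s using ab by (cases "q \<le> x") (use z in \<open>auto simp: qmul_def ry_def rz_def indicator_def algebra_simps\<close>)
    qed
    show ?thesis
      by (subst h[symmetric], rule reach_appr[OF appr_gate_ok[OF V] L2_4_pe[OF L2_step LI(2)]])
  qed
  have "reach (gg (step a d c (Suc ?n))) (gg (step a' d (c(m := C)) ?n))"
    using reach_trans[OF 1 reach_trans[OF 2 3]] by (simp add: f0_def)
  then show ?thesis by blast
qed

lemma merge_bins:
  assumes d: "d > 0"
  shows "\<exists>a' C. reach (gg (step a d c n)) (gg (\<lambda>x. C * indicator {a'..<a' + d} x))"
proof (cases n)
  case 0
  then have "gg (step a d c n) = gg (\<lambda>x. 0 * indicator {a..<a + d} x)" by (simp add: step_def[abs_def])
  then show ?thesis using reach_refl[OF L2_4_gg[OF L2_indicator[of 0 a "a + d"]]] by metis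
next
  case (Suc m)
  have "\<exists>a' C. reach (gg (step a d c (Suc m))) (gg (\<lambda>x. C * indicator {a'..<a' + d} x))"
  proof (induction m arbitrary: a c)
    case 0
    have "gg (step a d c (Suc 0)) = gg (\<lambda>x. c 0 * indicator {a..<a + d} x)"
      by (rule arg_cong2[where f=pe]) (auto simp: step_def fun_eq_iff)
    then show ?case using reach_refl[OF L2_4_gg[OF L2_indicator[of "c 0" a "a + d"]]] by metis
  next
    case (Suc m)
    then show ?case using merge_last_bin[OF d, of a c m] reach_trans by blast
  qed
  then show ?thesis using Suc by simp
qed

lemma l2n_indicator: assumes "d > 0" shows "l2n (\<lambda>x. c * indicator {a..<a + d} x) = cmod c * sqrt d"
proof -
  have "(\<integral>x. (cmod (indicator {a..<a + d} x :: complex))\<^sup>2 \<partial>lborel) = (\<integral>x. indicator {a..<a + d} x \<partial>lborel)"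
    by (rule Bochner_Integration.integral_cong) (auto simp: indicator_def)
  also have "\<dots> = d" using assms by simp
  finally have "l2n (indicator {a..<a + d}) = sqrt d" by (simp add: l2n_def)
  then show ?thesis by (simp add: l2n_cmult)
qed

text \<open>A translation and a constant phase rotation normalise position and argument of the last
  remaining bin; its modulus is then dictated by conservation of the norm.\<close>

lemma reach_step_unit_bin:
  assumes d: "d > 0"
  shows "reach (gg (step a d c n)) (gg (\<lambda>x. of_real (l2n (step a d c n) / sqrt d) * indicator {0..<d} x))"
proof -
  obtain a' C where 1: "reach (gg (step a d c n)) (gg (\<lambda>x. C * indicator {a'..<a' + d} x))"
    using merge_bins[OF d] by blast
  have "shift True (- a') (gg (\<lambda>x. C * indicator {a'..<a' + d} x)) = gg (\<lambda>x. C * indicator {0..<d} x)"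
    unfolding shift_pe by (intro arg_cong2[where f=pe] ext) (auto simp: indicator_def)
  then have 2: "reach (gg (\<lambda>x. C * indicator {a'..<a' + d} x)) (gg (\<lambda>x. C * indicator {0..<d} x))"
    using reach_appr[OF appr_shift[of True "- a'"] L2_4_gg[OF L2_indicator[of C a' "a' + d"]]] by simp
  have "cis (- Arg C) * C = of_real (cmod C)"
    using rcis_cmod_Arg[of C] by (metis add.left_inverse cis_mult cis_zero mult.commute mult.left_commute mult_1_right rcis_def)
  then have "gate True (\<lambda>x. rz ((- Arg C) * (1 + 0 * x))) (gg (\<lambda>x. C * indicator {0..<d} x)) = gg (\<lambda>x. of_real (cmod C) * indicator {0..<d} x)"
    unfolding gate_pe by (intro arg_cong2[where f=pe] ext) (simp_all add: rz_def mult.assoc[symmetric])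
  moreover have "gate_ok True (\<lambda>x. rz ((- Arg C) * (1 + 0 * x)))"
    using good_affine[of True 1 0] by (simp only: good_def)
  ultimately have 3: "reach (gg (\<lambda>x. C * indicator {0..<d} x)) (gg (\<lambda>x. of_real (cmod C) * indicator {0..<d} x))"
    using reach_appr[OF appr_gate_ok L2_4_gg[OF L2_indicator[of C 0 d]]] by metis
  have r: "reach (gg (step a d c n)) (gg (\<lambda>x. of_real (cmod C) * indicator {0..<d} x))"
    using reach_trans[OF 1 reach_trans[OF 2 3]] .
  have "l2n (step a d c n) = cmod C * sqrt d"
    using reach_norm4[OF r] l2n_indicator[OF d, of "of_real (cmod C)" 0] by (simp add: norm4_gg)
  then have "cmod C = l2n (step a d c n) / sqrt d" using d by simp
  then show ?thesis using r by simp
qed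

section \<open>The common reference state\<close>

definition base :: "real \<Rightarrow> state" where
  "base N = gg (\<lambda>x. of_real N * indicator {0..<1} x)"

text \<open>The reference state is itself a step function, with \<open>Suc m\<close> bins of the
  same width. Both states fold into the same single bin, and reversibility joins them.\<close>

lemma reach_step_base: "reach (gg (step a (1 / real (Suc m)) c n)) (base (l2n (step a (1 / real (Suc m)) c n)))"
proof -
  let ?d = "1 / real (Suc m)"
  define N where "N = l2n (step a ?d c n)"
  have N: "N \<ge> 0" by (simp add: N_def)
  have "step 0 ?d (\<lambda>_. of_real N) (Suc m) = (\<lambda>x. of_real N * indicator {0..<1} x)"
  proof
    fix x
    have e: "0 + real (Suc m) * ?d = 1" by simp
    show "step 0 ?d (\<lambda>_. of_real N) (Suc m) x = of_real N * indicator {0..<1} x"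
    proof (cases "0 \<le> x \<and> x < 1")
      case True
      then obtain k where "k < Suc m" "0 + real k * ?d \<le> x" "x < 0 + real (Suc k) * ?d"
        using step_floor[of ?d 0 x "Suc m"] e by auto
      then show ?thesis using step_inside[of ?d k "Suc m" 0 x "\<lambda>_. of_real N"] True by (auto simp: indicator_def)
    next
      case False
      then have "step 0 ?d (\<lambda>_. of_real N) (Suc m) x = 0" by (intro step_outside) (use e in auto)
      then show ?thesis using False by (auto simp: indicator_def)
    qed
  qed
  moreover have "l2n (\<lambda>x. of_real N * indicator {0..<1} x) = N"
    using l2n_indicator[of 1 "of_real N" 0] N by simp
  ultimately have "reach (base N) (gg (\<lambda>x. of_real (N / sqrt ?d) * indicator {0..<?d} x))"
    using reach_step_unit_bin[of ?d 0 "\<lambda>_. of_real N" "Suc m"] by (simp add: base_def)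
  moreover have "reach (gg (step a ?d c n)) (gg (\<lambda>x. of_real (N / sqrt ?d) * indicator {0..<?d} x))"
    unfolding N_def by (rule reach_step_unit_bin) simp
  ultimately show ?thesis unfolding N_def using reach_sym reach_trans by blast
qed

lemma L2_4_base: "L2_4 (base N)"
  unfolding base_def by (intro L2_4_gg L2_indicator)

lemma norm4_diff4_base: "norm4 (diff4 (base M) (base N)) = \<bar>M - N\<bar>"
proof -
  have "diff4 (base M) (base N) = gg (\<lambda>x. of_real (M - N) * indicator {0..<0 + 1} x)"
    unfolding base_def diff4_gg by (simp add: left_diff_distrib)
  then show ?thesis using l2n_indicator[of 1 "of_real (M - N)" 0] by (simp only: norm4_gg norm_of_real) simp
qed

text \<open>\<open>base\<close> depends continuously on the norm, so replacing \<open>f\<close> by a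
  nearby step function moves the target equally little.\<close>

lemma reach_gg_base: assumes f: "L2 f" shows "reach (gg f) (base (l2n f))"
proof (rule reach_closed[OF L2_4_gg[OF f] L2_4_base])
  fix e :: real assume "e > 0"
  then obtain a m c n where s: "l2n (\<lambda>x. f x - step a (1 / real (Suc m)) c n x) < e" using step_dense[OF f] by blast
  let ?s = "step a (1 / real (Suc m)) c n"
  have 1: "norm4 (diff4 (gg f) (gg ?s)) < e" using s by (simp add: diff4_gg norm4_gg)
  note L = L2_4_gg[OF f] L2_4_gg[OF L2_step[of a "1 / real (Suc m)" c n]]
  have "l2n f \<le> norm4 (diff4 (gg f) (gg ?s)) + l2n ?s" "l2n ?s \<le> norm4 (diff4 (gg f) (gg ?s)) + l2n f"
    using norm4_le_diff4[OF L] norm4_le_diff4[OF L(2,1)] norm4_diff4_commute[of "gg f" "gg ?s"]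
    by (simp_all only: norm4_gg)
  then have "\<bar>l2n f - l2n ?s\<bar> < e" using 1 by linarith
  then show "\<exists>\<phi>' \<psi>'. reach \<phi>' \<psi>' \<and> norm4 (diff4 (gg f) \<phi>') < e \<and> norm4 (diff4 (base (l2n f)) \<psi>') < e"
    using 1 reach_step_base[of a m c n] by (intro exI[of _ "gg ?s"] exI[of _ "base (l2n ?s)"]) (simp add: norm4_diff4_base)
qed

text \<open>Emptying the excited levels uses compact support, hence the truncation; the target moves
  only by the change of the norm.\<close>

lemma reach_base: assumes L: "L2_4 \<phi>" shows "reach \<phi> (base (norm4 \<phi>))"
proof (rule reach_closed[OF L L2_4_base])
  fix e :: real assume e: "e > 0"
  define \<psi> :: "nat \<Rightarrow> state" where "\<psi> n j x = (if \<bar>x\<bar> \<le> real n then \<phi> j x else 0)" for n j x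
  have [measurable]: "\<phi> j \<in> borel_measurable borel" for j using L2_measurable[OF L2_4D[OF L]] .
  have m[measurable]: "\<psi> n j \<in> borel_measurable borel" for n j unfolding \<psi>_def by measurable
  have L\<psi>: "L2_4 (\<psi> n)" for n
    unfolding L2_4_def
    using L2_integrable[OF L2_4D[OF L]] by (auto intro!: L2_dominated[OF m] simp: \<psi>_def)
  have "(\<lambda>n. norm4 (diff4 (\<psi> n) \<phi>)) \<longlonglongrightarrow> 0"
    unfolding norm4_tendsto_0_iff diff4_def
  proof
    fix j
    show "(\<lambda>n. l2n (\<lambda>x. \<psi> n j x - \<phi> j x)) \<longlonglongrightarrow> 0"
    proof (rule l2n_dominated_convergence[OF m _ L2_integrable[OF L2_4D[OF L, of j]]])
      show "AE x in lborel. (\<lambda>n. \<psi> n j x) \<longlonglongrightarrow> \<phi> j x"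
      proof (rule AE_I2)
        fix x
        obtain N where "\<bar>x\<bar> \<le> real N" using real_arch_simple by blast
        then have "\<forall>n\<ge>N. \<psi> n j x = \<phi> j x" by (auto simp: \<psi>_def)
        then have "\<forall>\<^sub>F n in sequentially. \<psi> n j x = \<phi> j x" unfolding eventually_sequentially by blast
        then show "(\<lambda>n. \<psi> n j x) \<longlonglongrightarrow> \<phi> j x" by (rule tendsto_eventually)
      qed
    qed (auto simp: \<psi>_def)
  qed
  then obtain n where n: "norm4 (diff4 (\<psi> n) \<phi>) < e" using tendsto_0_less e by blast
  obtain f where f: "L2 f" "reach (\<psi> n) (gg f)"
    using reach_gg_compact[OF L\<psi>, of "real n" n] by (auto simp: \<psi>_def)
  have "l2n f = norm4 (\<psi> n)" using reach_norm4[OF f(2)] by (simp add: norm4_gg)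
  then have r: "reach (\<psi> n) (base (norm4 (\<psi> n)))" using reach_trans[OF f(2) reach_gg_base[OF f(1)]] by simp
  have "\<bar>norm4 \<phi> - norm4 (\<psi> n)\<bar> < e"
    using n norm4_le_diff4[OF L L\<psi>[of n]] norm4_le_diff4[OF L\<psi>[of n] L] norm4_diff4_commute[of \<phi> "\<psi> n"] by linarith
  then show "\<exists>\<phi>' \<psi>'. reach \<phi>' \<psi>' \<and> norm4 (diff4 \<phi> \<phi>') < e \<and> norm4 (diff4 (base (norm4 \<phi>)) \<psi>') < e"
    using r n norm4_diff4_commute[of \<phi> "\<psi> n"]
    by (intro exI[of _ "\<psi> n"] exI[of _ "base (norm4 (\<psi> n))"]) (simp add: norm4_diff4_base)
qed

theorem mainTheorem1:
  fixes \<epsilon> M :: real and phi0 phiT :: state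
  assumes "\<epsilon> > 0" and "M > 0"
    and "L2_4 phi0" and "L2_4 phiT"
    and "norm4 phi0 = norm4 phiT"
  shows "\<exists>T0>0. \<forall>T>T0. \<exists>u1 u1r u1b u2 u2r u2b.
           Linf_ctrl T M u1 \<and> Linf_ctrl T M u1r \<and> Linf_ctrl T M u1b
         \<and> Linf_ctrl T M u2 \<and> Linf_ctrl T M u2r \<and> Linf_ctrl T M u2b
         \<and> (\<exists>phi. is_solution u1 u1r u1b u2 u2r u2b T phi0 phi)
         \<and> (\<forall>phi. is_solution u1 u1r u1b u2 u2r u2b T phi0 phi
                   \<longrightarrow> norm4 (diff4 (phi T) phiT) < \<epsilon>)"
proof -
  have "reach phi0 phiT"
    using reach_trans[OF reach_base[OF assms(3)]] reach_sym[OF reach_base[OF assms(4)]] assms(5) by simp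
  then obtain E where E: "impl E" "norm4 (diff4 (E phi0) phiT) < \<epsilon>"
    using assms(1) unfolding reach_def by blast
  \<comment> \<open>The bound \<open>M / 2\<close> leaves the strict gap below \<open>M\<close> that
    \<open>Linf_ctrl\<close> asks for.\<close>
  obtain u S where u: "steers u S E" "\<And>m. (\<lambda>t. u t m) \<in> borel_measurable borel" "\<And>t m. cmod (u t m) \<le> M / 2"
    using impl_steers[OF E(1), of "M / 2"] assms(2) by auto
  have S: "S \<ge> 0" using u(1) by (simp add: steers_def)
  show ?thesis
  \<comment> \<open>Only \<open>S \<ge> 0\<close> is known, whereas \<open>T0\<close> must be
    positive.\<close>
  proof (intro exI[of _ "S + 1"] conjI allI impI)
    show "S + 1 > 0" using S by simp
    fix T assume T: "T > S + 1"
    \<comment> \<open>Zero controls keep the state fixed and fill the time from \<open>S\<close> to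
      \<open>T\<close>.\<close>
    define idle where "idle = (\<lambda>_ :: real. seg_ctrl True 1 0 0 0)"
    define v where "v = cat S u idle"
    have "steers idle (T - S) (\<lambda>\<phi>. \<phi>)"
      using steers_seg[of 1 "T - S" True 0 0 0] T by (simp add: idle_def seg_zero[abs_def])
    from steers_cat[OF u(1) this] have st: "steers v T E" by (simp add: v_def)
    have ctrl: "Linf_ctrl T M (\<lambda>t. v t m)" for m
      unfolding Linf_ctrl_def
    proof (intro conjI exI[of _ "M / 2"] ballI)
      have [measurable]: "(\<lambda>t. u t m) \<in> borel_measurable borel" using u(2) .
      have "(\<lambda>t. v t m) = (\<lambda>t. if t < S then u t m else seg_ctrl True 1 0 0 0 m)"
        by (auto simp: v_def cat_def idle_def)
      then show "(\<lambda>t. v t m) \<in> borel_measurable lborel" by simp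
      show "cmod (v t m) \<le> M / 2" for t
        using u(3)[of t m] seg_ctrl_le[of 1 True 0 0 0 m] assms(2) by (simp add: v_def cat_def idle_def)
    qed (use assms(2) in simp)
    have sol: "\<exists>\<psi>. sol v T phi0 \<psi>" "\<And>\<psi>. sol v T phi0 \<psi> \<Longrightarrow> norm4 (diff4 (\<psi> T) (E phi0)) = 0"
      using st assms(3) by (auto simp: steers_def)
    have "norm4 (diff4 (\<psi> T) phiT) < \<epsilon>" if "sol v T phi0 \<psi>" for \<psi>
    proof -
      have "L2_4 (\<psi> T)" using that T S by (auto simp: sol_iff)
      then show ?thesis
        using norm4_diff4_triangle[OF _ impl_L2_4[OF E(1) assms(3)] assms(4), of "\<psi> T"] sol(2)[OF that] E(2) by simp
    qed
    then show "\<exists>u1 u1r u1b u2 u2r u2b.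
           Linf_ctrl T M u1 \<and> Linf_ctrl T M u1r \<and> Linf_ctrl T M u1b
         \<and> Linf_ctrl T M u2 \<and> Linf_ctrl T M u2r \<and> Linf_ctrl T M u2b
         \<and> (\<exists>phi. is_solution u1 u1r u1b u2 u2r u2b T phi0 phi)
         \<and> (\<forall>phi. is_solution u1 u1r u1b u2 u2r u2b T phi0 phi
                   \<longrightarrow> norm4 (diff4 (phi T) phiT) < \<epsilon>)"
      using ctrl sol(1) unfolding sol_def by blast
  qed
qed

end
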